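(* Let $\alpha>0$. The heat kernel $Z(x,t)$ is the transition density (via $p(t,x,y)=Z(x-y,t)$, $t>0$, $x,y\in\mathbb{A}_f$) of a time and space homogeneous Markov process on $\mathbb{A}_f$ which is bounded, right-continuous and has no discontinuities other than jumps.
   Context: Fix a strictly increasing sequence of natural numbers $\{e^{\psi(n)}\}_{n\ge 0}$ with $e^{\psi(0)}=1$, totally ordered by divisibility (so $e^{\psi(n)}\mid e^{\psi(n+1)}$) and cofinal in $\mathbb{N}$ for divisibility (every natural number divides some $e^{\psi(n)}$). Here $\psi(n)=\log(e^{\psi(n)})$, extended to $n\in\mathbb{Z}$ by $\psi(-n)=-\psi(n)$. Put $e^{\Lambda(n)}=e^{\psi(n)}/e^{\psi(n-1)}$, $n\in\mathbb{Z}$. For $x\in\mathbb{Q}$ let $\mathrm{ord}(x)=\max\{n\in\mathbb{Z}:x\in e^{\psi(n)}\mathbb{Z}\}$ if $x\ne0$, and $\mathrm{ord}(0)=\infty$. The ring of finite adeles $\mathbb{A}_f$ is the completion of $\mathbb{Q}$ for the ultrametric $d(x,y)=e^{-\psi(\mathrm{ord}(x-y))}$; $\mathrm{ord}$ extends to $\mathbb{A}_f$, and $\|x\|=e^{-\psi(\mathrm{ord}(x))}$, $\|0\|=0$. Every nonzero $x\in\mathbb{A}_f$ is uniquely a convergent series $x=\sum_{l\ge\gamma}x_le^{\psi(l)}$ with $x_l\in\{0,\dots,e^{\Lambda(l+1)}-1\}$, $x_\gamma\neq0$, $\gamma=\mathrm{ord}(x)$; its fractional part is $\{x\}=\sum_{l=\gamma}^{-1}x_le^{\psi(l)}\in\mathbb{Q}$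 if $\gamma<0$ and $\{x\}=0$ otherwise. The canonical character of $\mathbb{A}_f$ is $\chi(x)=\exp(2\pi i\{x\})$. The Haar measure $dx$ on $\mathbb{A}_f$ is normalized so that the unit ball $\widehat{\mathbb{Z}}=\{\|x\|\le1\}$ has measure $1$. The heat kernel is $Z(x,t)=\int_{\mathbb{A}_f}\chi(-x\xi)\exp(-t\|\xi\|^\alpha)\,d\xi$, $t>0$, $x\in\mathbb{A}_f$. The transition function is, for Borel sets $B\subset\mathbb{A}_f$, $P(t,x,B)=\int_B Z(x-y,t)\,dy$ for $t>0$ and $P(0,x,B)=1_B(x)$; this is what "time and space homogeneous" with transition density $Z$ refers to. Terminology for Markov processes (as in Dynkin): "bounded" means that each trajectory stays in a relatively compact set on every finite time interval; "no discontinuities other than jumps" means that trajectories have left limits in the state space at every $t>0$. *)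

theory Defs
  imports "HOL-Probability.Probability"
begin

section \<open>The filtration of the rationals\<close>

text \<open>The sequence \<open>a n\<close> is $e^{\psi(n)}$ for $n \ge 0$.\<close>

definition adelic_sequence :: "(nat \<Rightarrow> nat) \<Rightarrow> bool" where
  "adelic_sequence a \<longleftrightarrow>
     strict_mono a \<and> a 0 = 1 \<and> (\<forall>n. a n dvd a (Suc n)) \<and> (\<forall>m>0. \<exists>n. m dvd a n)"

definition psi :: "(nat \<Rightarrow> nat) \<Rightarrow> int \<Rightarrow> real" where
  "psi a n = (if 0 \<le> n then ln (real (a (nat n))) else - ln (real (a (nat (- n)))))"

text \<open>$e^{\psi(n)}$ for $n \in \mathbb{Z}$, as a rational number; see \<open>exp_psi\<close> below.\<close>

definition epsi :: "(nat \<Rightarrow> nat) \<Rightarrow> int \<Rightarrow> rat" where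
  "epsi a n = (if 0 \<le> n then of_nat (a (nat n)) else inverse (of_nat (a (nat (- n)))))"

definition eLambda :: "(nat \<Rightarrow> nat) \<Rightarrow> int \<Rightarrow> rat" where
  "eLambda a n = epsi a n / epsi a (n - 1)"

lemma exp_psi:
  assumes "adelic_sequence a"
  shows "exp (psi a n) = of_rat (epsi a n)"
proof -
  have "a m > 0" for m
    using assms strict_mono_less_eq[of a 0 m] by (auto simp: adelic_sequence_def)
  then show ?thesis
    by (simp add: psi_def epsi_def exp_minus of_rat_inverse)
qed

text \<open>Only meaningful for nonzero arguments; \<open>0\<close>, whose order is $\infty$, is treated
  separately wherever the order is used.\<close>

definition rat_ord :: "(nat \<Rightarrow> nat) \<Rightarrow> rat \<Rightarrow> int" where
  "rat_ord a x = (GREATEST n. \<exists>k::int. x = epsi a n * of_int k)"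

definition rat_dist :: "(nat \<Rightarrow> nat) \<Rightarrow> rat \<Rightarrow> rat \<Rightarrow> real" where
  "rat_dist a x y = (if x = y then 0 else exp (- psi a (rat_ord a (x - y))))"


section \<open>The ring of finite adeles\<close>

text \<open>As the metric depends on the sequence \<open>a\<close>, so does the completion, and it cannot be a single
  type.  Instead, a complete metric topological ring \<open>'a\<close> is the ring of finite adeles
  for \<open>a\<close> when the rationals with the ultrametric of \<open>a\<close> embed in it isometrically, as a subring,
  with dense image; this determines it up to a unique isometric ring isomorphism.  Second
  countability, which is part of \<^class>\<open>polish_space\<close>, is no restriction: it follows from the density
  of the countable set of rationals.\<close>

class polish_ring = polish_space + comm_ring_1 + topological_ab_group_add + topological_semigroup_mult

definition finite_adeles :: "(nat \<Rightarrow> nat) \<Rightarrow> (rat \<Rightarrow> 'a::polish_ring) \<Rightarrow> bool" where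
  "finite_adeles a emb \<longleftrightarrow>
     emb 1 = 1 \<and> (\<forall>x y. emb (x + y) = emb x + emb y) \<and> (\<forall>x y. emb (x * y) = emb x * emb y) \<and>
     (\<forall>x y. dist (emb x) (emb y) = rat_dist a x y) \<and>
     closure (range emb) = UNIV"

text \<open>The order is locally constant on the nonzero rationals; its extension to a nonzero adele \<open>x\<close> is
  the common value at all rationals close to \<open>x\<close>.\<close>

definition adele_ord :: "(nat \<Rightarrow> nat) \<Rightarrow> (rat \<Rightarrow> 'a::polish_ring) \<Rightarrow> 'a \<Rightarrow> int" where
  "adele_ord a emb x = (THE n. \<forall>\<^sub>F q in filtercomap emb (nhds x). rat_ord a q = n)"

definition adele_norm :: "(nat \<Rightarrow> nat) \<Rightarrow> (rat \<Rightarrow> 'a::polish_ring) \<Rightarrow> 'a \<Rightarrow> real" where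
  "adele_norm a emb x = (if x = 0 then 0 else exp (- psi a (adele_ord a emb x)))"

text \<open>The digits of a nonzero adele, extended by zero below its order.\<close>

definition adele_digits :: "(nat \<Rightarrow> nat) \<Rightarrow> (rat \<Rightarrow> 'a::polish_ring) \<Rightarrow> 'a \<Rightarrow> int \<Rightarrow> nat" where
  "adele_digits a emb x = (THE c. let \<gamma> = adele_ord a emb x in
     (\<forall>l<\<gamma>. c l = 0) \<and> c \<gamma> \<noteq> 0 \<and> (\<forall>l\<ge>\<gamma>. of_nat (c l) \<le> eLambda a (l + 1) - 1) \<and>
     (\<lambda>k::nat. emb (of_nat (c (\<gamma> + int k)) * epsi a (\<gamma> + int k))) sums x)"

definition adele_frac :: "(nat \<Rightarrow> nat) \<Rightarrow> (rat \<Rightarrow> 'a::polish_ring) \<Rightarrow> 'a \<Rightarrow> rat" where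
  "adele_frac a emb x =
     (if x \<noteq> 0 \<and> adele_ord a emb x < 0
      then \<Sum>l = adele_ord a emb x..-1. of_nat (adele_digits a emb x l) * epsi a l
      else 0)"

definition adele_char :: "(nat \<Rightarrow> nat) \<Rightarrow> (rat \<Rightarrow> 'a::polish_ring) \<Rightarrow> 'a \<Rightarrow> complex" where
  "adele_char a emb x = exp (2 * of_real pi * \<i> * of_rat (adele_frac a emb x))"

text \<open>On a second countable locally compact group, regularity of a Borel measure is
  automatic from finiteness on compact sets.\<close>

definition haar_measure :: "'a::polish_ring measure \<Rightarrow> bool" where
  "haar_measure \<mu> \<longleftrightarrow>
     sets \<mu> = sets borel \<and>
     (\<forall>x. \<forall>A\<in>sets borel. emeasure \<mu> ((\<lambda>y. x + y) ` A) = emeasure \<mu> A) \<and>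
     (\<forall>K. compact K \<longrightarrow> emeasure \<mu> K < \<infinity>) \<and>
     (\<forall>U. open U \<and> U \<noteq> {} \<longrightarrow> 0 < emeasure \<mu> U)"

definition normalized_haar ::
    "(nat \<Rightarrow> nat) \<Rightarrow> (rat \<Rightarrow> 'a::polish_ring) \<Rightarrow> 'a measure \<Rightarrow> bool" where
  "normalized_haar a emb \<mu> \<longleftrightarrow> haar_measure \<mu> \<and> emeasure \<mu> {x. adele_norm a emb x \<le> 1} = 1"


section \<open>The heat kernel\<close>

definition heat_kernel ::
    "(nat \<Rightarrow> nat) \<Rightarrow> (rat \<Rightarrow> 'a::polish_ring) \<Rightarrow> 'a measure \<Rightarrow> real \<Rightarrow> 'a \<Rightarrow> real \<Rightarrow> complex" where
  "heat_kernel a emb \<mu> \<alpha> x t =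
     (LINT \<xi>|\<mu>. adele_char a emb (- (x * \<xi>)) * of_real (exp (- t * adele_norm a emb \<xi> powr \<alpha>)))"

text \<open>The measure $B \mapsto P(t,x,B)$.  The real part is only there for typing.\<close>

definition heat_transition ::
    "(nat \<Rightarrow> nat) \<Rightarrow> (rat \<Rightarrow> 'a::polish_ring) \<Rightarrow> 'a measure \<Rightarrow> real \<Rightarrow> real \<Rightarrow> 'a \<Rightarrow> 'a measure" where
  "heat_transition a emb \<mu> \<alpha> t x =
     (if t = 0 then return borel x
      else density \<mu> (\<lambda>y. ennreal (Re (heat_kernel a emb \<mu> \<alpha> (x - y) t))))"


section \<open>Markov processes\<close>

text \<open>Conservative, time homogeneous transition functions; times are the reals \<open>t \<ge> 0\<close>.\<close>

definition transition_function :: "(real \<Rightarrow> 'a \<Rightarrow> 'a::topological_space measure) \<Rightarrow> bool" where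
  "transition_function P \<longleftrightarrow>
     (\<forall>t\<ge>0. P t \<in> borel \<rightarrow>\<^sub>M prob_algebra borel) \<and>
     (\<forall>x. P 0 x = return borel x) \<and>
     (\<forall>s\<ge>0. \<forall>t\<ge>0. \<forall>x. P (s + t) x = P s x \<bind> P t)"

definition space_homogeneous ::
    "(real \<Rightarrow> 'a \<Rightarrow> 'a::{topological_space, plus} measure) \<Rightarrow> bool" where
  "space_homogeneous P \<longleftrightarrow>
     (\<forall>t\<ge>0. \<forall>x z. P t (x + z) = distr (P t x) borel (\<lambda>y. y + z))"

text \<open>A time homogeneous Markov process with infinite lifetime, in the sense of Dynkin:
  \<open>S\<close> is the sample space with its \<open>\<sigma>\<close>-algebra of events, \<open>F\<close> the filtration,
  \<open>M x\<close> the law of the process started at \<open>x\<close>, and \<open>X t \<omega>\<close> the position at time \<open>t\<close>.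
  The last condition is Dynkin's requirement that the sample space be closed under time shifts.\<close>

definition markov_process ::
    "(real \<Rightarrow> 'a \<Rightarrow> 'a::topological_space measure) \<Rightarrow> 'w measure \<Rightarrow> (real \<Rightarrow> 'w measure) \<Rightarrow>
     ('a \<Rightarrow> 'w measure) \<Rightarrow> (real \<Rightarrow> 'w \<Rightarrow> 'a) \<Rightarrow> bool" where
  "markov_process P S F M X \<longleftrightarrow>
     transition_function P \<and>
     (\<forall>x. prob_space (M x) \<and> sets (M x) = sets S) \<and>
     (\<forall>t\<ge>0. subalgebra S (F t)) \<and>
     (\<forall>s\<ge>0. \<forall>t\<ge>s. subalgebra (F t) (F s)) \<and>
     (\<forall>t\<ge>0. X t \<in> F t \<rightarrow>\<^sub>M borel) \<and>
     (\<forall>x. AE \<omega> in M x. X 0 \<omega> = x) \<and>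
     (\<forall>x. \<forall>t\<ge>0. \<forall>h\<ge>0. \<forall>B\<in>sets borel.
        AE \<omega> in M x. real_cond_exp (M x) (F t) (indicator {\<omega>'\<in>space S. X (t + h) \<omega>' \<in> B}) \<omega>
                   = measure (P h (X t \<omega>)) B) \<and>
     (\<forall>t\<ge>0. \<forall>\<omega>\<in>space S. \<exists>\<omega>'\<in>space S. \<forall>s\<ge>0. X s \<omega>' = X (t + s) \<omega>)"

definition bounded_trajectory :: "(real \<Rightarrow> 'a::topological_space) \<Rightarrow> bool" where
  "bounded_trajectory f \<longleftrightarrow> (\<forall>T\<ge>0. compact (closure (f ` {0..T})))"

definition right_continuous_trajectory :: "(real \<Rightarrow> 'a::topological_space) \<Rightarrow> bool" where
  "right_continuous_trajectory f \<longleftrightarrow> (\<forall>t\<ge>0. continuous (at_right t) f)"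

definition only_jumps_trajectory :: "(real \<Rightarrow> 'a::topological_space) \<Rightarrow> bool" where
  "only_jumps_trajectory f \<longleftrightarrow> (\<forall>t>0. \<exists>l. (f \<longlongrightarrow> l) (at_left t))"

end

theory Submission
  imports Defs
begin

text \<open>The heat kernel is the Fourier transform of $\exp(-t\|\xi\|^\alpha)$, a decreasing function of the norm, and
every such function is an average of indicators of balls around $0$.  Here the ball is drawn at random with
an index of law \<open>\<kappa> t\<close>, whose distribution function is $n \mapsto \exp(-t r_n^\alpha)$, where $r_n$ is the
radius of the ball of index $n$.  The Fourier transform of the indicator of a ball is a multiple of the
indicator of the dual ball, because the canonical character is trivial on a ball exactly when the ball lies
in $\widehat{\mathbb{Z}}$.  So the heat kernel is an average of uniform densities on balls: it is real and
nonnegative, and it has total mass $1$ (\<open>heat_kernel_eq\<close>, \<open>heat_transition_eq\<close>).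

Balls are subgroups, so the convolution of the uniform laws on two balls is the uniform law on the larger
one.  Convolving two heat kernels therefore takes the maximum of two independent indices, which multiplies
their distribution functions, and $\exp(-s r_n^\alpha)\exp(-t r_n^\alpha) = \exp(-(s+t) r_n^\alpha)$.  This is the
semigroup property (\<open>heat_law_add\<close>).  The same formula bounds the mass that time \<open>t\<close> puts outside the ball of
radius \<open>r\<close> by \<open>t\<close> times a constant that depends on \<open>r\<close> alone (\<open>heat_law_cball\<close>).

That bound is all that the construction of the process needs (\<open>cadlag_markov_process\<close>), and it works for any
convolution semigroup on a Polish abelian group with an invariant ultrametric whose balls are compact.  Independent increments on
the grids of mesh $2^{-n}$ are consistent, and Kolmogorov's theorem joins them into one process on the dyadic
times.  Count the steps of the grid path that are longer than \<open>r\<close>.  By the ultrametric inequality a long step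
of one grid contains a long step of the next, so the count increases with $n$; its expectation up to time \<open>T\<close>
is at most \<open>T\<close> times the constant of \<open>r\<close>.  So the count is almost surely bounded, and up to distances of at
most \<open>r\<close> the path is a step function with finitely many steps on bounded intervals.  As this holds for all
\<open>r\<close>, the path has one-sided limits along the dyadic times; its right limits form a right-continuous path
which has left limits and is bounded.

Balls are open and closed, so the probability that finitely many values or increments lie in given balls
passes to the limit from the grids to the right-continuous path.  Hence that path has independent increments
with the laws of the semigroup, at all real times.  The laws of its translates, on the space of all such paths
with the filtration generated by the coordinates, form the Markov process.\<close>

section \<open>Ultrametric convolution semigroups\<close>

lemma measure_eqI_finite_marginals:
  fixes M N :: "('i \<Rightarrow> 'b) measure"
  assumes sM: "sets M = sets (PiM I K)" and sN: "sets N = sets (PiM I K)"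
    and fin: "finite_measure M"
    and eq: "\<And>J. finite J \<Longrightarrow> J \<subseteq> I \<Longrightarrow>
      distr M (PiM J K) (\<lambda>\<omega>. restrict \<omega> J) = distr N (PiM J K) (\<lambda>\<omega>. restrict \<omega> J)"
  shows "M = N"
proof (rule measure_eqI_PiM_infinite[OF sM sN _ fin])
  fix A J assume J: "finite J" "J \<subseteq> I" and A: "\<And>i. i \<in> J \<Longrightarrow> A i \<in> sets (K i)"
  let ?E = "prod_emb I K J (Pi\<^sub>E J A)"
  have E: "Pi\<^sub>E J A \<in> sets (PiM J K)"
    using J A by (intro sets_PiM_I_finite) auto
  have sp: "space M = space (PiM I K)" "space N = space (PiM I K)"
    using sM sN by (auto dest: sets_eq_imp_space_eq)
  have mM: "(\<lambda>\<omega>. restrict \<omega> J) \<in> M \<rightarrow>\<^sub>M PiM J K" "(\<lambda>\<omega>. restrict \<omega> J) \<in> N \<rightarrow>\<^sub>M PiM J K"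
    using J measurable_restrict_subset[of J I K] sM sN by (auto cong: measurable_cong_sets)
  have "emeasure (distr M (PiM J K) (\<lambda>\<omega>. restrict \<omega> J)) (Pi\<^sub>E J A) = emeasure M ?E"
    using E by (subst emeasure_distr[OF mM(1)]) (auto simp: prod_emb_def sp space_PiM)
  moreover have "emeasure (distr N (PiM J K) (\<lambda>\<omega>. restrict \<omega> J)) (Pi\<^sub>E J A) = emeasure N ?E"
    using E by (subst emeasure_distr[OF mM(2)]) (auto simp: prod_emb_def sp space_PiM)
  ultimately show "emeasure M ?E = emeasure N ?E"
    using eq[OF J] by simp
qed

text \<open>The constant \<open>c r\<close> bounds the rate of jumps longer than \<open>r\<close>.  The invariant ultrametric makes closed balls
around \<open>0\<close> open subgroups, so a bound on a single step is preserved under sums; compactness of balls is what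
gives bounded trajectories.\<close>

locale ultrametric_convolution_semigroup =
  fixes \<nu> :: "real \<Rightarrow> 'a::{polish_space, topological_ab_group_add} measure" and c :: "real \<Rightarrow> real"
  assumes dist_translate: "dist (x + z) (y + z) = dist x (y::'a)"
    and ultrametric: "dist x z \<le> max (dist x y) (dist y (z::'a))"
    and compact_cball: "compact (cball (0::'a) r)"
    and prob_space_\<nu>: "t \<ge> 0 \<Longrightarrow> prob_space (\<nu> t)"
    and sets_\<nu>: "t \<ge> 0 \<Longrightarrow> sets (\<nu> t) = sets borel"
    and \<nu>_0: "\<nu> 0 = return borel 0"
    and \<nu>_add: "s \<ge> 0 \<Longrightarrow> t \<ge> 0 \<Longrightarrow> \<nu> (s + t) = distr (\<nu> s \<Otimes>\<^sub>M \<nu> t) borel (\<lambda>(x, y). x + y)"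
    and \<nu>_cball: "t \<ge> 0 \<Longrightarrow> r > 0 \<Longrightarrow> 1 - t * c r \<le> measure (\<nu> t) (cball 0 r)"
begin

section \<open>Independent increments on dyadic grids\<close>

lemma measurable_\<nu>_cong: "t \<ge> 0 \<Longrightarrow> measurable M (\<nu> t) = measurable M borel"
  "t \<ge> 0 \<Longrightarrow> measurable (\<nu> t) M = measurable borel M"
  by (auto simp: sets_\<nu> cong: measurable_cong_sets)

text \<open>The law of the increments along the grid of mesh \<open>1 / 2 ^ n\<close>.\<close>

definition W :: "nat \<Rightarrow> (nat \<Rightarrow> 'a) measure" where
  "W n = PiM UNIV (\<lambda>i. \<nu> (1 / 2 ^ n))"

lemma prob_space_W: "prob_space (W n)"
  unfolding W_def by (intro prob_space_PiM prob_space_\<nu>) simp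

lemma sets_W [measurable_cong]: "sets (W n) = sets (PiM UNIV (\<lambda>_. borel))"
  unfolding W_def by (intro sets_PiM_cong sets_\<nu>) auto

lemma space_W: "space (W n) = UNIV"
  by (simp add: sets_eq_imp_space_eq[OF sets_W] space_PiM)

lemma measurable_partial_sum: "(\<lambda>\<xi>. \<Sum>i\<in>I. \<xi> i) \<in> borel_measurable (W n)"
  by measurable

lemma distr_W_coordinate: "distr (W n) borel (\<lambda>\<xi>. \<xi> i) = \<nu> (1 / 2 ^ n)"
proof -
  have "distr (W n) borel (\<lambda>\<xi>. \<xi> i) = distr (W n) (\<nu> (1 / 2 ^ n)) (\<lambda>\<xi>. \<xi> i)"
    by (intro distr_cong) (auto simp: sets_\<nu>)
  also have "\<dots> = \<nu> (1 / 2 ^ n)"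
    unfolding W_def by (intro distr_PiM_component prob_space_\<nu>) auto
  finally show ?thesis .
qed

lemma indep_vars_W:
  "prob_space.indep_vars (W n) (\<lambda>_. borel) (\<lambda>i \<xi>. \<xi> i) UNIV"
proof -
  interpret prob_space "W n" by (rule prob_space_W)
  have "indep_vars (\<lambda>_. borel) (\<lambda>i \<xi>. \<xi> i) UNIV \<longleftrightarrow>
    distr (W n) (\<Pi>\<^sub>M i\<in>UNIV. borel) (\<lambda>x. \<lambda>i\<in>UNIV. x i) = (\<Pi>\<^sub>M i\<in>UNIV. distr (W n) borel (\<lambda>\<xi>. \<xi> i))"
    by (intro indep_vars_iff_distr_eq_PiM) auto
  moreover have "distr (W n) (\<Pi>\<^sub>M i\<in>UNIV. borel) (\<lambda>x. \<lambda>i\<in>UNIV. x i) = W n"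
    by (simp add: restrict_UNIV distr_id2 sets_W)
  ultimately show ?thesis by (simp add: distr_W_coordinate) (simp add: W_def)
qed

lemma indep_var_W_functions:
  assumes "I \<inter> J = {}" and "f \<in> PiM I (\<lambda>_. borel) \<rightarrow>\<^sub>M M" and "g \<in> PiM J (\<lambda>_. borel) \<rightarrow>\<^sub>M N"
  shows "prob_space.indep_var (W n) M (\<lambda>\<xi>. f (restrict \<xi> I)) N (\<lambda>\<xi>. g (restrict \<xi> J))"
proof -
  interpret prob_space "W n" by (rule prob_space_W)
  have "indep_var (PiM I (\<lambda>_. borel)) (\<lambda>\<xi>. restrict \<xi> I) (PiM J (\<lambda>_. borel)) (\<lambda>\<xi>. restrict \<xi> J)"
    using indep_var_restrict[OF indep_vars_W[of n] assms(1)] by simp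
  from indep_var_compose[OF this assms(2,3)] show ?thesis by (simp add: comp_def)
qed

lemma distr_add_indep:
  assumes "prob_space M" and s: "s \<ge> 0" and t: "t \<ge> 0"
    and "prob_space.indep_var M borel X borel Y"
    and "distr M borel X = \<nu> s" and "distr M borel Y = \<nu> t"
  shows "distr M borel (\<lambda>\<omega>. X \<omega> + Y \<omega>) = \<nu> (s + t)"
proof -
  interpret prob_space M by fact
  have [measurable]: "X \<in> borel_measurable M" "Y \<in> borel_measurable M"
    and D: "distr M borel X \<Otimes>\<^sub>M distr M borel Y = distr M (borel \<Otimes>\<^sub>M borel) (\<lambda>x. (X x, Y x))"
    using assms(4) unfolding indep_var_distribution_eq by auto
  have "\<nu> (s + t) = distr (distr M (borel \<Otimes>\<^sub>M borel) (\<lambda>x. (X x, Y x))) borel (\<lambda>(x, y). x + y)"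
    using s t assms(5,6) D by (simp add: \<nu>_add)
  also have "\<dots> = distr M borel (\<lambda>\<omega>. X \<omega> + Y \<omega>)"
    by (subst distr_distr) (auto simp: comp_def)
  finally show ?thesis by simp
qed

lemma distr_W_sum:
  assumes "finite I"
  shows "distr (W n) borel (\<lambda>\<xi>. \<Sum>i\<in>I. \<xi> i) = \<nu> (card I / 2 ^ n)"
  using assms
proof induction
  case empty
  interpret prob_space "W n" by (rule prob_space_W)
  show ?case by (simp add: \<nu>_0 distr_const)
next
  case (insert i I)
  have iv: "prob_space.indep_var (W n) borel (\<lambda>\<xi>. \<xi> i) borel (\<lambda>\<xi>. \<Sum>j\<in>I. \<xi> j)"
    using indep_var_W_functions[of "{i}" I "\<lambda>\<xi>. \<xi> i" borel "\<lambda>\<xi>. \<Sum>j\<in>I. \<xi> j" borel n] insert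
    by (simp add: borel_measurable_sum cong: sum.cong)
  have "distr (W n) borel (\<lambda>\<xi>. \<xi> i + (\<Sum>j\<in>I. \<xi> j)) = \<nu> (1 / 2 ^ n + card I / 2 ^ n)"
    using distr_add_indep[OF prob_space_W _ _ iv distr_W_coordinate insert.IH] by simp
  then show ?case using insert by (simp add: add_divide_distrib)
qed

text \<open>Adding up neighbouring pairs of increments turns the noise of a grid into that of the next coarser one: this is
the semigroup property, and it is what makes the grids consistent.\<close>

lemma distr_W_refine:
  "distr (W (Suc n)) (PiM UNIV (\<lambda>_. borel)) (\<lambda>\<xi> i. \<xi> (2 * i) + \<xi> (2 * i + 1)) = W n"
proof -
  interpret prob_space "W (Suc n)" by (rule prob_space_W)
  have "indep_vars (\<lambda>j. PiM {2 * j, 2 * j + 1} (\<lambda>_. borel)) (\<lambda>j \<xi>. restrict \<xi> {2 * j, 2 * j + 1}) (UNIV :: nat set)"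
    using indep_vars_restrict[OF indep_vars_W[of "Suc n"], of UNIV "\<lambda>j. {2 * j, 2 * j + 1}"]
    by (auto simp: disjoint_family_on_def)
  from indep_vars_compose2[OF this, of "\<lambda>j \<xi>. \<xi> (2 * j) + \<xi> (2 * j + 1)" "\<lambda>_. borel"]
  have iv: "indep_vars (\<lambda>_. borel) (\<lambda>j \<xi>. \<xi> (2 * j) + \<xi> (2 * j + 1)) (UNIV :: nat set)"
    by simp
  have "distr (W (Suc n)) borel (\<lambda>\<xi>. \<xi> (2 * i) + \<xi> (2 * i + 1)) = \<nu> (1 / 2 ^ n)" for i
    using distr_W_sum[of "{2 * i, 2 * i + 1}" "Suc n"] by simp
  moreover have "distr (W (Suc n)) (PiM UNIV (\<lambda>_. borel)) (\<lambda>\<xi>. \<lambda>i\<in>UNIV. \<xi> (2 * i) + \<xi> (2 * i + 1)) =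
      PiM UNIV (\<lambda>i. distr (W (Suc n)) borel (\<lambda>\<xi>. \<xi> (2 * i) + \<xi> (2 * i + 1)))"
    using iv by (subst (asm) indep_vars_iff_distr_eq_PiM) auto
  ultimately show ?thesis
    by (simp add: W_def[of n] restrict_UNIV)
qed


section \<open>The process at dyadic times\<close>

definition grid :: "nat \<Rightarrow> real set" where
  "grid n = range (\<lambda>m::nat. real m / 2 ^ n)"

definition dyadics :: "real set" where
  "dyadics = (\<Union>n. grid n)"

text \<open>Truncating \<open>t * 2 ^ n\<close> is harmless for \<open>t\<close> in the grid, the only times at which the grid path is used.\<close>

definition grid_path :: "nat \<Rightarrow> (nat \<Rightarrow> 'a) \<Rightarrow> real \<Rightarrow> 'a" where
  "grid_path n \<xi> t = (\<Sum>i<nat \<lfloor>t * 2 ^ n\<rfloor>. \<xi> i)"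

lemma grid_mono:
  assumes "n \<le> m" shows "grid n \<subseteq> grid m"
proof -
  have "real k / 2 ^ n = real (k * 2 ^ (m - n)) / 2 ^ m" for k
    using assms by (simp add: field_simps flip: power_add)
  then show ?thesis unfolding grid_def by blast
qed

lemma finite_subset_grid:
  assumes "finite J" "J \<subseteq> dyadics" shows "\<exists>n. J \<subseteq> grid n"
  using assms
proof induction
  case (insert t J)
  then obtain n m where "J \<subseteq> grid n" "t \<in> grid m" by (auto simp: dyadics_def)
  then have "insert t J \<subseteq> grid (max n m)"
    using grid_mono[of n "max n m"] grid_mono[of m "max n m"] by auto
  then show ?case ..
qed simp

text \<open>A grid that contains the given finite set of dyadic times; which one is immaterial by \<open>grid_marginal_eq\<close>.\<close>

definition level :: "real set \<Rightarrow> nat" where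
  "level J = (SOME n. J \<subseteq> grid n)"

lemma level: "finite J \<Longrightarrow> J \<subseteq> dyadics \<Longrightarrow> J \<subseteq> grid (level J)"
  unfolding level_def using finite_subset_grid by (rule someI_ex)

lemma measurable_grid_path [measurable]: "(\<lambda>\<xi>. grid_path n \<xi> t) \<in> borel_measurable (W n')"
  unfolding grid_path_def by measurable

definition grid_marginal :: "nat \<Rightarrow> real set \<Rightarrow> (real \<Rightarrow> 'a) measure" where
  "grid_marginal n J = distr (W n) (PiM J (\<lambda>_. borel)) (\<lambda>\<xi>. \<lambda>t\<in>J. grid_path n \<xi> t)"

lemma grid_path_refine:
  assumes "t \<in> grid n"
  shows "grid_path (Suc n) \<xi> t = grid_path n (\<lambda>i. \<xi> (2 * i) + \<xi> (2 * i + 1)) t"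
proof -
  obtain m :: nat where t: "t = real m / 2 ^ n" using assms by (auto simp: grid_def)
  have "t * 2 ^ Suc n = real (2 * m)" "t * 2 ^ n = real m" by (simp_all add: t)
  then have e: "nat \<lfloor>t * 2 ^ Suc n\<rfloor> = 2 * m" "nat \<lfloor>t * 2 ^ n\<rfloor> = m"
    by (metis floor_of_nat nat_int)+
  have "(\<Sum>i<2 * m. \<xi> i) = (\<Sum>i<m. \<xi> (2 * i) + \<xi> (2 * i + 1))"
    by (induction m) (simp_all add: add.assoc)
  then show ?thesis unfolding grid_path_def e .
qed

lemma grid_marginal_Suc:
  assumes "J \<subseteq> grid n"
  shows "grid_marginal (Suc n) J = grid_marginal n J"
proof -
  have "grid_marginal (Suc n) J =
      distr (W (Suc n)) (PiM J (\<lambda>_. borel)) (\<lambda>\<xi>. \<lambda>t\<in>J. grid_path n (\<lambda>i. \<xi> (2 * i) + \<xi> (2 * i + 1)) t)"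
    unfolding grid_marginal_def using assms
    by (intro distr_cong refl restrict_ext grid_path_refine) auto
  also have "\<dots> = distr (distr (W (Suc n)) (PiM UNIV (\<lambda>_. borel)) (\<lambda>\<xi> i. \<xi> (2 * i) + \<xi> (2 * i + 1)))
      (PiM J (\<lambda>_. borel)) (\<lambda>\<xi>. \<lambda>t\<in>J. grid_path n \<xi> t)"
    by (subst distr_distr) (auto simp: comp_def intro!: measurable_abs_UNIV measurable_restrict)
  also have "\<dots> = grid_marginal n J"
    by (simp only: distr_W_refine grid_marginal_def)
  finally show ?thesis .
qed

lemma grid_marginal_eq:
  assumes "J \<subseteq> grid n" "J \<subseteq> grid m"
  shows "grid_marginal n J = grid_marginal m J"
proof -
  have "grid_marginal (k + l) J = grid_marginal k J" if "J \<subseteq> grid k" for k l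
    using that
  proof (induction l)
    case (Suc l)
    then have "J \<subseteq> grid (k + l)" using grid_mono[of k "k + l"] by auto
    from grid_marginal_Suc[OF this] Suc show ?case by simp
  qed simp
  from this[of n m] this[of m n] assms show ?thesis by (simp add: add.commute)
qed

lemma restrict_grid_marginal:
  assumes "J \<subseteq> H"
  shows "distr (grid_marginal n H) (PiM J (\<lambda>_. borel)) (\<lambda>\<omega>. restrict \<omega> J) = grid_marginal n J"
  unfolding grid_marginal_def using assms
  by (subst distr_distr)
     (auto simp: comp_def Int_absorb1 intro!: measurable_restrict_subset distr_cong)

lemma projective_family_grid_marginal:
  "polish_projective dyadics (\<lambda>J. grid_marginal (level J) J)"
proof (unfold polish_projective_def, rule projective_family.intro)
  fix J H :: "real set" assume "J \<subseteq> H" "finite H" "H \<subseteq> dyadics"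
  then show "grid_marginal (level J) J =
      distr (grid_marginal (level H) H) (PiM J (\<lambda>_. borel)) (\<lambda>f. restrict f J)"
    using level[of H] level[of J]
    by (subst restrict_grid_marginal) (auto intro!: grid_marginal_eq dest: finite_subset)
next
  fix J :: "real set"
  show "prob_space (grid_marginal (level J) J)"
    unfolding grid_marginal_def
    by (intro prob_space.prob_space_distr prob_space_W measurable_restrict) auto
qed

definition \<Omega> :: "(real \<Rightarrow> 'a) measure" where
  "\<Omega> = projective_family.lim dyadics (\<lambda>J. grid_marginal (level J) J) (\<lambda>_. borel)"

interpretation D: polish_projective dyadics "\<lambda>J. grid_marginal (level J) J"
  by (rule projective_family_grid_marginal)

lemma prob_space_\<Omega>: "prob_space \<Omega>"
  unfolding \<Omega>_def by (rule D.P.prob_space_axioms)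

lemma sets_\<Omega> [measurable_cong]: "sets \<Omega> = sets (PiM dyadics (\<lambda>_. borel))"
  unfolding \<Omega>_def by (rule D.sets_lim)

lemma finite_marginal_\<Omega>:
  assumes "finite J" "J \<subseteq> dyadics"
  shows "distr \<Omega> (PiM J (\<lambda>_. borel)) (\<lambda>\<omega>. restrict \<omega> J) = grid_marginal (level J) J"
proof (rule measure_eqI)
  let ?X = "distr \<Omega> (PiM J (\<lambda>_. borel)) (\<lambda>\<omega>. restrict \<omega> J)"
  show "sets ?X = sets (grid_marginal (level J) J)"
    by (simp add: grid_marginal_def)
  fix A assume "A \<in> sets ?X"
  then have A: "A \<in> sets (PiM J (\<lambda>_. borel))" by simp
  have m: "(\<lambda>\<omega>. restrict \<omega> J) \<in> \<Omega> \<rightarrow>\<^sub>M PiM J (\<lambda>_. borel)"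
    using measurable_restrict_subset[OF assms(2), of "\<lambda>_. borel"] sets_\<Omega> by (simp cong: measurable_cong_sets)
  show "emeasure ?X A = emeasure (grid_marginal (level J) J) A"
    using D.emeasure_lim_emb[OF assms(2,1) A] A
    by (subst emeasure_distr[OF m A]) (simp add: prod_emb_def \<Omega>_def space_PiM)
qed

lemma grid_in_dyadics: "real m / 2 ^ n \<in> dyadics"
  by (auto simp: dyadics_def grid_def)

lemma measurable_\<Omega>_coordinate [measurable]: "(\<lambda>\<omega>. \<omega> (real m / 2 ^ n)) \<in> borel_measurable \<Omega>"
  using grid_in_dyadics[of m n] by measurable

text \<open>Seen along one grid, the process is the sequence of partial sums of independent increments.  All later
computations of probabilities go through this description.\<close>

lemma grid_law_\<Omega>:
  "distr \<Omega> (PiM UNIV (\<lambda>_. borel)) (\<lambda>\<omega> m. \<omega> (real m / 2 ^ n)) =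
   distr (W n) (PiM UNIV (\<lambda>_. borel)) (\<lambda>\<xi> m. \<Sum>i<m. \<xi> i)"
proof (rule measure_eqI_finite_marginals)
  let ?X = "distr \<Omega> (PiM UNIV (\<lambda>_. borel)) (\<lambda>\<omega> m. \<omega> (real m / 2 ^ n))"
  interpret prob_space \<Omega> by (rule prob_space_\<Omega>)
  show "finite_measure ?X"
    by (intro finite_measure_distr measurable_abs_UNIV measurable_\<Omega>_coordinate)
next
  let ?X = "distr \<Omega> (PiM UNIV (\<lambda>_. borel)) (\<lambda>\<omega> m. \<omega> (real m / 2 ^ n))"
  fix J :: "nat set" assume J: "finite J"
  define K where "K = (\<lambda>m. real m / 2 ^ n) ` J"
  have K: "finite K" "K \<subseteq> dyadics" "K \<subseteq> grid n"
    using J grid_in_dyadics by (auto simp: K_def grid_def)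
  let ?r = "\<lambda>\<eta>::real \<Rightarrow> 'a. \<lambda>m\<in>J. \<eta> (real m / 2 ^ n)"
  have r[measurable]: "?r \<in> PiM K (\<lambda>_. borel) \<rightarrow>\<^sub>M PiM J (\<lambda>_. borel)"
    by (intro measurable_restrict measurable_component_singleton) (auto simp: K_def)
  have m[measurable]: "(\<lambda>\<omega>. restrict \<omega> K) \<in> \<Omega> \<rightarrow>\<^sub>M PiM K (\<lambda>_. borel)"
    using measurable_restrict_subset[OF K(2), of "\<lambda>_. borel"] sets_\<Omega> by (simp cong: measurable_cong_sets)
  have "distr ?X (PiM J (\<lambda>_. borel)) (\<lambda>\<omega>. restrict \<omega> J)
     = distr \<Omega> (PiM J (\<lambda>_. borel)) (\<lambda>\<omega>. \<lambda>m\<in>J. \<omega> (real m / 2 ^ n))"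
    by (subst distr_distr) (auto simp: comp_def intro!: measurable_restrict_subset measurable_abs_UNIV)
  also have "\<dots> = distr (distr \<Omega> (PiM K (\<lambda>_. borel)) (\<lambda>\<omega>. restrict \<omega> K)) (PiM J (\<lambda>_. borel)) ?r"
    by (subst distr_distr[OF r m]) (auto simp: comp_def K_def intro!: distr_cong restrict_ext)
  also have "\<dots> = distr (grid_marginal n K) (PiM J (\<lambda>_. borel)) ?r"
    using finite_marginal_\<Omega>[OF K(1,2)] grid_marginal_eq[OF level[OF K(1,2)] K(3)] by simp
  also have "\<dots> = distr (W n) (PiM J (\<lambda>_. borel)) (\<lambda>\<xi>. \<lambda>m\<in>J. \<Sum>i<m. \<xi> i)"
    unfolding grid_marginal_def
    by (subst distr_distr[OF r]) (auto simp: comp_def K_def grid_path_def intro!: distr_cong restrict_ext)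
  also have "\<dots> = distr (distr (W n) (PiM UNIV (\<lambda>_. borel)) (\<lambda>\<xi> m. \<Sum>i<m. \<xi> i)) (PiM J (\<lambda>_. borel)) (\<lambda>\<omega>. restrict \<omega> J)"
    by (subst distr_distr)
       (auto simp: comp_def intro!: measurable_restrict_subset measurable_abs_UNIV measurable_partial_sum)
  finally show "distr ?X (PiM J (\<lambda>_. borel)) (\<lambda>\<omega>. restrict \<omega> J)
     = distr (distr (W n) (PiM UNIV (\<lambda>_. borel)) (\<lambda>\<xi> m. \<Sum>i<m. \<xi> i)) (PiM J (\<lambda>_. borel)) (\<lambda>\<omega>. restrict \<omega> J)" .
qed auto

section \<open>Regularisation of paths along dyadic times\<close>

text \<open>The number of steps longer than \<open>r\<close> among the first \<open>m\<close> steps along the grid of mesh \<open>1 / 2 ^ n\<close>.\<close>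

definition changes :: "(real \<Rightarrow> 'a) \<Rightarrow> nat \<Rightarrow> real \<Rightarrow> nat \<Rightarrow> nat" where
  "changes f n r m = card {i. i < m \<and> r < dist (f (real i / 2 ^ n)) (f (real (Suc i) / 2 ^ n))}"

text \<open>Boundedness is asked for along sequences of radii \<open>1 / Suc k\<close> and of times \<open>T\<close> only, to keep the condition a
countable one.\<close>

definition regular_path :: "(real \<Rightarrow> 'a) \<Rightarrow> bool" where
  "regular_path f \<longleftrightarrow> (\<forall>k T. \<exists>M. \<forall>n. changes f n (1 / Suc k) (T * 2 ^ n) \<le> M)"

text \<open>The first point of the grid strictly after \<open>t\<close>.  Strictness matters: limits along these points are right limits
also when \<open>t\<close> is itself dyadic.\<close>

definition dyadic_above :: "nat \<Rightarrow> real \<Rightarrow> real" where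
  "dyadic_above n t = real (nat \<lfloor>t * 2 ^ n\<rfloor> + 1) / 2 ^ n"

definition cadlag_version :: "(real \<Rightarrow> 'a) \<Rightarrow> real \<Rightarrow> 'a" where
  "cadlag_version f t = lim (\<lambda>n. f (dyadic_above n t))"

lemma changes_mono_index: "m \<le> m' \<Longrightarrow> changes f n r m \<le> changes f n r m'"
  unfolding changes_def by (intro card_mono) auto

lemma changes_mono_radius: "r \<le> r' \<Longrightarrow> changes f n r' m \<le> changes f n r m"
  unfolding changes_def by (intro card_mono) auto

text \<open>By the ultrametric inequality a step longer than \<open>r\<close> cannot be composed of two steps of length at most \<open>r\<close>.
Choosing such a half step is injective.\<close>

lemma changes_refine: "changes f n r m \<le> changes f (Suc n) r (2 * m)"
proof -
  let ?C = "\<lambda>n i. r < dist (f (real i / 2 ^ n)) (f (real (Suc i) / 2 ^ n))"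
  \<comment> \<open>\<open>\<phi> i\<close> is a long half of the long step \<open>i\<close>\<close>
  define \<phi> where "\<phi> i = (if ?C (Suc n) (2 * i) then 2 * i else 2 * i + 1)" for i
  have C: "?C (Suc n) (\<phi> i)" if "?C n i" for i
  proof (rule ccontr)
    assume not: "\<not> ?C (Suc n) (\<phi> i)"
    then have 1: "\<not> ?C (Suc n) (2 * i)" and 2: "\<not> ?C (Suc n) (2 * i + 1)"
      by (auto simp: \<phi>_def split: if_splits)
    have e: "real (2 * i) / 2 ^ Suc n = real i / 2 ^ n"
      "real (Suc (2 * i + 1)) / 2 ^ Suc n = real (Suc i) / 2 ^ n"
      "real (2 * i + 1) / 2 ^ Suc n = real (Suc (2 * i)) / 2 ^ Suc n"
      by (simp_all add: field_simps)
    have "dist (f (real i / 2 ^ n)) (f (real (Suc i) / 2 ^ n)) \<le> r"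
      using 1 2 ultrametric[of "f (real i / 2 ^ n)" "f (real (Suc i) / 2 ^ n)" "f (real (Suc (2 * i)) / 2 ^ Suc n)"]
      unfolding e by linarith
    with that show False by simp
  qed
  have "inj_on \<phi> {i. i < m \<and> ?C n i}"
    by (auto simp: inj_on_def \<phi>_def split: if_splits)
  moreover have "\<phi> ` {i. i < m \<and> ?C n i} \<subseteq> {i. i < 2 * m \<and> ?C (Suc n) i}"
  proof (intro image_subsetI CollectI conjI)
    fix i assume "i \<in> {i. i < m \<and> ?C n i}"
    then have "i < m" "?C n i" by blast+
    show "\<phi> i < 2 * m" using \<open>i < m\<close> by (simp add: \<phi>_def)
    show "?C (Suc n) (\<phi> i)" using \<open>?C n i\<close> by (rule C)
  qed
  ultimately show ?thesis
    unfolding changes_def by (rule card_inj_on_le) auto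
qed

lemma nat_floor_double_le:
  fixes t :: real assumes "t \<ge> 0" shows "2 * nat \<lfloor>t * 2 ^ n\<rfloor> \<le> nat \<lfloor>t * 2 ^ Suc n\<rfloor>"
proof -
  have "2 * \<lfloor>t * 2 ^ n\<rfloor> \<le> \<lfloor>t * 2 ^ Suc n\<rfloor>" by (simp add: le_floor_iff)
  then show ?thesis using assms by (simp add: le_nat_iff nat_mult_distrib)
qed

lemma changes_incseq:
  fixes t :: real
  assumes "t \<ge> 0" shows "incseq (\<lambda>n. changes f n r (nat \<lfloor>t * 2 ^ n\<rfloor>))"
proof (rule incseq_SucI)
  fix n
  show "changes f n r (nat \<lfloor>t * 2 ^ n\<rfloor>) \<le> changes f (Suc n) r (nat \<lfloor>t * 2 ^ Suc n\<rfloor>)"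
    using changes_refine changes_mono_index[OF nat_floor_double_le[OF assms]] by (rule order_trans)
qed

lemma dist_le_if_no_changes:
  assumes "r \<ge> 0" "a \<le> b" "changes f n r b \<le> changes f n r a"
  shows "dist (f (real a / 2 ^ n)) (f (real b / 2 ^ n)) \<le> r"
proof -
  let ?C = "\<lambda>i. r < dist (f (real i / 2 ^ n)) (f (real (Suc i) / 2 ^ n))"
  have eq: "{i. i < a \<and> ?C i} = {i. i < b \<and> ?C i}"
    using assms(2,3) unfolding changes_def by (intro card_seteq) auto
  have N: "\<not> ?C i" if "a \<le> i" "i < b" for i
  proof
    assume "?C i"
    with that have "i \<in> {i. i < b \<and> ?C i}" by simp
    then have "i \<in> {i. i < a \<and> ?C i}" unfolding eq .
    then have "i < a" by blast
    with that show False by simp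
  qed
  have "dist (f (real a / 2 ^ n)) (f (real k / 2 ^ n)) \<le> r" if "a \<le> k" "k \<le> b" for k
    using that
  proof (induction k rule: dec_induct)
    case (step k)
    then show ?case
      using N[of k] ultrametric[of "f (real a / 2 ^ n)" "f (real (Suc k) / 2 ^ n)" "f (real k / 2 ^ n)"]
      by linarith
  qed (use assms in simp)
  then show ?thesis using assms(2) by simp
qed

text \<open>The counting function of long steps, in the limit of fine grids: it is increasing with values in the natural numbers,
and as long as it does not increase, the path moves by at most \<open>r\<close>.  One-sided limits of the path come from
those of an integer-valued monotone function, which are attained.\<close>

lemma variation_exists:
  assumes f: "regular_path f" and r: "r > 0"
  obtains V :: "real \<Rightarrow> nat" where "\<And>s t. 0 \<le> s \<Longrightarrow> s \<le> t \<Longrightarrow> V s \<le> V t"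
    and "\<And>s t. s \<in> dyadics \<Longrightarrow> t \<in> dyadics \<Longrightarrow> s \<le> t \<Longrightarrow> V s = V t \<Longrightarrow> dist (f s) (f t) \<le> r"
proof -
  obtain k where k: "1 / Suc k < r" using r nat_approx_posE by blast
  let ?v = "\<lambda>(t::real) n. changes f n r (nat \<lfloor>t * 2 ^ n\<rfloor>)"
  define V where "V t = (SUP n. ?v t n)" for t
  have bdd: "bdd_above (range (?v t))" for t
  proof -
    obtain M where M: "\<And>n. changes f n (1 / Suc k) (nat \<lceil>t\<rceil> * 2 ^ n) \<le> M"
      using f unfolding regular_path_def by blast
    have "?v t n \<le> M" for n
    proof -
      have "t * 2 ^ n \<le> real (nat \<lceil>t\<rceil> * 2 ^ n)"
        by (simp add: mult_right_mono real_nat_ceiling_ge)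
      then have "nat \<lfloor>t * 2 ^ n\<rfloor> \<le> nat \<lceil>t\<rceil> * 2 ^ n"
        using nat_mono[OF floor_mono] by (metis floor_of_nat nat_int)
      then have "?v t n \<le> changes f n r (nat \<lceil>t\<rceil> * 2 ^ n)" by (rule changes_mono_index)
      also have "\<dots> \<le> changes f n (1 / Suc k) (nat \<lceil>t\<rceil> * 2 ^ n)"
        using k by (intro changes_mono_radius) simp
      finally show ?thesis using M[of n] by simp
    qed
    then show ?thesis by (auto intro!: bdd_aboveI[of _ M])
  qed
  have le: "?v t n \<le> V t" for t n
    unfolding V_def using bdd by (rule cSUP_upper[OF UNIV_I])
  have attained: "\<exists>n. V t = ?v t n" for t
  proof -
    have "V t \<in> range (?v t)"
      unfolding V_def Sup_nat_def using Max_in[of "range (?v t)"] bdd[of t]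
      by (simp add: bdd_above_nat)
    then show ?thesis by auto
  qed
  have "V s \<le> V t" if "0 \<le> s" "s \<le> t" for s t
  proof -
    obtain n where "V s = ?v s n" using attained by blast
    also have "\<dots> \<le> ?v t n"
      using that by (intro changes_mono_index nat_mono floor_mono mult_right_mono) auto
    also have "\<dots> \<le> V t" by (rule le)
    finally show ?thesis .
  qed
  moreover have "dist (f s) (f t) \<le> r"
    if st: "s \<in> dyadics" "t \<in> dyadics" "s \<le> t" and eq: "V s = V t" for s t
  proof -
    have s0: "s \<ge> 0" using st(1) by (auto simp: dyadics_def grid_def)
    obtain n0 where n0: "V s = ?v s n0" using attained by blast
    obtain n1 where n1: "{s, t} \<subseteq> grid n1" using finite_subset_grid[of "{s, t}"] st by auto
    \<comment> \<open>a grid that contains both times and is fine enough for the count up to \<open>s\<close> to have reached its limit\<close>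
    define n where "n = max n0 n1"
    have "{s, t} \<subseteq> grid n" using n1 grid_mono[of n1 n] by (auto simp: n_def)
    then obtain a b :: nat where ab: "s = real a / 2 ^ n" "t = real b / 2 ^ n" by (auto simp: grid_def)
    have "?v s n0 \<le> ?v s n"
      using incseqD[OF changes_incseq[OF s0, of f r], of n0 n] by (simp add: n_def)
    then have "?v t n \<le> ?v s n" using le[of n t] n0 eq by simp
    then have "changes f n r b \<le> changes f n r a" by (simp add: ab)
    moreover have "a \<le> b" using st(3) by (simp add: ab divide_right_mono field_simps)
    ultimately show ?thesis
      using dist_le_if_no_changes[of r a b f n] r by (simp add: ab)
  qed
  ultimately show ?thesis by (rule that)
qed

text \<open>Just after \<open>t\<close> the counting function is constant: it takes its minimum over the times after \<open>t\<close>.\<close>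

lemma dyadics_right_oscillation:
  assumes f: "regular_path f" and r: "r > 0" and t: "t \<ge> 0"
  shows "\<exists>\<delta>>0. \<forall>s\<in>dyadics. \<forall>s'\<in>dyadics. t < s \<longrightarrow> s < t + \<delta> \<longrightarrow> t < s' \<longrightarrow> s' < t + \<delta> \<longrightarrow> dist (f s) (f s') \<le> r"
proof -
  obtain V :: "real \<Rightarrow> nat" where V: "\<And>s t. 0 \<le> s \<Longrightarrow> s \<le> t \<Longrightarrow> V s \<le> V t"
    and Vd: "\<And>s t. s \<in> dyadics \<Longrightarrow> t \<in> dyadics \<Longrightarrow> s \<le> t \<Longrightarrow> V s = V t \<Longrightarrow> dist (f s) (f t) \<le> r"
    by (rule variation_exists[OF f r]) (rule that)
  \<comment> \<open>on the times between \<open>t\<close> and \<open>s0\<close> the counting function equals its minimum\<close>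
  obtain s0 where s0: "s0 > t" "\<And>s. s > t \<Longrightarrow> V s0 \<le> V s"
    using ex_has_least_nat[of "\<lambda>s. s > t" "t + 1" V] by auto
  have eq: "V s = V s0" if "t < s" "s < s0" for s
    using V[of s s0] s0(2)[of s] that t by simp
  show ?thesis
  proof (intro exI[of _ "s0 - t"] conjI ballI impI)
    fix s s' assume h: "s \<in> dyadics" "s' \<in> dyadics" "t < s" "s < t + (s0 - t)" "t < s'" "s' < t + (s0 - t)"
    then show "dist (f s) (f s') \<le> r"
      using Vd[of s s'] Vd[of s' s] eq[of s] eq[of s'] by (cases "s \<le> s'") (auto simp: dist_commute)
  qed (use s0 in simp)
qed

text \<open>Just before \<open>t\<close> the counting function is constant: it takes its maximum over the times before \<open>t\<close>.\<close>

lemma dyadics_left_oscillation: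
  assumes f: "regular_path f" and r: "r > 0" and t: "t > 0"
  shows "\<exists>u. 0 \<le> u \<and> u < t \<and> (\<forall>s\<in>dyadics. \<forall>s'\<in>dyadics. u < s \<longrightarrow> s < t \<longrightarrow> u < s' \<longrightarrow> s' < t \<longrightarrow> dist (f s) (f s') \<le> r)"
proof -
  obtain V :: "real \<Rightarrow> nat" where V: "\<And>s t. 0 \<le> s \<Longrightarrow> s \<le> t \<Longrightarrow> V s \<le> V t"
    and Vd: "\<And>s t. s \<in> dyadics \<Longrightarrow> t \<in> dyadics \<Longrightarrow> s \<le> t \<Longrightarrow> V s = V t \<Longrightarrow> dist (f s) (f t) \<le> r"
    by (rule variation_exists[OF f r]) (rule that)
  obtain u where u: "0 \<le> u" "u < t" "\<And>s. 0 \<le> s \<Longrightarrow> s < t \<Longrightarrow> V s \<le> V u"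
  proof -
    have "\<exists>u. (0 \<le> u \<and> u < t) \<and> (\<forall>s. 0 \<le> s \<and> s < t \<longrightarrow> V s \<le> V u)"
      using t V by (intro ex_has_greatest_nat[of _ 0 _ "Suc (V t)"]) (auto simp: less_Suc_eq_le)
    then show ?thesis using that by blast
  qed
  have eq: "V s = V u" if "u < s" "s < t" for s
    using V[of u s] u(1,2) u(3)[of s] that by simp
  show ?thesis
  proof (intro exI[of _ u] conjI ballI impI u(1,2))
    fix s s' assume h: "s \<in> dyadics" "s' \<in> dyadics" "u < s" "s < t" "u < s'" "s' < t"
    then show "dist (f s) (f s') \<le> r"
      using Vd[of s s'] Vd[of s' s] eq[of s] eq[of s'] by (cases "s \<le> s'") (auto simp: dist_commute)
  qed
qed

lemma dyadic_above:
  assumes "t \<ge> 0"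
  shows "t < dyadic_above n t" "dyadic_above n t \<le> t + 1 / 2 ^ n" "dyadic_above n t \<in> dyadics"
proof -
  have r: "real (nat \<lfloor>t * 2 ^ n\<rfloor>) = of_int \<lfloor>t * 2 ^ n\<rfloor>" using assms by simp
  have "t * 2 ^ n < real (nat \<lfloor>t * 2 ^ n\<rfloor> + 1)" using r by (simp) linarith
  then show "t < dyadic_above n t" by (simp add: dyadic_above_def field_simps)
  have "real (nat \<lfloor>t * 2 ^ n\<rfloor> + 1) \<le> t * 2 ^ n + 1" using r by simp
  then have "real (nat \<lfloor>t * 2 ^ n\<rfloor> + 1) / 2 ^ n \<le> (t * 2 ^ n + 1) / 2 ^ n" by (rule divide_right_mono) simp
  then show "dyadic_above n t \<le> t + 1 / 2 ^ n" by (simp add: dyadic_above_def add_divide_distrib)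
  show "dyadic_above n t \<in> dyadics" unfolding dyadic_above_def by (rule grid_in_dyadics)
qed

lemma eventually_dyadic_above:
  assumes "t \<ge> 0" "\<delta> > 0"
  shows "\<forall>\<^sub>F n in sequentially. dyadic_above n t < t + \<delta>"
proof -
  have "(\<lambda>n. 1 / 2 ^ n :: real) \<longlonglongrightarrow> 0" by real_asymp
  then have "\<forall>\<^sub>F n in sequentially. 1 / 2 ^ n < \<delta>" using assms(2) by (rule order_tendstoD)
  then show ?thesis
    by eventually_elim (use dyadic_above(2)[OF assms(1)] in \<open>smt (verit)\<close>)
qed

lemma cadlag_version_LIMSEQ:
  assumes f: "regular_path f" and t: "t \<ge> 0"
  shows "(\<lambda>n. f (dyadic_above n t)) \<longlonglongrightarrow> cadlag_version f t"
proof -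
  have "Cauchy (\<lambda>n. f (dyadic_above n t))"
  proof (rule metric_CauchyI)
    fix e :: real assume "e > 0"
    then obtain \<delta> where \<delta>: "\<delta> > 0"
      "\<And>s s'. s \<in> dyadics \<Longrightarrow> s' \<in> dyadics \<Longrightarrow> t < s \<Longrightarrow> s < t + \<delta> \<Longrightarrow> t < s' \<Longrightarrow> s' < t + \<delta> \<Longrightarrow> dist (f s) (f s') \<le> e / 2"
      using dyadics_right_oscillation[OF f _ t, of "e / 2"] by auto
    obtain N where "\<And>n. n \<ge> N \<Longrightarrow> dyadic_above n t < t + \<delta>"
      using eventually_dyadic_above[OF t \<delta>(1)] by (auto simp: eventually_sequentially)
    then have "dist (f (dyadic_above m t)) (f (dyadic_above n t)) \<le> e / 2" if "m \<ge> N" "n \<ge> N" for m n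
      using that dyadic_above[OF t] by (intro \<delta>(2)) auto
    with \<open>e > 0\<close> show "\<exists>M. \<forall>m\<ge>M. \<forall>n\<ge>M. dist (f (dyadic_above m t)) (f (dyadic_above n t)) < e"
      by (intro exI[of _ N]) fastforce
  qed
  then have "convergent (\<lambda>n. f (dyadic_above n t))" by (simp add: Cauchy_convergent)
  then show ?thesis by (simp add: convergent_LIMSEQ_iff cadlag_version_def)
qed

lemma dist_limit_le:
  assumes "X \<longlonglongrightarrow> l" "\<forall>\<^sub>F n in sequentially. dist y (X n) \<le> r"
  shows "dist y (l :: 'a) \<le> r"
  using tendsto_upperbound[OF tendsto_dist[OF tendsto_const assms(1)] assms(2)] by simp

lemma cadlag_version_right:
  assumes f: "regular_path f" and r: "r > 0" and t: "t \<ge> 0"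
  shows "\<exists>\<delta>>0. \<forall>u. t \<le> u \<longrightarrow> u < t + \<delta> \<longrightarrow> dist (cadlag_version f t) (cadlag_version f u) \<le> r"
proof -
  obtain \<delta> where \<delta>: "\<delta> > 0"
    "\<And>s s'. s \<in> dyadics \<Longrightarrow> s' \<in> dyadics \<Longrightarrow> t < s \<Longrightarrow> s < t + \<delta> \<Longrightarrow> t < s' \<Longrightarrow> s' < t + \<delta> \<Longrightarrow> dist (f s) (f s') \<le> r"
    using dyadics_right_oscillation[OF f r t] by blast
  have 1: "dist (f s) (cadlag_version f u) \<le> r"
    if "s \<in> dyadics" "t < s" "s < t + \<delta>" "t \<le> u" "u < t + \<delta>" for s u
  proof (rule dist_limit_le[OF cadlag_version_LIMSEQ[OF f]])
    show "u \<ge> 0" using that t by simp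
    have "\<forall>\<^sub>F n in sequentially. dyadic_above n u < u + (t + \<delta> - u)"
      using that t by (intro eventually_dyadic_above) auto
    then show "\<forall>\<^sub>F n in sequentially. dist (f s) (f (dyadic_above n u)) \<le> r"
      by eventually_elim (use that t dyadic_above[of u] in \<open>auto intro!: \<delta>(2) intro: le_less_trans\<close>)
  qed
  have "dist (cadlag_version f t) (cadlag_version f u) \<le> r" if "t \<le> u" "u < t + \<delta>" for u
  proof -
    have "dist (cadlag_version f u) (cadlag_version f t) \<le> r"
    proof (rule dist_limit_le[OF cadlag_version_LIMSEQ[OF f t]])
      show "\<forall>\<^sub>F n in sequentially. dist (cadlag_version f u) (f (dyadic_above n t)) \<le> r"
        using eventually_dyadic_above[OF t \<delta>(1)]
        by eventually_elim
           (use that dyadic_above[OF t] 1 dist_commute[of "cadlag_version f u"] in auto)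
    qed
    then show ?thesis by (simp add: dist_commute)
  qed
  with \<delta>(1) show ?thesis by blast
qed

lemma cadlag_version_left:
  assumes f: "regular_path f" and r: "r > 0" and t: "t > 0"
  shows "\<exists>u0<t. 0 \<le> u0 \<and> (\<forall>u v. u0 < u \<longrightarrow> u < t \<longrightarrow> u0 < v \<longrightarrow> v < t \<longrightarrow> dist (cadlag_version f u) (cadlag_version f v) \<le> r)"
proof -
  obtain w where w: "0 \<le> w" "w < t"
    "\<And>s s'. s \<in> dyadics \<Longrightarrow> s' \<in> dyadics \<Longrightarrow> w < s \<Longrightarrow> s < t \<Longrightarrow> w < s' \<Longrightarrow> s' < t \<Longrightarrow> dist (f s) (f s') \<le> r"
    using dyadics_left_oscillation[OF f r t] by blast
  have ev: "\<forall>\<^sub>F n in sequentially. w < dyadic_above n u \<and> dyadic_above n u < t" if "w < u" "u < t" for u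
  proof -
    have "\<forall>\<^sub>F n in sequentially. dyadic_above n u < u + (t - u)"
      using that w by (intro eventually_dyadic_above) auto
    then show ?thesis
      by eventually_elim (use that w dyadic_above[of u] in \<open>auto intro: less_trans\<close>)
  qed
  have 1: "dist (f s) (cadlag_version f u) \<le> r" if "s \<in> dyadics" "w < s" "s < t" "w < u" "u < t" for s u
  proof (rule dist_limit_le[OF cadlag_version_LIMSEQ[OF f]])
    show "u \<ge> 0" using that w by simp
    show "\<forall>\<^sub>F n in sequentially. dist (f s) (f (dyadic_above n u)) \<le> r"
      using ev[OF that(4,5)] by eventually_elim (use that w dyadic_above[of u] in \<open>auto intro!: w(3)\<close>)
  qed
  have "dist (cadlag_version f v) (cadlag_version f u) \<le> r" if "w < u" "u < t" "w < v" "v < t" for u v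
  proof (rule dist_limit_le[OF cadlag_version_LIMSEQ[OF f]])
    show "u \<ge> 0" using that w by simp
    show "\<forall>\<^sub>F n in sequentially. dist (cadlag_version f v) (f (dyadic_above n u)) \<le> r"
      using ev[OF that(1,2)] by eventually_elim
         (use that w dyadic_above[of u] 1 dist_commute[of "cadlag_version f v"] in auto)
  qed
  with w(1,2) show ?thesis by blast
qed

lemma right_continuous_cadlag_version:
  assumes "regular_path f" shows "right_continuous_trajectory (cadlag_version f)"
  unfolding right_continuous_trajectory_def continuous_within
proof (intro allI impI tendstoI)
  fix t e :: real assume t: "t \<ge> 0" and e: "e > 0"
  obtain \<delta> where "\<delta> > 0" "\<And>u. t \<le> u \<Longrightarrow> u < t + \<delta> \<Longrightarrow> dist (cadlag_version f t) (cadlag_version f u) \<le> e / 2"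
    using cadlag_version_right[OF assms _ t, of "e / 2"] e by auto
  then show "\<forall>\<^sub>F u in at_right t. dist (cadlag_version f u) (cadlag_version f t) < e"
    unfolding eventually_at_right_field using e
    by (intro exI[of _ "t + \<delta>"]) (auto simp: dist_commute intro: le_less_trans[where y = "e / 2"])
qed

lemma only_jumps_cadlag_version:
  assumes f: "regular_path f" shows "only_jumps_trajectory (cadlag_version f)"
  unfolding only_jumps_trajectory_def
proof (intro allI impI)
  fix t :: real assume t: "t > 0"
  let ?Y = "cadlag_version f"
  \<comment> \<open>a sequence that increases to \<open>t\<close>, along which the left limit is computed\<close>
  define s where "s n = t - t / (real n + 2)" for n
  have s: "0 < s n" "s n < t" for n
    using t by (auto simp: s_def field_simps intro: add_pos_nonneg)
  have s_lim: "s \<longlonglongrightarrow> t" unfolding s_def by real_asymp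
  have osc: "\<exists>u0<t. 0 \<le> u0 \<and> (\<forall>u v. u0 < u \<longrightarrow> u < t \<longrightarrow> u0 < v \<longrightarrow> v < t \<longrightarrow> dist (?Y u) (?Y v) \<le> e / 2)"
    if "e > 0" for e using cadlag_version_left[OF f _ t, of "e / 2"] that by auto
  have "Cauchy (\<lambda>n. ?Y (s n))"
  proof (rule metric_CauchyI)
    fix e :: real assume e: "e > 0"
    obtain u0 where u0: "u0 < t" "\<And>u v. u0 < u \<Longrightarrow> u < t \<Longrightarrow> u0 < v \<Longrightarrow> v < t \<Longrightarrow> dist (?Y u) (?Y v) \<le> e / 2"
      using osc[OF e] by blast
    obtain N where N: "\<And>n. n \<ge> N \<Longrightarrow> u0 < s n"
      using order_tendstoD(1)[OF s_lim u0(1)] by (auto simp: eventually_sequentially)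
    have "dist (?Y (s m)) (?Y (s n)) < e" if "m \<ge> N" "n \<ge> N" for m n
      using u0(2)[OF N[OF that(1)] s(2) N[OF that(2)] s(2)] e by linarith
    then show "\<exists>M. \<forall>m\<ge>M. \<forall>n\<ge>M. dist (?Y (s m)) (?Y (s n)) < e" by blast
  qed
  then obtain l where l: "(\<lambda>n. ?Y (s n)) \<longlonglongrightarrow> l" by (auto simp: Cauchy_convergent_iff convergent_def)
  have "(?Y \<longlongrightarrow> l) (at_left t)"
  proof (rule tendstoI)
    fix e :: real assume e: "e > 0"
    obtain u0 where u0: "u0 < t" "\<And>u v. u0 < u \<Longrightarrow> u < t \<Longrightarrow> u0 < v \<Longrightarrow> v < t \<Longrightarrow> dist (?Y u) (?Y v) \<le> e / 2"
      using osc[OF e] by blast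
    have "dist (?Y u) l < e" if "u0 < u" "u < t" for u
    proof -
      have "dist (?Y u) l \<le> e / 2"
      proof (rule dist_limit_le[OF l])
        show "\<forall>\<^sub>F n in sequentially. dist (?Y u) (?Y (s n)) \<le> e / 2"
          using order_tendstoD(1)[OF s_lim u0(1)] by eventually_elim (rule u0(2)[OF that _ s(2)])
      qed
      with e show ?thesis by simp
    qed
    then show "\<forall>\<^sub>F u in at_left t. dist (?Y u) l < e"
      unfolding eventually_at_left_field using u0(1) by blast
  qed
  then show "\<exists>l. (?Y \<longlongrightarrow> l) (at_left t)" ..
qed

lemma compact_cball_any: "compact (cball (z::'a) r)"
proof -
  have "cball z r = (\<lambda>y. y + z) ` cball 0 r"
  proof (intro equalityI subsetI)
    fix y assume "y \<in> cball z r"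
    then have "y - z \<in> cball 0 r" using dist_translate[of 0 z "y - z"] by simp
    then have "y - z + z \<in> (\<lambda>y. y + z) ` cball 0 r" by (rule imageI)
    then show "y \<in> (\<lambda>y. y + z) ` cball 0 r" by simp
  next
    fix y assume "y \<in> (\<lambda>y. y + z) ` cball 0 r"
    then obtain w where "y = w + z" "dist 0 w \<le> r" by auto
    then show "y \<in> cball z r" using dist_translate[of 0 z w] by simp
  qed
  then show ?thesis
    by (simp add: compact_cball compact_continuous_image continuous_intros)
qed

text \<open>The counting function takes finitely many values on a bounded interval, and the path stays in one ball of
radius \<open>1\<close> while the value is the same.\<close>

lemma bounded_cadlag_version:
  assumes f: "regular_path f" shows "bounded_trajectory (cadlag_version f)"
  unfolding bounded_trajectory_def
proof (intro allI impI)
  fix T :: real assume T: "T \<ge> 0"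
  obtain V :: "real \<Rightarrow> nat" where V: "\<And>s t. 0 \<le> s \<Longrightarrow> s \<le> t \<Longrightarrow> V s \<le> V t"
    and Vd: "\<And>s t. s \<in> dyadics \<Longrightarrow> t \<in> dyadics \<Longrightarrow> s \<le> t \<Longrightarrow> V s = V t \<Longrightarrow> dist (f s) (f t) \<le> 1"
    by (rule variation_exists[OF f zero_less_one]) (rule that)
  have D0: "s \<ge> 0" if "s \<in> dyadics" for s using that by (auto simp: dyadics_def grid_def)
  \<comment> \<open>one dyadic time for each value of the counting function; a value that is not taken gives an arbitrary time\<close>
  define rep where "rep v = (SOME s. s \<in> dyadics \<and> V s = v)" for v
  define K where "K = (\<Union>v\<le>V (T + 1). cball (f (rep v)) 1)"
  have K: "compact K" unfolding K_def by (intro compact_UN compact_cball_any) auto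
  have fK: "f s \<in> K" if "s \<in> dyadics" "s \<le> T + 1" for s
  proof -
    have "rep (V s) \<in> dyadics \<and> V (rep (V s)) = V s"
      unfolding rep_def by (rule someI[where x = s]) (use that in simp)
    then have "dist (f (rep (V s))) (f s) \<le> 1"
      using Vd[of s "rep (V s)"] Vd[of "rep (V s)" s] that by (cases "s \<le> rep (V s)") (auto simp: dist_commute)
    moreover have "V s \<le> V (T + 1)" using V[of s "T + 1"] D0 that by auto
    ultimately show ?thesis by (auto simp: K_def)
  qed
  have "cadlag_version f ` {0..T} \<subseteq> K"
  proof safe
    fix t assume "t \<in> {0..T}"
    then have t: "0 \<le> t" "t \<le> T" by auto
    show "cadlag_version f t \<in> K"
    proof (rule closed_sequentially[OF compact_imp_closed[OF K] _ cadlag_version_LIMSEQ[OF f t(1)]])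
      fix n
      have "1 / 2 ^ n \<le> (1::real)" by simp
      then show "f (dyadic_above n t) \<in> K"
        using dyadic_above[OF t(1), of n] t by (intro fK) linarith+
    qed
  qed
  then have "closure (cadlag_version f ` {0..T}) \<subseteq> K"
    by (intro closure_minimal compact_imp_closed K)
  then show "compact (closure (cadlag_version f ` {0..T}))"
    using compact_Int_closed[OF K closed_closure, of "cadlag_version f ` {0..T}"] by (simp add: Int_absorb1)
qed

section \<open>Laws of the dyadic increments\<close>

lemma distr_grid:
  assumes [measurable]: "g \<in> PiM UNIV (\<lambda>_. borel) \<rightarrow>\<^sub>M N"
  shows "distr \<Omega> N (\<lambda>\<omega>. g (\<lambda>m. \<omega> (real m / 2 ^ n))) = distr (W n) N (\<lambda>\<xi>. g (\<lambda>m. \<Sum>i<m. \<xi> i))"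
proof -
  have "distr \<Omega> N (\<lambda>\<omega>. g (\<lambda>m. \<omega> (real m / 2 ^ n))) =
      distr (distr \<Omega> (PiM UNIV (\<lambda>_. borel)) (\<lambda>\<omega> m. \<omega> (real m / 2 ^ n))) N g"
    by (subst distr_distr) (auto simp: comp_def intro!: measurable_abs_UNIV measurable_\<Omega>_coordinate)
  also have "\<dots> = distr (W n) N (\<lambda>\<xi>. g (\<lambda>m. \<Sum>i<m. \<xi> i))"
    unfolding grid_law_\<Omega>
    by (subst distr_distr) (auto simp: comp_def intro!: measurable_abs_UNIV measurable_partial_sum)
  finally show ?thesis .
qed

lemma measure_grid:
  assumes E: "Measurable.pred (PiM UNIV (\<lambda>_. borel)) Q"
  shows "measure \<Omega> {\<omega>\<in>space \<Omega>. Q (\<lambda>m. \<omega> (real m / 2 ^ n))} = measure (W n) {\<xi>. Q (\<lambda>m. \<Sum>i<m. \<xi> i)}"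
proof -
  note [measurable] = E
  have [measurable]: "(\<lambda>\<omega> m. \<omega> (real m / 2 ^ n)) \<in> \<Omega> \<rightarrow>\<^sub>M PiM UNIV (\<lambda>_. borel)"
    "(\<lambda>\<xi> m. \<Sum>i<m. \<xi> i) \<in> W n \<rightarrow>\<^sub>M PiM UNIV (\<lambda>_. borel)"
    by (auto intro!: measurable_abs_UNIV measurable_\<Omega>_coordinate measurable_partial_sum)
  have m: "(\<lambda>\<omega>. Q (\<lambda>m. \<omega> (real m / 2 ^ n))) \<in> \<Omega> \<rightarrow>\<^sub>M count_space UNIV"
    "(\<lambda>\<xi>. Q (\<lambda>m. \<Sum>i<m. \<xi> i)) \<in> W n \<rightarrow>\<^sub>M count_space UNIV"
    by measurable
  have "measure (distr \<Omega> (count_space UNIV) (\<lambda>\<omega>. Q (\<lambda>m. \<omega> (real m / 2 ^ n)))) {True} =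
      measure (distr (W n) (count_space UNIV) (\<lambda>\<xi>. Q (\<lambda>m. \<Sum>i<m. \<xi> i))) {True}"
    by (subst distr_grid) auto
  then show ?thesis
    by (simp add: measure_distr[OF m(1)] measure_distr[OF m(2)] vimage_def Int_def space_W conj_commute)
qed

lemma borel_measurable_group_diff [measurable]:
  assumes "f \<in> borel_measurable M" "g \<in> borel_measurable M"
  shows "(\<lambda>\<omega>. f \<omega> - g \<omega> :: 'a) \<in> borel_measurable M"
  by (rule borel_measurable_continuous_Pair[OF assms]) (intro continuous_intros)

lemma partial_sum_diff: "(m::nat) \<le> m' \<Longrightarrow> (\<Sum>i<m'. \<xi> i) - (\<Sum>i<m. \<xi> i) = (\<Sum>i\<in>{m..<m'}. \<xi> i :: 'a)"
proof -
  assume "m \<le> m'"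
  then have "{..<m'} - {..<m} = {m..<m'}" by auto
  with \<open>m \<le> m'\<close> sum_diff[of "{..<m'}" "{..<m}" \<xi>] show ?thesis by simp
qed

lemma distr_\<Omega>_increment:
  assumes "m \<le> m'"
  shows "distr \<Omega> borel (\<lambda>\<omega>. \<omega> (real m' / 2 ^ n) - \<omega> (real m / 2 ^ n)) = \<nu> (real (m' - m) / 2 ^ n)"
proof -
  have "distr \<Omega> borel (\<lambda>\<omega>. \<omega> (real m' / 2 ^ n) - \<omega> (real m / 2 ^ n)) =
      distr (W n) borel (\<lambda>\<xi>. \<Sum>i\<in>{m..<m'}. \<xi> i)"
    by (subst distr_grid[of "\<lambda>\<eta>. \<eta> m' - \<eta> m" borel n]) (simp_all add: partial_sum_diff[OF assms])
  then show ?thesis using distr_W_sum[of "{m..<m'}" n] by simp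
qed

lemma distr_\<Omega>_point: "distr \<Omega> borel (\<lambda>\<omega>. \<omega> (real m / 2 ^ n)) = \<nu> (real m / 2 ^ n)"
  using distr_grid[of "\<lambda>\<eta>. \<eta> m" borel n] distr_W_sum[of "{..<m}" n] by simp

text \<open>The positions up to index \<open>m\<close> depend on the increments below \<open>m\<close> only, and the step from \<open>m\<close> to \<open>m'\<close> on
later ones.\<close>

lemma measure_cylinder_increment:
  assumes I: "finite I" "\<And>i. i \<in> I \<Longrightarrow> k i \<le> m" and m: "m \<le> m'"
    and A: "\<And>i. i \<in> I \<Longrightarrow> A i \<in> sets borel" and B: "B \<in> sets borel"
  shows "measure \<Omega> {\<omega>\<in>space \<Omega>. (\<forall>i\<in>I. \<omega> (real (k i) / 2 ^ n) \<in> A i) \<and>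
        \<omega> (real m' / 2 ^ n) - \<omega> (real m / 2 ^ n) \<in> B} =
    measure \<Omega> {\<omega>\<in>space \<Omega>. \<forall>i\<in>I. \<omega> (real (k i) / 2 ^ n) \<in> A i} * measure (\<nu> (real (m' - m) / 2 ^ n)) B"
proof -
  interpret W: prob_space "W n" by (rule prob_space_W)
  note [measurable] = A B
  have [measurable]: "finite I" by fact
  let ?f = "\<lambda>\<eta>. \<forall>i\<in>I. (\<Sum>j<k i. \<eta> j) \<in> A i"
  let ?g = "\<lambda>\<eta> :: nat \<Rightarrow> 'a. \<Sum>j\<in>{m..<m'}. \<eta> j"
  have f[measurable]: "?f \<in> PiM {..<m} (\<lambda>_. borel) \<rightarrow>\<^sub>M count_space UNIV"
  proof -
    have "(\<lambda>\<eta>. \<Sum>j<k i. \<eta> j) \<in> borel_measurable (PiM {..<m} (\<lambda>_. borel :: 'a measure))" if "i \<in> I" for i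
      using I(2)[OF that] by (intro borel_measurable_sum measurable_component_singleton) auto
    then show ?thesis using I(1) A by (intro pred_intros_finite) (auto intro!: pred_sets2)
  qed
  have [measurable]: "?g \<in> PiM {m..<m'} (\<lambda>_. borel) \<rightarrow>\<^sub>M borel"
    by (intro borel_measurable_sum measurable_component_singleton) auto
  have g: "(\<lambda>\<eta>. ?g \<eta> \<in> B) \<in> PiM {m..<m'} (\<lambda>_. borel) \<rightarrow>\<^sub>M count_space UNIV"
    by measurable
  have iv: "W.indep_var (count_space UNIV) (\<lambda>\<xi>. ?f (restrict \<xi> {..<m})) (count_space UNIV) (\<lambda>\<xi>. ?g (restrict \<xi> {m..<m'}) \<in> B)"
    by (rule indep_var_W_functions[OF _ f g]) auto
  have f_eq: "(\<Sum>j<k i. restrict \<xi> {..<m} j) = (\<Sum>j<k i. \<xi> j)" if "i \<in> I" for i and \<xi> :: "nat \<Rightarrow> 'a"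
    using I(2)[OF that] by (intro sum.cong) auto
  have r: "?f (restrict \<xi> {..<m}) = ?f \<xi>" "?g (restrict \<xi> {m..<m'}) = ?g \<xi>" for \<xi>
    by (simp_all only: f_eq cong: ball_cong) (auto intro: sum.cong)
  note iv = iv[unfolded r]
  have "measure (W n) {\<xi>. ?f \<xi> \<and> ?g \<xi> \<in> B} = measure (W n) {\<xi>. ?f \<xi>} * measure (W n) {\<xi>. ?g \<xi> \<in> B}"
    using W.indep_varD[OF iv, of "{True}" "{True}"] by (simp add: vimage_def space_W Int_def)
  moreover have "measure (W n) {\<xi>. ?g \<xi> \<in> B} = measure (\<nu> (real (m' - m) / 2 ^ n)) B"
  proof -
    have "measure (distr (W n) borel ?g) B = measure (W n) {\<xi>. ?g \<xi> \<in> B}"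
      using B by (subst measure_distr) (auto simp: vimage_def space_W intro: measurable_partial_sum)
    then show ?thesis using distr_W_sum[of "{m..<m'}" n] by simp
  qed
  moreover have "measure \<Omega> {\<omega>\<in>space \<Omega>. (\<forall>i\<in>I. \<omega> (real (k i) / 2 ^ n) \<in> A i) \<and>
        \<omega> (real m' / 2 ^ n) - \<omega> (real m / 2 ^ n) \<in> B} = measure (W n) {\<xi>. ?f \<xi> \<and> ?g \<xi> \<in> B}"
    using measure_grid[of "\<lambda>\<eta>. (\<forall>i\<in>I. \<eta> (k i) \<in> A i) \<and> \<eta> m' - \<eta> m \<in> B" n] I(1)
    by (simp add: partial_sum_diff[OF m])
  moreover have "measure \<Omega> {\<omega>\<in>space \<Omega>. \<forall>i\<in>I. \<omega> (real (k i) / 2 ^ n) \<in> A i} = measure (W n) {\<xi>. ?f \<xi>}"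
    using measure_grid[of "\<lambda>\<eta>. \<forall>i\<in>I. \<eta> (k i) \<in> A i" n] I(1) by simp
  ultimately show ?thesis by simp
qed

section \<open>Almost every dyadic path is regular\<close>

lemma dist_eq_diff: "dist x y = dist 0 (y - x :: 'a)"
  using dist_translate[of 0 x "y - x"] by simp

lemma rate_nonneg: "r > 0 \<Longrightarrow> c r \<ge> 0"
  using \<nu>_cball[of 1 r] prob_space.prob_le_1[OF prob_space_\<nu>[of 1]] by (smt (verit))

lemma emeasure_step_change:
  assumes r: "r > 0"
  shows "emeasure \<Omega> {\<omega>\<in>space \<Omega>. r < dist (\<omega> (real i / 2 ^ n)) (\<omega> (real (Suc i) / 2 ^ n))} \<le> ennreal (c r / 2 ^ n)"
proof -
  interpret prob_space \<Omega> by (rule prob_space_\<Omega>)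
  interpret N: prob_space "\<nu> (1 / 2 ^ n)" by (rule prob_space_\<nu>) simp
  have sp: "space (\<nu> (1 / 2 ^ n)) = UNIV" using sets_eq_imp_space_eq[OF sets_\<nu>[of "1 / 2 ^ n"]] by simp
  have [measurable]: "cball 0 r \<in> sets borel" by simp
  have "measure \<Omega> {\<omega>\<in>space \<Omega>. r < dist (\<omega> (real i / 2 ^ n)) (\<omega> (real (Suc i) / 2 ^ n))}
      = measure (distr \<Omega> borel (\<lambda>\<omega>. \<omega> (real (Suc i) / 2 ^ n) - \<omega> (real i / 2 ^ n))) (- cball 0 r)"
    by (subst measure_distr) (auto simp: vimage_def Int_def not_le dist_eq_diff[of "_ (real i / 2 ^ n)"] conj_commute
        simp del: of_nat_Suc)
  also have "\<dots> = measure (\<nu> (1 / 2 ^ n)) (- cball 0 r)"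
    unfolding distr_\<Omega>_increment[OF le_SucI[OF le_refl]] by simp
  also have "\<dots> = 1 - measure (\<nu> (1 / 2 ^ n)) (cball 0 r)"
    using N.prob_compl[of "cball 0 r"] by (simp add: sets_\<nu> sp Compl_eq_Diff_UNIV)
  also have "\<dots> \<le> c r / 2 ^ n" using \<nu>_cball[of "1 / 2 ^ n" r] r by simp
  finally show ?thesis by (simp add: emeasure_eq_measure ennreal_leI)
qed

lemma measurable_changes [measurable]: "(\<lambda>\<omega>. changes \<omega> n r m) \<in> \<Omega> \<rightarrow>\<^sub>M count_space UNIV"
proof -
  have "changes \<omega> n r m = (\<Sum>i<m. if r < dist (\<omega> (real i / 2 ^ n)) (\<omega> (real (Suc i) / 2 ^ n)) then 1 else 0)" for \<omega>
    unfolding changes_def by (subst sum.If_cases) (auto simp: lessThan_def Int_def)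
  then show ?thesis by (simp del: of_nat_Suc)
qed

lemma nn_integral_changes_le:
  assumes r: "r > 0"
  shows "(\<integral>\<^sup>+\<omega>. of_nat (changes \<omega> n r m) \<partial>\<Omega>) \<le> ennreal (real m * c r / 2 ^ n)"
proof -
  let ?E = "\<lambda>i. {\<omega>\<in>space \<Omega>. r < dist (\<omega> (real i / 2 ^ n)) (\<omega> (real (Suc i) / 2 ^ n))}"
  have E[measurable]: "?E i \<in> sets \<Omega>" for i by measurable
  have eq: "of_nat (changes \<omega> n r m) = (\<Sum>i<m. indicator (?E i) \<omega> :: ennreal)" if "\<omega> \<in> space \<Omega>" for \<omega>
    unfolding changes_def using that
    by (subst card_eq_sum, subst of_nat_sum) (auto simp: indicator_def sum.If_cases lessThan_def Int_def)
  have "(\<integral>\<^sup>+\<omega>. of_nat (changes \<omega> n r m) \<partial>\<Omega>) = (\<Sum>i<m. emeasure \<Omega> (?E i))"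
    by (simp only: eq nn_integral_sum[OF borel_measurable_indicator[OF E]] nn_integral_indicator[OF E] cong: nn_integral_cong)
  also have "\<dots> \<le> (\<Sum>i<m. ennreal (c r / 2 ^ n))" by (intro sum_mono emeasure_step_change r)
  also have "\<dots> = ennreal (real m * c r / 2 ^ n)"
    using rate_nonneg[OF r] by (simp add: ennreal_of_nat_eq_real_of_nat ennreal_mult'[symmetric])
  finally show ?thesis .
qed

text \<open>The expected number of long steps up to time \<open>T\<close> is at most \<open>T * c r\<close> on every grid.  As the number increases
with the fineness of the grid, monotone convergence makes its supremum integrable.\<close>

lemma AE_changes_bounded:
  assumes r: "r > 0"
  shows "AE \<omega> in \<Omega>. \<exists>M. \<forall>n. changes \<omega> n r (T * 2 ^ n) \<le> M"
proof -
  let ?C = "\<lambda>n \<omega>. of_nat (changes \<omega> n r (T * 2 ^ n)) :: ennreal"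
  have inc: "incseq ?C"
  proof (rule incseq_SucI, rule le_funI)
    fix n \<omega>
    show "?C n \<omega> \<le> ?C (Suc n) \<omega>"
      using changes_refine[of \<omega> n r "T * 2 ^ n"] by (simp add: mult.left_commute)
  qed
  have "(\<integral>\<^sup>+\<omega>. (SUP n. ?C n \<omega>) \<partial>\<Omega>) = (SUP n. \<integral>\<^sup>+\<omega>. ?C n \<omega> \<partial>\<Omega>)"
    by (intro nn_integral_monotone_convergence_SUP inc) measurable
  also have "\<dots> \<le> ennreal (T * c r)"
    using nn_integral_changes_le[OF r] by (intro SUP_least order_trans[OF nn_integral_changes_le[OF r]]) simp
  finally have "(\<integral>\<^sup>+\<omega>. (SUP n. ?C n \<omega>) \<partial>\<Omega>) \<noteq> \<infinity>" by (auto simp: top_unique)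
  then have "AE \<omega> in \<Omega>. (SUP n. ?C n \<omega>) \<noteq> \<infinity>"
    by (intro nn_integral_noteq_infinite) measurable
  then show ?thesis
  proof eventually_elim
    case (elim \<omega>)
    then obtain M :: nat where M: "(SUP n. ?C n \<omega>) < of_nat M"
      by (metis ennreal_Ex_less_of_nat infinity_ennreal_def less_top)
    have "changes \<omega> n r (T * 2 ^ n) \<le> M" for n
    proof -
      have "?C n \<omega> \<le> (SUP n. ?C n \<omega>)" by (rule SUP_upper) simp
      with M have "?C n \<omega> < of_nat M" by (rule order.strict_trans1[rotated])
      then show ?thesis by (simp add: ennreal_of_nat_eq_real_of_nat ennreal_less_iff)
    qed
    then show ?case by blast
  qed
qed

lemma AE_regular_path: "AE \<omega> in \<Omega>. regular_path \<omega>"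
  unfolding regular_path_def AE_all_countable by (intro allI AE_changes_bounded) simp

lemma measurable_regular_path [measurable]: "Measurable.pred \<Omega> regular_path"
  unfolding regular_path_def by measurable

section \<open>Balls generate the Borel sets\<close>

text \<open>The empty set is included because balls that are not nested are disjoint.\<close>

definition balls :: "'a set set" where
  "balls = insert {} {cball z r | z r. r > 0}"

lemma ballsE:
  assumes "B \<in> balls"
  obtains "B = {}" | z r where "r > 0" "B = cball z r"
  using assms by (auto simp: balls_def)

lemma cball_in_balls: "r > 0 \<Longrightarrow> cball z r \<in> balls"
  unfolding balls_def by blast

lemma open_cball: "r > 0 \<Longrightarrow> open (cball (z::'a) r)"
  unfolding open_dist
proof (intro ballI)
  fix x assume "r > 0" "x \<in> cball z r"
  then have "dist z y \<le> r" if "dist y x < r" for y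
    using ultrametric[of z y x] that by (simp add: dist_commute)
  then show "\<exists>e>0. \<forall>y. dist y x < e \<longrightarrow> y \<in> cball z r" using \<open>r > 0\<close> by auto
qed

lemma balls_clopen: "B \<in> balls \<Longrightarrow> open B \<and> closed B"
  by (erule ballsE) (auto intro: open_cball)

lemma cball_eq:
  assumes "x \<in> cball (z::'a) r" shows "cball z r = cball x r"
proof -
  have "dist z x \<le> r" using assms by simp
  then have "dist z y \<le> r \<longleftrightarrow> dist x y \<le> r" for y
    using ultrametric[of z y x] ultrametric[of x y z] by (auto simp: dist_commute max_def split: if_splits)
  then show ?thesis by auto
qed

lemma Int_stable_balls: "Int_stable balls"
proof (rule Int_stableI)
  fix A B assume AB: "A \<in> balls" "B \<in> balls"
  show "A \<inter> B \<in> balls"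
  proof (cases "A \<inter> B = {}")
    case False
    then obtain x where x: "x \<in> A" "x \<in> B" by auto
    obtain z r where A: "r > 0" "A = cball z r" using AB(1) x by (auto elim: ballsE)
    obtain w s where B: "s > 0" "B = cball w s" using AB(2) x by (auto elim: ballsE)
    have "A = cball x r" "B = cball x s" using cball_eq x A B by auto
    then have "A \<inter> B = cball x (min r s)" by auto
    then show ?thesis unfolding balls_def using A(1) B(1) by (auto intro!: exI[of _ x] exI[of _ "min r s"])
  qed (simp add: balls_def)
qed

lemma borel_eq_sigma_balls: "sets (borel :: 'a measure) = sigma_sets UNIV balls"
proof
  show "sets (borel :: 'a measure) \<subseteq> sigma_sets UNIV balls"
    unfolding borel_def
  proof (subst sets_measure_of, simp, rule sigma_sets_mono, rule subsetI)
    fix U :: "'a set" assume "U \<in> {S. open S}"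
    then have U: "open U" by simp
    let ?F = "{B \<in> balls. B \<subseteq> U}"
    have "\<Union> ?F = U"
    proof (intro equalityI subsetI)
      fix x assume x: "x \<in> U"
      obtain e where "e > 0" "cball x e \<subseteq> U" using U x open_contains_cball by blast
      then show "x \<in> \<Union> ?F" by (intro UnionI[of "cball x e"]) (auto simp: cball_in_balls)
    qed auto
    moreover obtain \<F> where "\<F> \<subseteq> ?F" "countable \<F>" "\<Union> \<F> = \<Union> ?F"
      by (rule Lindelof[of ?F]) (use balls_clopen in auto)
    ultimately have "U = \<Union> \<F>" "countable \<F>" "\<F> \<subseteq> balls" by auto
    then show "U \<in> sigma_sets UNIV balls"
      by (auto intro!: sigma_sets_UNION)
  qed
  show "sigma_sets UNIV balls \<subseteq> sets (borel :: 'a measure)"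
    using balls_clopen by (intro sets.sigma_sets_subset[of _ borel, simplified]) auto
qed

section \<open>Continuity in time of the convolution semigroup\<close>

text \<open>The measure \<open>\<nu> t\<close> is the law of a sum in which the second summand, of law \<open>\<nu> (t - s)\<close>, is at most \<open>r\<close> long
outside an event of probability \<open>(t - s) * c r\<close>; adding a vector of length at most \<open>r\<close> does not lead out of a ball
of radius \<open>r\<close>, or into it.\<close>

lemma \<nu>_cball_Lipschitz:
  assumes s: "0 \<le> s" and st: "s \<le> t" and r: "r > 0"
  shows "\<bar>measure (\<nu> t) (cball z r) - measure (\<nu> s) (cball z r)\<bar> \<le> (t - s) * c r"
proof -
  interpret S: prob_space "\<nu> s" by (rule prob_space_\<nu>[OF s])
  interpret D: prob_space "\<nu> (t - s)" using st by (intro prob_space_\<nu>) simp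
  interpret P: pair_prob_space "\<nu> s" "\<nu> (t - s)" ..
  note [measurable_cong] = sets_\<nu>[OF s] sets_\<nu>[of "t - s"]
  have [measurable_cong]: "sets (\<nu> (t - s)) = sets borel" using st by (intro sets_\<nu>) simp
  have sp: "space (\<nu> s) = UNIV" "space (\<nu> (t - s)) = UNIV"
    using sets_eq_imp_space_eq[OF sets_\<nu>[OF s]] sets_eq_imp_space_eq[OF sets_\<nu>[of "t - s"]] st by auto
  let ?P = "\<nu> s \<Otimes>\<^sub>M \<nu> (t - s)"
  have spP: "space ?P = UNIV" by (simp add: space_pair_measure sp)
  have [measurable]: "cball z r \<in> sets borel" "cball 0 r \<in> sets borel" by auto
  have "\<nu> t = distr ?P borel (\<lambda>(x, y). x + y)" using \<nu>_add[of s "t - s"] s st by simp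
  then have 1: "measure (\<nu> t) (cball z r) = P.prob {p. fst p + snd p \<in> cball z r}"
    by (simp add: measure_distr vimage_def spP split_beta')
  have "measure (\<nu> s) (cball z r) = P.prob (cball z r \<times> UNIV)"
    using D.emeasure_space_1 by (simp add: measure_def D.emeasure_pair_measure_Times sp)
  also have "cball z r \<times> UNIV = {p. fst p \<in> cball z r}" by auto
  finally have 2: "measure (\<nu> s) (cball z r) = P.prob {p. fst p \<in> cball z r}" .
  have "P.prob (UNIV \<times> (- cball 0 r)) = D.prob (- cball 0 r)"
  proof -
    have "emeasure ?P (UNIV \<times> (- cball 0 r)) = emeasure (\<nu> s) UNIV * emeasure (\<nu> (t - s)) (- cball 0 r)"
      by (intro D.emeasure_pair_measure_Times) measurable
    then show ?thesis using S.emeasure_space_1 by (simp add: measure_def sp)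
  qed
  also have "\<dots> \<le> (t - s) * c r"
    using D.prob_compl[of "cball 0 r"] \<nu>_cball[of "t - s" r] st r by (simp add: sets_\<nu> sp Compl_eq_Diff_UNIV)
  finally have 3: "P.prob (UNIV \<times> (- cball 0 r)) \<le> (t - s) * c r" .
  have same: "fst p + snd p \<in> cball z r \<longleftrightarrow> fst p \<in> cball z r" if "snd p \<in> cball 0 r" for p
  proof -
    have d: "dist (fst p) (fst p + snd p) \<le> r" using that by (simp add: dist_eq_diff[of "fst p"])
    then show ?thesis
      using ultrametric[of z "fst p + snd p" "fst p"] ultrametric[of z "fst p" "fst p + snd p"]
      by (auto simp: dist_commute)
  qed
  \<comment> \<open>up to the exceptional set \<open>G\<close>, the events \<open>E\<close> and \<open>F\<close> are the same\<close>
  define E F G where "E = {p. fst p + snd p \<in> cball z r}" and "F = {p :: 'a \<times> 'a. fst p \<in> cball z r}"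
    and "G = (UNIV :: 'a set) \<times> (- cball 0 r :: 'a set)"
  have "{p \<in> space ?P. fst p + snd p \<in> cball z r} \<in> sets ?P" "{p \<in> space ?P. fst p \<in> cball z r} \<in> sets ?P"
    by measurable
  then have m: "E \<in> sets ?P" "F \<in> sets ?P"
    by (simp_all only: spP E_def F_def UNIV_I simp_thms)
  have mG: "G \<in> sets ?P"
    unfolding G_def by (intro pair_measureI) measurable
  have "E \<subseteq> F \<union> G" "F \<subseteq> E \<union> G"
    using same by (auto simp: E_def F_def G_def)
  then have "P.prob E \<le> P.prob F + P.prob G" "P.prob F \<le> P.prob E + P.prob G"
    using P.finite_measure_mono[of E "F \<union> G"] measure_Un_le[of F ?P G]
      P.finite_measure_mono[of F "E \<union> G"] measure_Un_le[of E ?P G] m mG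
    by (meson order_trans sets.Un)+
  then show ?thesis
    using 3 unfolding 1 2 E_def[symmetric] F_def[symmetric] G_def[symmetric] by linarith
qed

lemma \<nu>_balls_tendsto:
  assumes B: "B \<in> balls" and h: "h \<ge> 0" and hn: "\<And>n. hn n \<ge> 0" "hn \<longlonglongrightarrow> h"
  shows "(\<lambda>n. measure (\<nu> (hn n)) B) \<longlonglongrightarrow> measure (\<nu> h) B"
  using B
proof (cases rule: ballsE)
  case (2 z r)
  have "norm (measure (\<nu> (hn n)) B - measure (\<nu> h) B) \<le> \<bar>hn n - h\<bar> * c r" for n
    using \<nu>_cball_Lipschitz[of h "hn n" r z] \<nu>_cball_Lipschitz[of "hn n" h r z] h hn(1)[of n] 2
    by (cases "h \<le> hn n") (auto simp: abs_minus_commute)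
  then have le: "\<forall>\<^sub>F n in sequentially. norm (measure (\<nu> (hn n)) B - measure (\<nu> h) B) \<le> \<bar>hn n - h\<bar> * c r"
    by (intro always_eventually allI)
  have "(\<lambda>n. \<bar>hn n - h\<bar> * c r) \<longlonglongrightarrow> \<bar>h - h\<bar> * c r"
    by (intro tendsto_intros hn)
  then have "(\<lambda>n. \<bar>hn n - h\<bar> * c r) \<longlonglongrightarrow> 0" by simp
  with le have "(\<lambda>n. measure (\<nu> (hn n)) B - measure (\<nu> h) B) \<longlonglongrightarrow> 0"
    by (rule Lim_null_comparison)
  then show ?thesis by (simp add: LIM_zero_iff)
qed simp

section \<open>The right-continuous process\<close>

text \<open>The value \<open>0\<close> on the null set of irregular paths keeps every sample path right-continuous with left limits.\<close>

definition path :: "(real \<Rightarrow> 'a) \<Rightarrow> real \<Rightarrow> 'a" where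
  "path \<omega> t = (if regular_path \<omega> then cadlag_version \<omega> t else 0)"

lemma path_LIMSEQ:
  assumes "regular_path \<omega>" "t \<ge> 0"
  shows "(\<lambda>n. \<omega> (dyadic_above n t)) \<longlonglongrightarrow> path \<omega> t"
  using cadlag_version_LIMSEQ[OF assms] assms by (simp add: path_def)

lemma measurable_path [measurable]:
  assumes t: "t \<ge> 0" shows "(\<lambda>\<omega>. path \<omega> t) \<in> borel_measurable \<Omega>"
proof (rule borel_measurable_LIMSEQ_metric)
  fix n show "(\<lambda>\<omega>. if regular_path \<omega> then \<omega> (dyadic_above n t) else 0) \<in> borel_measurable \<Omega>"
    unfolding dyadic_above_def by measurable
next
  fix \<omega> show "(\<lambda>n. if regular_path \<omega> then \<omega> (dyadic_above n t) else 0) \<longlonglongrightarrow> path \<omega> t"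
    using path_LIMSEQ[OF _ t] by (cases "regular_path \<omega>") (simp_all add: path_def)
qed

text \<open>This is how convergence along the grids is transported to probabilities: for sets without boundary, the
indicators converge pointwise.\<close>

lemma eventually_clopen_iff:
  assumes "X \<longlonglongrightarrow> l" "open A" "closed A"
  shows "\<forall>\<^sub>F n in sequentially. X n \<in> A \<longleftrightarrow> l \<in> A"
proof (cases "l \<in> A")
  case True
  then show ?thesis using topological_tendstoD[OF assms(1,2)] by simp
next
  case False
  then have "\<forall>\<^sub>F n in sequentially. X n \<in> - A"
    using topological_tendstoD[OF assms(1), of "- A"] assms(3) by (simp add: open_Compl)
  then show ?thesis by eventually_elim (use False in simp)
qed

lemma prob_tendsto:
  assumes E: "\<And>n. Measurable.pred \<Omega> (E n)" "Measurable.pred \<Omega> F"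
    and ev: "AE \<omega> in \<Omega>. \<forall>\<^sub>F n in sequentially. E n \<omega> \<longleftrightarrow> F \<omega>"
  shows "(\<lambda>n. measure \<Omega> {\<omega>\<in>space \<Omega>. E n \<omega>}) \<longlonglongrightarrow> measure \<Omega> {\<omega>\<in>space \<Omega>. F \<omega>}"
proof -
  interpret prob_space \<Omega> by (rule prob_space_\<Omega>)
  note [measurable] = E
  have "(\<lambda>n. \<integral>\<omega>. indicator {\<omega>\<in>space \<Omega>. E n \<omega>} \<omega> \<partial>\<Omega> :: real) \<longlonglongrightarrow> (\<integral>\<omega>. indicator {\<omega>\<in>space \<Omega>. F \<omega>} \<omega> \<partial>\<Omega>)"
  proof (rule integral_dominated_convergence[where w = "\<lambda>_. 1"])
    show "AE \<omega> in \<Omega>. (\<lambda>n. indicator {\<omega>\<in>space \<Omega>. E n \<omega>} \<omega> :: real) \<longlonglongrightarrow> indicator {\<omega>\<in>space \<Omega>. F \<omega>} \<omega>"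
      using ev
    proof eventually_elim
      case (elim \<omega>)
      then have "\<forall>\<^sub>F n in sequentially. indicator {\<omega>\<in>space \<Omega>. E n \<omega>} \<omega> = (indicator {\<omega>\<in>space \<Omega>. F \<omega>} \<omega> :: real)"
        by eventually_elim (simp add: indicator_def)
      then show ?case by (rule tendsto_eventually)
    qed
  qed (auto simp: indicator_def)
  then show ?thesis by simp
qed

text \<open>The identity holds along every grid, and both sides converge.  At each stage all times are replaced by the grid
points after them, which keeps the order of the times.\<close>

lemma measure_path_cylinder_increment:
  assumes I: "finite I" "\<And>i. i \<in> I \<Longrightarrow> 0 \<le> i \<and> i \<le> t" and t: "t \<ge> 0" and h: "h \<ge> 0"
    and A: "\<And>i. i \<in> I \<Longrightarrow> open (A i) \<and> closed (A i)" and B: "B \<in> balls"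
  shows "measure \<Omega> {\<omega>\<in>space \<Omega>. (\<forall>i\<in>I. path \<omega> i \<in> A i) \<and> path \<omega> (t + h) - path \<omega> t \<in> B} =
    measure \<Omega> {\<omega>\<in>space \<Omega>. \<forall>i\<in>I. path \<omega> i \<in> A i} * measure (\<nu> h) B"
proof -
  note [measurable] = I(1)
  have A'[measurable]: "A i \<in> sets borel" if "i \<in> I" for i using A[OF that] by auto
  have B'[measurable]: "B \<in> sets borel" and Boc: "open B" "closed B" using balls_clopen[OF B] by auto
  define k where "k n u = nat \<lfloor>u * 2 ^ n\<rfloor> + 1" for n and u :: real
  have d: "dyadic_above n u = real (k n u) / 2 ^ n" for n u by (simp add: k_def dyadic_above_def)
  have k_mono: "k n u \<le> k n v" if "u \<le> v" for n u v
    unfolding k_def using that by (intro add_right_mono nat_mono floor_mono mult_right_mono) auto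
  have mI: "(\<lambda>\<omega>. \<forall>i\<in>I. path \<omega> i \<in> A i) \<in> \<Omega> \<rightarrow>\<^sub>M count_space UNIV"
    "(\<lambda>\<omega>. \<forall>i\<in>I. \<omega> (dyadic_above n i) \<in> A i) \<in> \<Omega> \<rightarrow>\<^sub>M count_space UNIV" for n
  proof -
    show "(\<lambda>\<omega>. \<forall>i\<in>I. path \<omega> i \<in> A i) \<in> \<Omega> \<rightarrow>\<^sub>M count_space UNIV"
      using I by (intro pred_intros_finite pred_sets2[OF A'] measurable_path) auto
    show "(\<lambda>\<omega>. \<forall>i\<in>I. \<omega> (dyadic_above n i) \<in> A i) \<in> \<Omega> \<rightarrow>\<^sub>M count_space UNIV"
      unfolding d using I by (intro pred_intros_finite pred_sets2[OF A'] measurable_\<Omega>_coordinate) auto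
  qed
  have mD: "(\<lambda>\<omega>. path \<omega> (t + h) - path \<omega> t \<in> B) \<in> \<Omega> \<rightarrow>\<^sub>M count_space UNIV"
    "(\<lambda>\<omega>. \<omega> (dyadic_above n (t + h)) - \<omega> (dyadic_above n t) \<in> B) \<in> \<Omega> \<rightarrow>\<^sub>M count_space UNIV" for n
  proof -
    show "(\<lambda>\<omega>. path \<omega> (t + h) - path \<omega> t \<in> B) \<in> \<Omega> \<rightarrow>\<^sub>M count_space UNIV"
      using t h by (intro pred_sets2[OF B'] borel_measurable_group_diff measurable_path) auto
    show "(\<lambda>\<omega>. \<omega> (dyadic_above n (t + h)) - \<omega> (dyadic_above n t) \<in> B) \<in> \<Omega> \<rightarrow>\<^sub>M count_space UNIV"
      unfolding d by (intro pred_sets2[OF B'] borel_measurable_group_diff measurable_\<Omega>_coordinate)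
  qed
  have evI: "\<forall>\<^sub>F n in sequentially. (\<forall>i\<in>I. \<omega> (dyadic_above n i) \<in> A i) \<longleftrightarrow> (\<forall>i\<in>I. path \<omega> i \<in> A i)"
    if "regular_path \<omega>" for \<omega>
  proof -
    have "\<forall>\<^sub>F n in sequentially. \<forall>i\<in>I. \<omega> (dyadic_above n i) \<in> A i \<longleftrightarrow> path \<omega> i \<in> A i"
      using I A path_LIMSEQ[OF that] by (intro eventually_ball_finite ballI eventually_clopen_iff) auto
    then show ?thesis by eventually_elim blast
  qed
  have evD: "\<forall>\<^sub>F n in sequentially. \<omega> (dyadic_above n (t + h)) - \<omega> (dyadic_above n t) \<in> B \<longleftrightarrow> path \<omega> (t + h) - path \<omega> t \<in> B"
    if "regular_path \<omega>" for \<omega>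
    using path_LIMSEQ[OF that] t h by (intro eventually_clopen_iff tendsto_diff Boc) auto
  let ?L = "\<lambda>n. measure \<Omega> {\<omega>\<in>space \<Omega>. (\<forall>i\<in>I. \<omega> (dyadic_above n i) \<in> A i) \<and> \<omega> (dyadic_above n (t + h)) - \<omega> (dyadic_above n t) \<in> B}"
  let ?R = "\<lambda>n. measure \<Omega> {\<omega>\<in>space \<Omega>. \<forall>i\<in>I. \<omega> (dyadic_above n i) \<in> A i}"
  let ?h = "\<lambda>n. real (k n (t + h) - k n t) / 2 ^ n"
  have "?L \<longlonglongrightarrow> measure \<Omega> {\<omega>\<in>space \<Omega>. (\<forall>i\<in>I. path \<omega> i \<in> A i) \<and> path \<omega> (t + h) - path \<omega> t \<in> B}"
  proof (rule prob_tendsto)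
    show "AE \<omega> in \<Omega>. \<forall>\<^sub>F n in sequentially.
        ((\<forall>i\<in>I. \<omega> (dyadic_above n i) \<in> A i) \<and> \<omega> (dyadic_above n (t + h)) - \<omega> (dyadic_above n t) \<in> B) \<longleftrightarrow>
        ((\<forall>i\<in>I. path \<omega> i \<in> A i) \<and> path \<omega> (t + h) - path \<omega> t \<in> B)"
      using AE_regular_path
    proof eventually_elim
      case (elim \<omega>)
      from evI[OF elim] evD[OF elim] show ?case by eventually_elim simp
    qed
  qed (intro pred_intros_logic mI mD)+
  moreover have "?L n = ?R n * measure (\<nu> (?h n)) B" for n
    unfolding d using I h t by (intro measure_cylinder_increment k_mono A' B') auto
  moreover have "(\<lambda>n. ?R n * measure (\<nu> (?h n)) B) \<longlonglongrightarrow> measure \<Omega> {\<omega>\<in>space \<Omega>. \<forall>i\<in>I. path \<omega> i \<in> A i} * measure (\<nu> h) B"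
  proof (intro tendsto_mult \<nu>_balls_tendsto B h)
    show "?R \<longlonglongrightarrow> measure \<Omega> {\<omega>\<in>space \<Omega>. \<forall>i\<in>I. path \<omega> i \<in> A i}"
    proof (rule prob_tendsto)
      show "AE \<omega> in \<Omega>. \<forall>\<^sub>F n in sequentially.
          (\<forall>i\<in>I. \<omega> (dyadic_above n i) \<in> A i) \<longleftrightarrow> (\<forall>i\<in>I. path \<omega> i \<in> A i)"
        using AE_regular_path by eventually_elim (rule evI)
    qed (rule mI)+
    have lim: "(\<lambda>n. dyadic_above n u) \<longlonglongrightarrow> u" if "u \<ge> 0" for u
    proof (rule tendsto_sandwich)
      show "\<forall>\<^sub>F n in sequentially. u \<le> dyadic_above n u" "\<forall>\<^sub>F n in sequentially. dyadic_above n u \<le> u + 1 / 2 ^ n"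
        using dyadic_above[OF that] by (auto intro!: always_eventually less_imp_le)
      show "(\<lambda>n. u + 1 / 2 ^ n) \<longlonglongrightarrow> u" by real_asymp
    qed simp
    have "?h = (\<lambda>n. dyadic_above n (t + h) - dyadic_above n t)"
      using k_mono[of t "t + h"] h by (simp add: d of_nat_diff diff_divide_distrib fun_eq_iff)
    then show "?h \<longlonglongrightarrow> h"
      using tendsto_diff[OF lim[of "t + h"] lim[of t]] t h by simp
  qed simp
  ultimately show ?thesis using LIMSEQ_unique by simp
qed

text \<open>The right limit at \<open>0\<close> has law \<open>\<nu> 0\<close>, by continuity in time.\<close>

lemma AE_path_0: "AE \<omega> in \<Omega>. path \<omega> 0 = 0"
proof -
  interpret prob_space \<Omega> by (rule prob_space_\<Omega>)
  have path_0[measurable]: "(\<lambda>\<omega>. path \<omega> 0) \<in> borel_measurable \<Omega>"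
    by (rule measurable_path[OF order_refl])
  have "measure \<Omega> {\<omega>\<in>space \<Omega>. path \<omega> 0 \<in> cball 0 r} = 1" if r: "r > 0" for r
  proof -
    have B: "cball 0 r \<in> balls" using r by (rule cball_in_balls)
    have [measurable]: "cball 0 r \<in> sets (borel :: 'a measure)" by simp
    have "(\<lambda>n. measure \<Omega> {\<omega>\<in>space \<Omega>. \<omega> (dyadic_above n 0) \<in> cball 0 r}) \<longlonglongrightarrow> measure \<Omega> {\<omega>\<in>space \<Omega>. path \<omega> 0 \<in> cball 0 r}"
    proof (rule prob_tendsto)
      show "AE \<omega> in \<Omega>. \<forall>\<^sub>F n in sequentially. \<omega> (dyadic_above n 0) \<in> cball 0 r \<longleftrightarrow> path \<omega> 0 \<in> cball 0 r"
        using AE_regular_path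
      proof eventually_elim
        case (elim \<omega>)
        then show ?case using balls_clopen[OF B] by (intro eventually_clopen_iff path_LIMSEQ) auto
      qed
    qed (unfold dyadic_above_def, measurable)
    moreover have "measure \<Omega> {\<omega>\<in>space \<Omega>. \<omega> (dyadic_above n 0) \<in> cball 0 r} = measure (\<nu> (1 / 2 ^ n)) (cball 0 r)" for n
    proof -
      have "measure \<Omega> {\<omega>\<in>space \<Omega>. \<omega> (real 1 / 2 ^ n) \<in> cball 0 r} = measure (distr \<Omega> borel (\<lambda>\<omega>. \<omega> (real 1 / 2 ^ n))) (cball 0 r)"
        using measurable_\<Omega>_coordinate[of 1 n]
        by (subst measure_distr) (auto simp: vimage_def Int_def conj_commute)
      then show ?thesis using distr_\<Omega>_point[of 1 n] by (simp add: dyadic_above_def)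
    qed
    moreover have "(\<lambda>n. measure (\<nu> (1 / 2 ^ n)) (cball 0 r)) \<longlonglongrightarrow> measure (\<nu> 0) (cball 0 r)"
      by (rule \<nu>_balls_tendsto[OF B]) (simp, simp, real_asymp)
    ultimately have "measure \<Omega> {\<omega>\<in>space \<Omega>. path \<omega> 0 \<in> cball 0 r} = measure (\<nu> 0) (cball 0 r)"
      using LIMSEQ_unique by simp
    then show ?thesis using r by (simp add: \<nu>_0 measure_return)
  qed
  then have "prob {\<omega>\<in>space \<Omega>. path \<omega> 0 \<in> cball 0 (1 / Suc n)} = 1" for n by simp
  moreover have "{\<omega>\<in>space \<Omega>. path \<omega> 0 \<in> cball 0 (1 / Suc n)} \<in> events" for n
    by (intro predE pred_sets2[where N = borel]) auto
  ultimately have "AE \<omega> in \<Omega>. path \<omega> 0 \<in> cball 0 (1 / Suc n)" for n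
    by (simp only: prob_Collect_eq_1)
  then have "AE \<omega> in \<Omega>. \<forall>n. path \<omega> 0 \<in> cball 0 (1 / Suc n)" by (simp add: AE_all_countable)
  then show ?thesis
  proof eventually_elim
    case (elim \<omega>)
    have "dist 0 (path \<omega> 0) \<le> 0"
    proof (rule ccontr)
      assume "\<not> ?thesis"
      then obtain n where "1 / Suc n < dist 0 (path \<omega> 0)" using nat_approx_posE[of "dist 0 (path \<omega> 0)"] by auto
      moreover have "dist 0 (path \<omega> 0) \<le> 1 / Suc n" using elim[rule_format, of n] by simp
      ultimately show False by simp
    qed
    then show ?case by simp
  qed
qed

section \<open>The Markov process on path space\<close>

definition cadlag_paths :: "(real \<Rightarrow> 'a) set" where
  "cadlag_paths = {f. bounded_trajectory f \<and> right_continuous_trajectory f \<and> only_jumps_trajectory f}"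

text \<open>The sample space consists of the paths themselves, so it is closed under time shifts.  Only nonnegative times
generate the \<open>\<sigma>\<close>-algebra.\<close>

definition path_algebra :: "(real \<Rightarrow> 'a) measure" where
  "path_algebra = vimage_algebra cadlag_paths (\<lambda>f. restrict f {0..}) (PiM {0..} (\<lambda>_. borel))"

definition path_filtration :: "real \<Rightarrow> (real \<Rightarrow> 'a) measure" where
  "path_filtration t = vimage_algebra cadlag_paths (\<lambda>f. restrict f {0..t}) (PiM {0..t} (\<lambda>_. borel))"

definition path_law :: "'a \<Rightarrow> (real \<Rightarrow> 'a) measure" where
  "path_law x = distr \<Omega> path_algebra (\<lambda>\<omega> s. x + path \<omega> s)"

lemma path_cadlag: "path \<omega> \<in> cadlag_paths"
proof (cases "regular_path \<omega>")
  case True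
  then have "path \<omega> = cadlag_version \<omega>" by (simp add: path_def fun_eq_iff)
  then show ?thesis
    using True
    by (simp add: cadlag_paths_def bounded_cadlag_version right_continuous_cadlag_version only_jumps_cadlag_version)
next
  case False
  then have "path \<omega> = (\<lambda>_. 0)" by (simp add: path_def fun_eq_iff)
  moreover have "compact (closure ((\<lambda>_. 0 :: 'a) ` {0..T}))" if "T \<ge> 0" for T :: real
  proof -
    have "(\<lambda>_. 0 :: 'a) ` {0..T} = {0}" using that by auto
    then show ?thesis by simp
  qed
  ultimately show ?thesis
    by (auto simp: cadlag_paths_def bounded_trajectory_def right_continuous_trajectory_def only_jumps_trajectory_def)
qed

lemma translate_cadlag:
  assumes "f \<in> cadlag_paths" shows "(\<lambda>s. x + f s) \<in> cadlag_paths"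
proof -
  have f: "bounded_trajectory f" "right_continuous_trajectory f" "only_jumps_trajectory f"
    using assms by (auto simp: cadlag_paths_def)
  have "bounded_trajectory (\<lambda>s. x + f s)"
    unfolding bounded_trajectory_def
  proof (intro allI impI)
    fix T :: real assume "T \<ge> 0"
    let ?K = "(\<lambda>y. x + y) ` closure (f ` {0..T})"
    have K: "compact ?K"
      using f(1) \<open>T \<ge> 0\<close> unfolding bounded_trajectory_def
      by (intro compact_continuous_image continuous_intros) auto
    have "closure ((\<lambda>s. x + f s) ` {0..T}) \<subseteq> ?K"
      using closure_subset by (intro closure_minimal compact_imp_closed[OF K]) blast
    then show "compact (closure ((\<lambda>s. x + f s) ` {0..T}))"
      using compact_Int_closed[OF K closed_closure, of "(\<lambda>s. x + f s) ` {0..T}"] by (simp add: Int_absorb1)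
  qed
  moreover have "right_continuous_trajectory (\<lambda>s. x + f s)"
    using f(2) by (auto simp: right_continuous_trajectory_def intro: continuous_intros)
  moreover have "only_jumps_trajectory (\<lambda>s. x + f s)"
    unfolding only_jumps_trajectory_def
  proof (intro allI impI)
    fix t :: real assume "t > 0"
    then obtain l where "(f \<longlongrightarrow> l) (at_left t)"
      using f(3) by (auto simp: only_jumps_trajectory_def)
    then have "((\<lambda>s. x + f s) \<longlongrightarrow> x + l) (at_left t)" by (intro tendsto_intros)
    then show "\<exists>l. ((\<lambda>s. x + f s) \<longlongrightarrow> l) (at_left t)" ..
  qed
  ultimately show ?thesis by (simp add: cadlag_paths_def)
qed

lemma shift_cadlag:
  assumes f: "f \<in> cadlag_paths" and t: "t \<ge> 0" shows "(\<lambda>s. f (t + s)) \<in> cadlag_paths"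
proof -
  have f: "bounded_trajectory f" "right_continuous_trajectory f" "only_jumps_trajectory f"
    using f by (auto simp: cadlag_paths_def)
  have "bounded_trajectory (\<lambda>s. f (t + s))"
    unfolding bounded_trajectory_def
  proof (intro allI impI)
    fix T :: real assume "T \<ge> 0"
    have K: "compact (closure (f ` {0..t + T}))"
      using f(1) t \<open>T \<ge> 0\<close> unfolding bounded_trajectory_def by simp
    have "closure ((\<lambda>s. f (t + s)) ` {0..T}) \<subseteq> closure (f ` {0..t + T})"
      using t by (intro closure_mono) auto
    then show "compact (closure ((\<lambda>s. f (t + s)) ` {0..T}))"
      using compact_Int_closed[OF K closed_closure, of "(\<lambda>s. f (t + s)) ` {0..T}"] by (simp add: Int_absorb1)
  qed
  moreover have "right_continuous_trajectory (\<lambda>s. f (t + s))"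
    unfolding right_continuous_trajectory_def continuous_within
  proof (intro allI impI)
    fix u :: real assume "u \<ge> 0"
    then have "(f \<longlongrightarrow> f (t + u)) (at_right (t + u))"
      using f(2) t by (simp add: right_continuous_trajectory_def continuous_within)
    moreover have "filterlim (\<lambda>s. t + s) (at_right (t + u)) (at_right u)"
      by (auto simp: filterlim_at eventually_at_filter intro!: tendsto_intros)
    ultimately show "((\<lambda>s. f (t + s)) \<longlongrightarrow> f (t + u)) (at_right u)"
      by (rule filterlim_compose)
  qed
  moreover have "only_jumps_trajectory (\<lambda>s. f (t + s))"
    unfolding only_jumps_trajectory_def
  proof (intro allI impI)
    fix u :: real assume "u > 0"
    then obtain l where "(f \<longlongrightarrow> l) (at_left (t + u))"
      using f(3) t unfolding only_jumps_trajectory_def by (meson add_nonneg_pos)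
    moreover have "filterlim (\<lambda>s. t + s) (at_left (t + u)) (at_left u)"
      by (auto simp: filterlim_at eventually_at_filter intro!: tendsto_intros)
    ultimately have "((\<lambda>s. f (t + s)) \<longlongrightarrow> l) (at_left u)"
      by (rule filterlim_compose)
    then show "\<exists>l. ((\<lambda>s. f (t + s)) \<longlongrightarrow> l) (at_left u)" ..
  qed
  ultimately show ?thesis by (simp add: cadlag_paths_def)
qed

lemma space_path_algebra [simp]: "space path_algebra = cadlag_paths"
  and space_path_filtration [simp]: "space (path_filtration t) = cadlag_paths"
  by (simp_all add: path_algebra_def path_filtration_def)

lemma restrict_in_space_PiM: "restrict f T \<in> space (PiM T (\<lambda>_. borel :: 'a measure))"
  by (simp only: space_PiM space_borel restrict_PiE_iff) blast

lemma measurable_path_algebra_coordinate: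
  assumes "0 \<le> s" shows "(\<lambda>f. f s) \<in> borel_measurable path_algebra"
proof -
  have "(\<lambda>f. restrict f {0..} s) \<in> borel_measurable path_algebra"
    unfolding path_algebra_def using assms
    by (intro measurable_compose[OF measurable_vimage_algebra1 measurable_component_singleton]) (auto simp only: restrict_in_space_PiM Pi_iff atLeast_iff atLeastAtMost_iff)
  then show ?thesis using assms by simp
qed

lemma measurable_path_filtration_coordinate:
  assumes "0 \<le> s" "s \<le> t" shows "(\<lambda>f. f s) \<in> borel_measurable (path_filtration t)"
proof -
  have "(\<lambda>f. restrict f {0..t} s) \<in> borel_measurable (path_filtration t)"
    unfolding path_filtration_def using assms
    by (intro measurable_compose[OF measurable_vimage_algebra1 measurable_component_singleton]) (auto simp only: restrict_in_space_PiM Pi_iff atLeast_iff atLeastAtMost_iff)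
  then show ?thesis using assms by simp
qed

lemma sets_path_filtration_least:
  assumes "space N = cadlag_paths" "\<And>s. 0 \<le> s \<Longrightarrow> s \<le> t \<Longrightarrow> (\<lambda>f. f s) \<in> borel_measurable N"
  shows "sets (path_filtration t) \<subseteq> sets N"
  unfolding path_filtration_def
  by (intro sets_image_in_sets[OF assms(1)] measurable_restrict assms(2)) simp_all

lemma subalgebra_path_algebra: "subalgebra path_algebra (path_filtration t)"
  unfolding subalgebra_def
  by (intro conjI sets_path_filtration_least measurable_path_algebra_coordinate) simp_all

lemma subalgebra_path_filtration: "s \<le> t \<Longrightarrow> subalgebra (path_filtration t) (path_filtration s)"
  unfolding subalgebra_def
  by (intro conjI sets_path_filtration_least measurable_path_filtration_coordinate) simp_all

lemma measurable_translate_path: "(\<lambda>\<omega> s. x + path \<omega> s) \<in> \<Omega> \<rightarrow>\<^sub>M path_algebra"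
  unfolding path_algebra_def
  by (rule measurable_vimage_algebra2)
     (simp add: translate_cadlag path_cadlag,
      intro measurable_restrict borel_measurable_add measurable_path borel_measurable_const, simp)

lemma prob_space_path_law: "prob_space (path_law x)"
  unfolding path_law_def
  by (rule prob_space.prob_space_distr[OF prob_space_\<Omega> measurable_translate_path])

lemma sets_path_law [simp, measurable_cong]: "sets (path_law x) = sets path_algebra"
  and space_path_law [simp]: "space (path_law x) = cadlag_paths"
  by (simp_all add: path_law_def)

text \<open>Events that only involve open and closed sets: for these the independence of increments is known, they are stable
under intersection, and they generate the past.\<close>

definition cylinders :: "real \<Rightarrow> (real \<Rightarrow> 'a) set set" where
  "cylinders t = {{\<omega>\<in>space \<Omega>. \<forall>i\<in>I. path \<omega> i \<in> A i} | I A.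
     finite I \<and> I \<subseteq> {0..t} \<and> (\<forall>i. open (A i) \<and> closed (A i))}"

lemma Int_stable_cylinders: "Int_stable (cylinders t)"
proof (rule Int_stableI)
  fix C D assume "C \<in> cylinders t" "D \<in> cylinders t"
  then obtain I A J B where C: "C = {\<omega>\<in>space \<Omega>. \<forall>i\<in>I. path \<omega> i \<in> A i}" "finite I" "I \<subseteq> {0..t}" "\<And>i. open (A i) \<and> closed (A i)"
    and D: "D = {\<omega>\<in>space \<Omega>. \<forall>i\<in>J. path \<omega> i \<in> B i}" "finite J" "J \<subseteq> {0..t}" "\<And>i. open (B i) \<and> closed (B i)"
    unfolding cylinders_def by blast
  define E where "E i = (if i \<in> I then A i else UNIV) \<inter> (if i \<in> J then B i else UNIV)" for i
  have "C \<inter> D = {\<omega>\<in>space \<Omega>. \<forall>i\<in>I \<union> J. path \<omega> i \<in> E i}"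
    unfolding C(1) D(1) E_def by auto
  moreover have "open (E i) \<and> closed (E i)" for i
    using C(4) D(4) by (auto simp: E_def)
  ultimately show "C \<inter> D \<in> cylinders t"
    unfolding cylinders_def using C(2,3) D(2,3)
    by (intro CollectI exI[of _ "I \<union> J"] exI[of _ E] conjI) simp_all
qed

lemma sets_cylinders: "cylinders t \<subseteq> sets \<Omega>"
proof
  fix C assume "C \<in> cylinders t"
  then obtain I A where C: "C = {\<omega>\<in>space \<Omega>. \<forall>i\<in>I. path \<omega> i \<in> A i}" "finite I" "I \<subseteq> {0..t}" "\<And>i. open (A i) \<and> closed (A i)"
    unfolding cylinders_def by blast
  show "C \<in> sets \<Omega>"
    unfolding C(1) using C(2,3) C(4)
    by (intro predE pred_intros_finite pred_sets2[where N = borel] measurable_path) auto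
qed

lemma measurable_translate_path_cylinders:
  "(\<lambda>\<omega> s. x + path \<omega> s) \<in> sigma (space \<Omega>) (cylinders t) \<rightarrow>\<^sub>M path_filtration t"
  unfolding path_filtration_def
proof (rule measurable_vimage_algebra2)
  show "(\<lambda>\<omega> s. x + path \<omega> s) \<in> space (sigma (space \<Omega>) (cylinders t)) \<rightarrow> cadlag_paths"
    by (auto intro: translate_cadlag path_cadlag)
  have sub: "cylinders t \<subseteq> Pow (space \<Omega>)" by (auto simp: cylinders_def)
  have "(\<lambda>\<omega>. path \<omega> s) \<in> borel_measurable (sigma (space \<Omega>) (cylinders t))" if s: "s \<in> {0..t}" for s
  proof (rule measurable_sigma_sets[OF borel_eq_sigma_balls])
    fix B :: "'a set" assume "B \<in> balls"
    then have "open B \<and> closed B" by (rule balls_clopen)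
    then have "(\<lambda>\<omega>. path \<omega> s) -` B \<inter> space \<Omega> \<in> cylinders t"
      unfolding cylinders_def
      by (intro CollectI exI[of _ "{s}"] exI[of _ "\<lambda>_. B"]) (use s in auto)
    then show "(\<lambda>\<omega>. path \<omega> s) -` B \<inter> space (sigma (space \<Omega>) (cylinders t)) \<in> sets (sigma (space \<Omega>) (cylinders t))"
      unfolding space_measure_of[OF sub] sets_measure_of[OF sub] by (rule sigma_sets.Basic)
  qed auto
  then show "(\<lambda>\<omega>. restrict (\<lambda>s. x + path \<omega> s) {0..t}) \<in> sigma (space \<Omega>) (cylinders t) \<rightarrow>\<^sub>M PiM {0..t} (\<lambda>_. borel)"
    by (intro measurable_restrict borel_measurable_add) auto
qed

lemma distr_path_increment:
  assumes t: "t \<ge> 0" and h: "h \<ge> 0"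
  shows "distr \<Omega> borel (\<lambda>\<omega>. path \<omega> (t + h) - path \<omega> t) = \<nu> h"
proof -
  interpret O: prob_space \<Omega> by (rule prob_space_\<Omega>)
  interpret N: prob_space "\<nu> h" using h by (rule prob_space_\<nu>)
  let ?D = "distr \<Omega> borel (\<lambda>\<omega>. path \<omega> (t + h) - path \<omega> t)"
  have m: "(\<lambda>\<omega>. path \<omega> (t + h) - path \<omega> t) \<in> borel_measurable \<Omega>"
    using t h by (intro borel_measurable_group_diff measurable_path) auto
  interpret D: prob_space ?D by (rule O.prob_space_distr[OF m])
  show ?thesis
  proof (rule measure_eqI_generator_eq[OF Int_stable_balls, where \<Omega> = UNIV and A = "\<lambda>n. cball 0 (real (Suc n))"])
    fix B :: "'a set" assume B: "B \<in> balls"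
    then have "B \<in> sets borel" using balls_clopen by auto
    then have "measure ?D B = measure (\<nu> h) B"
      using measure_path_cylinder_increment[of "{}" t h "\<lambda>_. UNIV" B] B t h
      by (simp add: measure_distr[OF m] vimage_def Int_def conj_commute O.prob_space)
    then show "emeasure ?D B = emeasure (\<nu> h) B"
      by (simp add: D.emeasure_eq_measure N.emeasure_eq_measure)
  next
    show "emeasure ?D (cball 0 (real (Suc i))) \<noteq> \<infinity>" for i by simp
    show "range (\<lambda>n. cball 0 (real (Suc n))) \<subseteq> balls" by (auto intro: cball_in_balls)
    show "(\<Union>n. cball (0::'a) (real (Suc n))) = UNIV"
    proof (intro equalityI subsetI UNIV_I)
      fix x :: 'a
      obtain n where "dist 0 x \<le> real n" using real_arch_simple by blast
      then show "x \<in> (\<Union>n. cball 0 (real (Suc n)))" by (intro UN_I[of n]) auto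
    qed
  qed (simp_all add: borel_eq_sigma_balls sets_\<nu> h)
qed

text \<open>Independence extends from the cylinders and the balls to the \<open>\<sigma>\<close>-algebras that they generate.  It is transported to
path space, where it says that the increment after time \<open>t\<close> has law \<open>\<nu> h\<close> and is independent of the past.\<close>

lemma path_increment_independent:
  assumes t: "t \<ge> 0" and h: "h \<ge> 0" and E: "E \<in> sets (path_filtration t)" and B: "B \<in> sets borel"
  shows "emeasure (path_law x) {f\<in>cadlag_paths. f \<in> E \<and> f (t + h) - f t \<in> B} =
    emeasure (path_law x) E * emeasure (\<nu> h) B"
proof -
  let ?E = "{f\<in>cadlag_paths. f \<in> E \<and> f (t + h) - f t \<in> B}"
  interpret prob_space \<Omega> by (rule prob_space_\<Omega>)
  let ?\<Delta> = "\<lambda>\<omega>. path \<omega> (t + h) - path \<omega> t"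
  let ?X = "\<lambda>\<omega> s. x + path \<omega> s"
  have m[measurable]: "?\<Delta> \<in> borel_measurable \<Omega>"
    using t h by (intro borel_measurable_group_diff measurable_path) auto
  let ?G = "{?\<Delta> -` B \<inter> space \<Omega> | B. B \<in> balls}"
  have law: "prob (?\<Delta> -` B \<inter> space \<Omega>) = measure (\<nu> h) B" if "B \<in> sets borel" for B
    using measure_distr[OF m that] distr_path_increment[OF t h] by simp
  have "indep_set (cylinders t) ?G"
    unfolding indep_sets2_eq
  proof (intro conjI ballI)
    show "cylinders t \<subseteq> events" by (rule sets_cylinders)
    show "?G \<subseteq> events" using balls_clopen by (auto intro!: measurable_sets[OF m])
    fix C D assume "C \<in> cylinders t" "D \<in> ?G"
    then obtain I A B where C: "C = {\<omega>\<in>space \<Omega>. \<forall>i\<in>I. path \<omega> i \<in> A i}" "finite I" "I \<subseteq> {0..t}" "\<And>i. open (A i) \<and> closed (A i)"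
      and D: "D = ?\<Delta> -` B \<inter> space \<Omega>" "B \<in> balls"
      unfolding cylinders_def by blast
    have "C \<inter> D = {\<omega>\<in>space \<Omega>. (\<forall>i\<in>I. path \<omega> i \<in> A i) \<and> ?\<Delta> \<omega> \<in> B}"
      unfolding C D by auto
    then have "prob (C \<inter> D) = prob C * measure (\<nu> h) B"
      unfolding C(1)
      by (simp only:) (rule measure_path_cylinder_increment, use C D t h in auto)
    then show "prob (C \<inter> D) = prob C * prob D"
      using law[of B] D balls_clopen[of B] by simp
  qed
  then have ind: "indep_set (sigma_sets (space \<Omega>) (cylinders t)) (sigma_sets (space \<Omega>) ?G)"
  proof (rule indep_set_sigma_sets[OF _ Int_stable_cylinders])
    show "Int_stable ?G"
    proof (rule Int_stableI)
      fix C D assume "C \<in> ?G" "D \<in> ?G"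
      then obtain A B where CD: "C = ?\<Delta> -` A \<inter> space \<Omega>" "D = ?\<Delta> -` B \<inter> space \<Omega>" and AB: "A \<in> balls" "B \<in> balls"
        by blast
      have "A \<inter> B \<in> balls" using Int_stable_balls AB by (auto simp: Int_stable_def)
      then show "C \<inter> D \<in> ?G"
        unfolding CD by (intro CollectI exI[of _ "A \<inter> B"]) auto
    qed
  qed
  have "?X -` E \<inter> space \<Omega> \<in> sigma_sets (space \<Omega>) (cylinders t)"
  proof -
    have sub: "cylinders t \<subseteq> Pow (space \<Omega>)"
      using sets_cylinders[of t] sets.space_closed[of \<Omega>] by (rule order_trans)
    show ?thesis
      using measurable_sets[OF measurable_translate_path_cylinders E, of x]
      unfolding space_measure_of[OF sub] sets_measure_of[OF sub] .
  qed
  moreover have "?\<Delta> -` B \<inter> space \<Omega> \<in> sigma_sets (space \<Omega>) ?G"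
  proof -
    have sub: "?G \<subseteq> Pow (space \<Omega>)" by blast
    have "?\<Delta> \<in> borel_measurable (sigma (space \<Omega>) ?G)"
    proof (rule measurable_sigma_sets[OF borel_eq_sigma_balls])
      fix C :: "'a set" assume "C \<in> balls"
      then have "?\<Delta> -` C \<inter> space \<Omega> \<in> ?G" by blast
      then show "?\<Delta> -` C \<inter> space (sigma (space \<Omega>) ?G) \<in> sets (sigma (space \<Omega>) ?G)"
        unfolding space_measure_of[OF sub] sets_measure_of[OF sub] by (rule sigma_sets.Basic)
    qed auto
    from measurable_sets[OF this B] show ?thesis
      unfolding space_measure_of[OF sub] sets_measure_of[OF sub] .
  qed
  ultimately have "prob ((?X -` E \<inter> space \<Omega>) \<inter> (?\<Delta> -` B \<inter> space \<Omega>)) = prob (?X -` E \<inter> space \<Omega>) * measure (\<nu> h) B"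
    using indep_setD[OF ind] law[OF B] by simp
  moreover have "emeasure (path_law x) ?E = prob ((?X -` E \<inter> space \<Omega>) \<inter> (?\<Delta> -` B \<inter> space \<Omega>))"
  proof -
    have E': "E \<in> sets path_algebra" using E subalgebra_path_algebra[of t] by (auto simp: subalgebra_def)
    have [measurable]: "(\<lambda>f. f (t + h) - f t) \<in> borel_measurable path_algebra"
      using t h by (intro borel_measurable_group_diff measurable_path_algebra_coordinate) auto
    note [measurable] = E' B
    have "{f\<in>space path_algebra. f \<in> E \<and> f (t + h) - f t \<in> B} \<in> sets path_algebra" by measurable
    then have "emeasure (path_law x) ?E =
        emeasure \<Omega> (?X -` ?E \<inter> space \<Omega>)"
      unfolding path_law_def by (subst emeasure_distr[OF measurable_translate_path]) simp_all
    also have "?X -` ?E \<inter> space \<Omega> = (?X -` E \<inter> space \<Omega>) \<inter> (?\<Delta> -` B \<inter> space \<Omega>)"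
      using translate_cadlag[OF path_cadlag] by (auto simp: algebra_simps)
    finally show ?thesis by (simp add: emeasure_eq_measure)
  qed
  moreover have "emeasure (path_law x) E = prob (?X -` E \<inter> space \<Omega>)"
    using E subalgebra_path_algebra[of t] unfolding path_law_def
    by (subst emeasure_distr[OF measurable_translate_path]) (auto simp: subalgebra_def emeasure_eq_measure)
  moreover have "emeasure (\<nu> h) B = measure (\<nu> h) B"
  proof -
    interpret N: prob_space "\<nu> h" using h by (rule prob_space_\<nu>)
    show ?thesis by (rule N.emeasure_eq_measure)
  qed
  ultimately show ?thesis by (simp add: ennreal_mult)
qed

definition kernel :: "real \<Rightarrow> 'a \<Rightarrow> 'a measure" where
  "kernel t x = distr (\<nu> t) borel (\<lambda>y. x + y)"

lemma space_\<nu>: "t \<ge> 0 \<Longrightarrow> space (\<nu> t) = UNIV"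
  using sets_eq_imp_space_eq[OF sets_\<nu>] by simp

lemma \<nu>_in_subprob: "t \<ge> 0 \<Longrightarrow> \<nu> t \<in> space (subprob_algebra borel)"
  by (simp add: space_subprob_algebra sets_\<nu> prob_space_\<nu> prob_space_imp_subprob_space)

lemma emeasure_kernel:
  assumes "t \<ge> 0" "B \<in> sets borel" shows "emeasure (kernel t x) B = emeasure (\<nu> t) {y. x + y \<in> B}"
  unfolding kernel_def using assms
  by (subst emeasure_distr) (auto simp: measurable_\<nu>_cong space_\<nu> vimage_def intro!: borel_measurable_add)

lemma measurable_kernel:
  assumes t: "t \<ge> 0" shows "kernel t \<in> borel \<rightarrow>\<^sub>M prob_algebra borel"
proof (rule measurable_prob_algebraI)
  show "prob_space (kernel t x)" for x
    unfolding kernel_def using t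
    by (intro prob_space.prob_space_distr prob_space_\<nu>) (auto simp: measurable_\<nu>_cong intro!: borel_measurable_add)
  have "(\<lambda>x. distr (\<nu> t) borel ((+) x)) \<in> borel \<rightarrow>\<^sub>M subprob_algebra borel"
    by (rule measurable_distr2[where M = borel]) (use \<nu>_in_subprob[OF t] in measurable)
  then show "kernel t \<in> borel \<rightarrow>\<^sub>M subprob_algebra borel"
    unfolding kernel_def .
qed

lemma transition_function_kernel: "transition_function kernel"
  unfolding transition_function_def
proof (intro conjI allI impI)
  show "kernel t \<in> borel \<rightarrow>\<^sub>M prob_algebra borel" if "t \<ge> 0" for t
    using that by (rule measurable_kernel)
  show "kernel 0 x = return borel x" for x
    unfolding kernel_def \<nu>_0 by (subst distr_return) (auto intro!: borel_measurable_add)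
  fix s t :: real and x
  assume s: "s \<ge> 0" and t: "t \<ge> 0"
  interpret N: prob_space "\<nu> t" by (rule prob_space_\<nu>[OF t])
  note [measurable_cong] = sets_\<nu>[OF s] sets_\<nu>[OF t]
  have kt: "kernel t \<in> borel \<rightarrow>\<^sub>M subprob_algebra borel"
    using measurable_kernel[OF t] by (rule measurable_prob_algebraD)
  have sK: "sets (kernel s x) = sets borel" "space (kernel s x) = UNIV" by (simp_all add: kernel_def)
  have kt': "kernel t \<in> kernel s x \<rightarrow>\<^sub>M subprob_algebra borel"
    using kt by (simp cong: measurable_cong_sets add: sK)
  show "kernel (s + t) x = kernel s x \<bind> kernel t"
  proof (rule measure_eqI)
    show "sets (kernel (s + t) x) = sets (kernel s x \<bind> kernel t)"
      by (subst sets_bind[where N = borel]) (auto simp: kernel_def)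
    fix A assume "A \<in> sets (kernel (s + t) x)"
    then have A[measurable]: "A \<in> sets borel" by (simp add: kernel_def)
    have "emeasure (kernel (s + t) x) A = emeasure (\<nu> s \<Otimes>\<^sub>M \<nu> t) {p \<in> space (\<nu> s \<Otimes>\<^sub>M \<nu> t). x + (fst p + snd p) \<in> A}"
    proof -
      have 1: "{y. x + y \<in> A} \<in> sets borel"
        using measurable_sets[of "\<lambda>y. x + y" borel borel A] by (simp add: vimage_def)
      have "emeasure (kernel (s + t) x) A = emeasure (\<nu> (s + t)) {y. x + y \<in> A}"
        using s t A by (intro emeasure_kernel) auto
      also have "\<dots> = emeasure (\<nu> s \<Otimes>\<^sub>M \<nu> t) {p \<in> space (\<nu> s \<Otimes>\<^sub>M \<nu> t). x + (fst p + snd p) \<in> A}"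
        unfolding \<nu>_add[OF s t] using 1
        by (subst emeasure_distr) (auto simp: split_beta' intro!: arg_cong[where f = "emeasure _"])
      finally show ?thesis .
    qed
    also have "\<dots> = (\<integral>\<^sup>+y. emeasure (\<nu> t) (Pair y -` {p \<in> space (\<nu> s \<Otimes>\<^sub>M \<nu> t). x + (fst p + snd p) \<in> A}) \<partial>\<nu> s)"
      by (rule N.emeasure_pair_measure_alt) measurable
    also have "\<dots> = (\<integral>\<^sup>+y. emeasure (kernel t (x + y)) A \<partial>\<nu> s)"
      by (intro nn_integral_cong)
         (simp add: emeasure_kernel[OF t A] space_pair_measure space_\<nu> s t vimage_def add.assoc)
    also have "\<dots> = (\<integral>\<^sup>+y. emeasure (kernel t y) A \<partial>kernel s x)"
      unfolding kernel_def[of s x]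
      by (subst nn_integral_distr) (auto simp: measurable_\<nu>_cong s intro!: measurable_emeasure_kernel[OF kt A] borel_measurable_add)
    also have "\<dots> = emeasure (kernel s x \<bind> kernel t) A"
      by (rule emeasure_bind[symmetric, OF _ kt' A]) (simp add: sK)
    finally show "emeasure (kernel (s + t) x) A = emeasure (kernel s x \<bind> kernel t) A" .
  qed
qed

text \<open>The pair of the past and the increment has a product law, and the future position is a function of that pair;
Fubini integrates out the increment.\<close>

lemma path_law_future:
  assumes t: "t \<ge> 0" and h: "h \<ge> 0" and A: "A \<in> sets (path_filtration t)" and B: "B \<in> sets borel"
  shows "emeasure (path_law x) {f\<in>cadlag_paths. f \<in> A \<and> f (t + h) \<in> B} =
    (\<integral>\<^sup>+f. indicator A f * emeasure (kernel h (f t)) B \<partial>path_law x)"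
proof -
  let ?C = "{f\<in>cadlag_paths. f \<in> A \<and> f (t + h) \<in> B}"
  interpret L: prob_space "path_law x" by (rule prob_space_path_law)
  interpret N: prob_space "\<nu> h" by (rule prob_space_\<nu>[OF h])
  let ?F = "path_filtration t"
  let ?\<Delta> = "\<lambda>f. f (t + h) - f t :: 'a"
  define R where "R = distr (path_law x) ?F (\<lambda>f. f)"
  have id[measurable]: "(\<lambda>f. f) \<in> path_law x \<rightarrow>\<^sub>M ?F"
    using subalgebra_path_algebra[of t] by (auto simp: subalgebra_def measurable_def)
  interpret R: prob_space R unfolding R_def by (rule L.prob_space_distr[OF id])
  have sR[measurable_cong]: "sets R = sets ?F" by (simp add: R_def)
  note [measurable_cong] = sets_\<nu>[OF h]
  note [measurable] = A B
  have [measurable]: "(\<lambda>f. f t) \<in> borel_measurable ?F"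
    using t by (intro measurable_path_filtration_coordinate) auto
  have \<Delta>[measurable]: "?\<Delta> \<in> borel_measurable (path_law x)"
    using t h by (intro borel_measurable_group_diff) (auto cong: measurable_cong_sets intro!: measurable_path_algebra_coordinate)
  \<comment> \<open>\<open>R\<close> is the law of the past, and \<open>Q\<close> the joint law of the past and the increment\<close>
  define Q where "Q = distr (path_law x) (?F \<Otimes>\<^sub>M borel) (\<lambda>f. (f, ?\<Delta> f))"
  have RQ: "R \<Otimes>\<^sub>M \<nu> h = Q"
  proof (rule pair_measure_eqI)
    show "sets (R \<Otimes>\<^sub>M \<nu> h) = sets Q"
      unfolding Q_def by (simp, intro sets_pair_measure_cong sR sets_\<nu> h)
    fix C D assume "C \<in> sets R" "D \<in> sets (\<nu> h)"
    then have CD[measurable]: "C \<in> sets ?F" "D \<in> sets borel" by (simp_all add: sR sets_\<nu> h)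
    have "C \<subseteq> cadlag_paths" using sets.sets_into_space[OF CD(1)] by simp
    then have "(\<lambda>f. (f, ?\<Delta> f)) -` (C \<times> D) \<inter> space (path_law x) = {f\<in>cadlag_paths. f \<in> C \<and> ?\<Delta> f \<in> D}"
      by auto
    then have "emeasure Q (C \<times> D) = emeasure (path_law x) {f\<in>cadlag_paths. f \<in> C \<and> ?\<Delta> f \<in> D}"
      unfolding Q_def by (subst emeasure_distr) auto
    moreover have "emeasure R C = emeasure (path_law x) C"
    proof -
      have "(\<lambda>f. f) -` C \<inter> space (path_law x) = C" using \<open>C \<subseteq> cadlag_paths\<close> by auto
      then show ?thesis unfolding R_def by (simp add: emeasure_distr[OF id CD(1)])
    qed
    ultimately show "emeasure R C * emeasure (\<nu> h) D = emeasure Q (C \<times> D)"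
      using path_increment_independent[OF t h CD] by simp
  qed unfold_locales
  let ?D = "{p \<in> space (?F \<Otimes>\<^sub>M borel). fst p \<in> A \<and> fst p t + snd p \<in> B}"
  have D[measurable]: "?D \<in> sets (?F \<Otimes>\<^sub>M borel)" by measurable
  have "(\<lambda>f. (f, ?\<Delta> f)) -` ?D \<inter> space (path_law x) = ?C"
    by (auto simp: space_pair_measure)
  then have "emeasure (path_law x) ?C = emeasure Q ?D"
    unfolding Q_def by (subst emeasure_distr) auto
  also have "\<dots> = (\<integral>\<^sup>+f. emeasure (\<nu> h) (Pair f -` ?D) \<partial>R)"
    unfolding RQ[symmetric]
    by (rule N.emeasure_pair_measure_alt) (use D in \<open>simp cong: sets_pair_measure_cong add: sR sets_\<nu> h\<close>)
  also have "\<dots> = (\<integral>\<^sup>+f. indicator A f * emeasure (kernel h (f t)) B \<partial>R)"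
  proof (rule nn_integral_cong)
    fix f assume "f \<in> space R"
    then have "f \<in> cadlag_paths" by (simp add: R_def)
    then have "Pair f -` ?D = (if f \<in> A then {y. f t + y \<in> B} else {})"
      by (auto simp: space_pair_measure)
    then show "emeasure (\<nu> h) (Pair f -` ?D) = indicator A f * emeasure (kernel h (f t)) B"
      by (simp add: emeasure_kernel[OF h B])
  qed
  also have "\<dots> = (\<integral>\<^sup>+f. indicator A f * emeasure (kernel h (f t)) B \<partial>path_law x)"
    unfolding R_def
  proof (rule nn_integral_distr[OF id])
    have "(\<lambda>y. emeasure (kernel h y) B) \<in> borel_measurable borel"
      by (rule measurable_emeasure_kernel[OF measurable_prob_algebraD[OF measurable_kernel[OF h]] B])
    then have "(\<lambda>f. indicator A f * emeasure (kernel h (f t)) B) \<in> borel_measurable ?F"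
      by measurable
    then show "(\<lambda>f. indicator A f * emeasure (kernel h (f t)) B) \<in> borel_measurable (distr (path_law x) ?F (\<lambda>f. f))"
      by simp
  qed
  finally show ?thesis .
qed

lemma path_law_markov:
  assumes t: "t \<ge> 0" and h: "h \<ge> 0" and B: "B \<in> sets borel"
  shows "AE f in path_law x. real_cond_exp (path_law x) (path_filtration t)
      (indicator {f\<in>cadlag_paths. f (t + h) \<in> B}) f = measure (kernel h (f t)) B"
proof -
  let ?C = "{f\<in>cadlag_paths. f (t + h) \<in> B}"
  interpret L: prob_space "path_law x" by (rule prob_space_path_law)
  have sub: "subalgebra (path_law x) (path_filtration t)"
    using subalgebra_path_algebra[of t] by (simp add: subalgebra_def)
  interpret finite_measure_subalgebra "path_law x" "path_filtration t"
    by unfold_locales (rule sub)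
  have K: "prob_space (kernel h y)" for y
    using measurable_space[OF measurable_kernel[OF h], of y] by (simp add: space_prob_algebra)
  have m: "(\<lambda>y. measure (kernel h y) B) \<in> borel_measurable borel"
    using measurable_emeasure_kernel[OF measurable_prob_algebraD[OF measurable_kernel[OF h]] B]
    unfolding measure_def by measurable
  have mF[measurable]: "(\<lambda>f. measure (kernel h (f t)) B) \<in> borel_measurable (path_filtration t)"
    using t by (intro measurable_compose[OF _ m] measurable_path_filtration_coordinate) auto
  have mS[measurable]: "(\<lambda>f. measure (kernel h (f t)) B) \<in> borel_measurable (path_law x)"
    using mF sub by (rule measurable_from_subalg[rotated])
  have C[measurable]: "?C \<in> sets (path_law x)"
  proof -
    have [measurable]: "(\<lambda>f. f (t + h)) \<in> borel_measurable path_algebra"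
      using t h by (intro measurable_path_algebra_coordinate) simp
    have "{f\<in>space path_algebra. f (t + h) \<in> B} \<in> sets path_algebra" using B by measurable
    then show ?thesis by simp
  qed
  show ?thesis
  proof (rule real_cond_exp_charact)
    fix A assume A: "A \<in> sets (path_filtration t)"
    then have AL[measurable]: "A \<in> sets (path_law x)" using sub by (auto simp: subalgebra_def)
    have Asub: "A \<subseteq> cadlag_paths" using sets.sets_into_space[OF A] by simp
    have "(\<integral>f\<in>A. indicator ?C f \<partial>path_law x) =
        (\<integral>f. indicator (A \<inter> ?C) f \<partial>path_law x)"
      unfolding set_lebesgue_integral_def by (intro Bochner_Integration.integral_cong) (auto simp: indicator_def)
    also have "\<dots> = measure (path_law x) {f\<in>cadlag_paths. f \<in> A \<and> f (t + h) \<in> B}"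
      using Asub by (simp add: Int_def conj_left_commute) (intro arg_cong[where f = "measure _"], auto)
    also have "\<dots> = enn2real (\<integral>\<^sup>+f. indicator A f * emeasure (kernel h (f t)) B \<partial>path_law x)"
      unfolding measure_def path_law_future[OF t h A B] ..
    also have "\<dots> = enn2real (\<integral>\<^sup>+f. ennreal (indicator A f * measure (kernel h (f t)) B) \<partial>path_law x)"
      by (intro arg_cong[where f = enn2real] nn_integral_cong)
         (auto simp: indicator_def finite_measure.emeasure_eq_measure[OF prob_space.finite_measure[OF K]])
    also have "\<dots> = (\<integral>f. indicator A f * measure (kernel h (f t)) B \<partial>path_law x)"
      by (rule integral_eq_nn_integral[symmetric]) auto
    also have "\<dots> = (\<integral>f\<in>A. measure (kernel h (f t)) B \<partial>path_law x)"
      by (simp add: set_lebesgue_integral_def)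
    finally show "(\<integral>f\<in>A. indicator ?C f \<partial>path_law x) =
      (\<integral>f\<in>A. measure (kernel h (f t)) B \<partial>path_law x)" .
  next
    show "integrable (path_law x) (indicator ?C :: _ \<Rightarrow> real)"
      by (intro integrable_real_indicator C) (simp add: L.emeasure_eq_measure)
    show "integrable (path_law x) (\<lambda>f. measure (kernel h (f t)) B)"
      by (rule L.integrable_const_bound[where B = 1]) (auto simp: prob_space.prob_le_1[OF K])
  qed (rule mF)
qed

text \<open>Since the law at time \<open>h\<close> of the path started at \<open>y\<close> is \<open>\<nu> h\<close> translated by \<open>y\<close>, the Markov property is the
independence of the increments from the past.\<close>

theorem cadlag_markov_process:
  assumes P: "\<And>t. t \<ge> 0 \<Longrightarrow> P t = kernel t"
  shows "markov_process P path_algebra path_filtration path_law (\<lambda>t f. f t)"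
  unfolding markov_process_def
proof (intro conjI allI impI ballI)
  show "transition_function P"
    using transition_function_kernel P unfolding transition_function_def by (simp add: add_nonneg_nonneg)
  show "prob_space (path_law x)" "sets (path_law x) = sets path_algebra" for x
    by (simp_all add: prob_space_path_law)
  show "subalgebra path_algebra (path_filtration t)" for t by (rule subalgebra_path_algebra)
  show "subalgebra (path_filtration t) (path_filtration s)" if "s \<le> t" for s t
    using that by (rule subalgebra_path_filtration)
  show "(\<lambda>f. f t) \<in> path_filtration t \<rightarrow>\<^sub>M borel" if "t \<ge> 0" for t
    using that by (intro measurable_path_filtration_coordinate) auto
  show "AE f in path_law x. f 0 = x" for x
    unfolding path_law_def
  proof (subst AE_distr_iff[OF measurable_translate_path])
    have "(\<lambda>f. f 0) \<in> borel_measurable path_algebra" by (rule measurable_path_algebra_coordinate) simp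
    then show "{f \<in> space path_algebra. f 0 = x} \<in> sets path_algebra"
      by (intro predE pred_eq_const1[where N = borel]) auto
    show "AE \<omega> in \<Omega>. x + path \<omega> 0 = x" using AE_path_0 by eventually_elim simp
  qed
  show "AE f in path_law x. real_cond_exp (path_law x) (path_filtration t)
      (indicator {f\<in>space path_algebra. f (t + h) \<in> B}) f = measure (P h (f t)) B"
    if "0 \<le> t" "0 \<le> h" "B \<in> sets borel" for x t h B
    using path_law_markov[OF that] P[OF that(2)] by simp
  show "\<exists>g\<in>space path_algebra. \<forall>s\<ge>0. g s = f (t + s)" if "0 \<le> t" "f \<in> space path_algebra" for t f
    using shift_cadlag[of f t] that by (intro bexI[of _ "\<lambda>s. f (t + s)"]) auto
qed

lemma space_homogeneous_kernel:
  assumes P: "\<And>t. t \<ge> 0 \<Longrightarrow> P t = kernel t"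
  shows "space_homogeneous P"
  unfolding space_homogeneous_def
proof (intro allI impI)
  fix t :: real and x z assume t: "t \<ge> 0"
  have m: "(\<lambda>y. x + y) \<in> \<nu> t \<rightarrow>\<^sub>M borel" "(\<lambda>y. y + z) \<in> borel \<rightarrow>\<^sub>M borel" for x z :: 'a
    using t by (auto simp: measurable_\<nu>_cong intro!: borel_measurable_add)
  show "P t (x + z) = distr (P t x) borel (\<lambda>y. y + z)"
    unfolding P[OF t] kernel_def by (subst distr_distr[OF m(2) m(1)]) (auto simp: comp_def add_ac intro!: distr_cong)
qed

end

section \<open>Lattices in the rationals\<close>

locale adele_ring =
  fixes a :: "nat \<Rightarrow> nat" and emb :: "rat \<Rightarrow> 'a::polish_ring"
  assumes adelic: "adelic_sequence a" and adeles: "finite_adeles a emb"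
begin

abbreviation q :: "int \<Rightarrow> rat" where "q \<equiv> epsi a"

text \<open>The subgroup $e^{\psi(n)}\mathbb{Z}$ of the rationals.\<close>

definition lattice :: "int \<Rightarrow> rat set" where
  "lattice n = range (\<lambda>k::int. q n * of_int k)"

text \<open>The value $e^{-\psi(n)}$ of the norm, decreasing in \<open>n\<close>.\<close>

definition radius :: "int \<Rightarrow> real" where
  "radius n = 1 / of_rat (q n)"

lemma a_pos: "a n > 0"
  using adelic strict_mono_less_eq[of a 0 n] by (auto simp: adelic_sequence_def)

lemma a_0: "a 0 = 1"
  using adelic by (simp add: adelic_sequence_def)

lemma a_dvd: "m \<le> n \<Longrightarrow> a m dvd a n"
proof (induction n rule: dec_induct)
  case (step n)
  then show ?case using adelic dvd_trans by (auto simp: adelic_sequence_def)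
qed simp

lemma a_less_iff: "a m < a n \<longleftrightarrow> m < n"
  using adelic by (simp add: adelic_sequence_def strict_mono_less)

lemma a_cofinal: "m > 0 \<Longrightarrow> \<exists>n. m dvd a n"
  using adelic by (simp add: adelic_sequence_def)

lemma a_ge: "a n \<ge> n"
  using adelic by (simp add: adelic_sequence_def strict_mono_imp_increasing)

lemma q_pos: "q n > 0"
  using a_pos by (simp add: epsi_def)

lemma q_0: "q 0 = 1"
  by (simp add: epsi_def a_0)

lemma q_uminus: "q (- n) = 1 / q n"
  using a_0 by (cases "n = 0") (auto simp: epsi_def divide_simps)

lemma q_quotient_nat:
  assumes "m \<le> n" shows "\<exists>k::nat. q n = q m * of_nat k"
proof -
  consider "0 \<le> m" | "m < 0" "0 \<le> n" | "n < 0" by linarith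
  then show ?thesis
  proof cases
    case 1
    then have "a (nat m) dvd a (nat n)" using assms by (intro a_dvd) simp
    then obtain k where "a (nat n) = a (nat m) * k" by blast
    then show ?thesis using 1 assms by (intro exI[of _ k]) (simp add: epsi_def)
  next
    case 2
    then show ?thesis using a_pos[of "nat (- m)"]
      by (intro exI[of _ "a (nat n) * a (nat (- m))"]) (simp add: epsi_def)
  next
    case 3
    then have "a (nat (- n)) dvd a (nat (- m))" using assms by (intro a_dvd) simp
    then obtain k where k: "a (nat (- m)) = a (nat (- n)) * k" by blast
    then have "k > 0" using a_pos[of "nat (- m)"] by (simp add: gr0I)
    then show ?thesis using 3 assms a_pos[of "nat (- n)"] k
      by (intro exI[of _ k]) (simp add: epsi_def)
  qed
qed

lemma q_less: assumes "m < n" shows "q m < q n"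
proof -
  consider "0 \<le> m" | "m < 0" "0 \<le> n" | "n < 0" by linarith
  then show ?thesis
  proof cases
    case 1
    then show ?thesis using assms a_less_iff[of "nat m" "nat n"] by (simp add: epsi_def)
  next
    case 2
    then have "a 0 < a (nat (- m))" "a 0 \<le> a (nat n)"
      using a_less_iff[of 0 "nat (- m)"] a_less_iff[of 0 "nat n"] by (auto simp: a_0 Suc_leI a_pos)
    then have "q m < 1" "1 \<le> q n" using 2 by (auto simp: epsi_def a_0 field_simps)
    then show ?thesis by simp
  next
    case 3
    then have "a (nat (- n)) < a (nat (- m))" using assms by (simp add: a_less_iff)
    then show ?thesis using 3 assms a_pos by (simp add: epsi_def field_simps)
  qed
qed

lemma q_less_iff: "q m < q n \<longleftrightarrow> m < n"
  using q_less[of m n] q_less[of n m] by (cases m n rule: linorder_cases) auto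

lemma q_le_iff: "q m \<le> q n \<longleftrightarrow> m \<le> n"
  using q_less_iff[of n m] by linarith

lemma radius_pos: "radius n > 0"
  using q_pos by (simp add: radius_def)

lemma radius_eq_exp: "radius n = exp (- psi a n)"
  using exp_psi[OF adelic, of n] by (simp add: radius_def exp_minus inverse_eq_divide)

lemma radius_le_iff: "radius m \<le> radius n \<longleftrightarrow> n \<le> m"
  using q_pos[of m] q_pos[of n] q_le_iff[of n m]
  by (simp add: radius_def frac_le_eq divide_simps of_rat_less_eq)

lemma radius_eq_iff: "radius m = radius n \<longleftrightarrow> n = m"
  using radius_le_iff[of n m] radius_le_iff[of m n] by auto

lemma radius_uminus: "radius (- n) = of_rat (q n)"
  by (simp add: radius_def q_uminus of_rat_divide)

lemma radius_small: assumes "e > 0" shows "\<exists>n::nat. radius (int n) < e"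
proof -
  obtain n :: nat where "inverse (of_nat (Suc n)) < e" using reals_Archimedean[OF assms] by auto
  moreover have "radius (int (Suc n)) \<le> inverse (of_nat (Suc n))"
  proof -
    have "real (Suc n) \<le> real (a (Suc n))" using a_ge[of "Suc n"] by (simp only: of_nat_le_iff)
    then show ?thesis by (simp add: radius_def epsi_def field_simps del: of_nat_Suc)
  qed
  ultimately have "radius (int (Suc n)) < e" by linarith
  then show ?thesis ..
qed

lemma radius_large: "\<exists>n::nat. r \<le> radius (- int n)"
proof -
  obtain n :: nat where "r \<le> real n" using real_arch_simple by blast
  moreover have "real n \<le> radius (- int n)"
    using a_ge[of n] by (simp add: radius_uminus epsi_def)
  ultimately show ?thesis using order_trans by blast
qed

lemma lattice_add: "x \<in> lattice n \<Longrightarrow> y \<in> lattice n \<Longrightarrow> x + y \<in> lattice n"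
  by (auto simp: lattice_def distrib_left[symmetric] simp flip: of_int_add)

lemma lattice_uminus: "x \<in> lattice n \<Longrightarrow> - x \<in> lattice n"
  by (auto simp: lattice_def simp flip: mult_minus_right of_int_minus)

lemma lattice_0 [simp]: "0 \<in> lattice n"
  by (auto simp: lattice_def intro: image_eqI[of _ _ 0])

lemma lattice_mult_of_int: "q n * of_int k \<in> lattice n"
  unfolding lattice_def by (rule rangeI)

lemma lattice_antimono: assumes "m \<le> n" shows "lattice n \<subseteq> lattice m"
proof
  fix x assume "x \<in> lattice n"
  then obtain k :: int where "x = q n * of_int k" by (auto simp: lattice_def)
  moreover obtain l :: nat where "q n = q m * of_nat l" using q_quotient_nat[OF assms] by blast
  ultimately have "x = q m * of_int (int l * k)" by simp
  then show "x \<in> lattice m" by (simp only: lattice_mult_of_int)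
qed

lemma lattice_0_iff: "x \<in> lattice 0 \<longleftrightarrow> x \<in> \<int>"
  by (auto simp: lattice_def q_0 Ints_def)

text \<open>The denominator divides some \<open>a N\<close>: here cofinality of the sequence enters.\<close>

lemma lattice_exhausts: "\<exists>n. x \<in> lattice n"
proof -
  obtain p d where pd: "quotient_of x = (p, d)" by fastforce
  then have d: "d > 0" and x: "x = of_int p / of_int d"
    using quotient_of_denom_pos quotient_of_div by auto
  obtain N where "nat d dvd a N" using a_cofinal[of "nat d"] d by auto
  then obtain k where k: "a N = nat d * k" by blast
  have kp: "k > 0" using a_pos[of N] k by (simp add: gr0I)
  have "(of_nat (a N) :: rat) = of_int d * of_nat k" using k d by simp
  then have "x = q (- int N) * of_int (p * int k)"
    using d kp by (cases "N = 0") (auto simp: x epsi_def a_0 field_simps)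
  then show ?thesis using lattice_mult_of_int by metis
qed

lemma lattice_bound: assumes "x \<in> lattice n" "x \<noteq> 0" shows "q n \<le> \<bar>x\<bar>"
proof -
  obtain k :: int where k: "x = q n * of_int k" using assms(1) by (auto simp: lattice_def)
  then have "1 \<le> \<bar>of_int k :: rat\<bar>" using assms(2) by (auto simp: simp flip: of_int_abs)
  then show ?thesis using q_pos[of n] by (simp add: k abs_mult)
qed

text \<open>The maximum in the definition of the order exists: some lattice contains \<open>x\<close>, and nonzero elements of a lattice are
at least as large as its generator, which is unbounded.\<close>

lemma lattice_rat_ord:
  assumes "x \<noteq> 0" shows "x \<in> lattice n \<longleftrightarrow> n \<le> rat_ord a x"
proof -
  obtain n0 where n0: "x \<in> lattice n0" using lattice_exhausts by blast
  obtain N :: nat where N: "real_of_rat \<bar>x\<bar> < real N" using reals_Archimedean2 by blast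
  have bound: "n < int N" if "x \<in> lattice n" for n
  proof (rule ccontr)
    assume "\<not> n < int N"
    then have "q (int N) \<le> q n" by (simp add: q_le_iff)
    also have "\<dots> \<le> \<bar>x\<bar>" by (rule lattice_bound[OF that assms])
    finally have "real_of_rat (q (int N)) \<le> real_of_rat \<bar>x\<bar>" by (simp add: of_rat_less_eq)
    moreover have "real N \<le> real_of_rat (q (int N))" using a_ge[of N] by (simp add: epsi_def)
    ultimately show False using N by linarith
  qed
  have "\<exists>k. (x \<in> lattice (n0 + int k)) \<and> (\<forall>l. x \<in> lattice (n0 + int l) \<longrightarrow> l \<le> k)"
    using ex_has_greatest_nat[of "\<lambda>k. x \<in> lattice (n0 + int k)" 0 "\<lambda>k. k" "nat (int N - n0)"] n0 bound
    by (force simp: less_diff_eq)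
  then obtain k where k: "x \<in> lattice (n0 + int k)" "\<And>l. x \<in> lattice (n0 + int l) \<Longrightarrow> l \<le> k" by blast
  have max: "m \<le> n0 + int k" if "x \<in> lattice m" for m
  proof (cases "m \<le> n0")
    case False
    then have "m = n0 + int (nat (m - n0))" by simp
    then show ?thesis using k(2)[of "nat (m - n0)"] that by simp
  qed simp
  have "rat_ord a x = n0 + int k"
    unfolding rat_ord_def using k(1) max by (intro Greatest_equality) (auto simp: lattice_def)
  then show ?thesis using k(1) max lattice_antimono by auto
qed

section \<open>The ultrametric ring of finite adeles\<close>

lemma emb_add: "emb (x + y) = emb x + emb y" and emb_mult: "emb (x * y) = emb x * emb y"
  and dist_emb: "dist (emb x) (emb y) = rat_dist a x y" and dense_emb: "closure (range emb) = UNIV"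
  using adeles by (auto simp: finite_adeles_def)

lemma emb_0: "emb 0 = 0"
  using emb_add[of 0 0] by simp

lemma emb_uminus: "emb (- x) = - emb x"
  using emb_add[of x "- x"] by (simp add: emb_0 eq_neg_iff_add_eq_0 add.commute)

lemma emb_diff: "emb (x - y) = emb x - emb y"
  using emb_add[of x "- y"] by (simp add: emb_uminus)

lemma emb_sum: "emb (\<Sum>i\<in>I. f i) = (\<Sum>i\<in>I. emb (f i))"
  by (induction I rule: infinite_finite_induct) (auto simp: emb_0 emb_add)

lemma dist_emb_le_iff: "dist (emb x) (emb y) \<le> radius n \<longleftrightarrow> x - y \<in> lattice n"
proof (cases "x = y")
  case True
  then show ?thesis using radius_pos[of n] by simp
next
  case False
  then show ?thesis
    by (simp add: dist_emb rat_dist_def lattice_rat_ord radius_le_iff flip: radius_eq_exp)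
qed

lemma dist_emb_cases: "x \<noteq> y \<Longrightarrow> dist (emb x) (emb y) = radius (rat_ord a (x - y))"
  by (simp add: dist_emb rat_dist_def radius_eq_exp)

lemma emb_sequence: obtains r where "(\<lambda>n. emb (r n)) \<longlonglongrightarrow> x"
proof -
  have "x \<in> closure (range emb)" by (simp add: dense_emb)
  then obtain f where f: "\<And>n. f n \<in> range emb" "f \<longlonglongrightarrow> x" unfolding closure_sequential by blast
  then have "\<exists>r. \<forall>n. f n = emb (r n)" by (intro choice) blast
  then obtain r where "f = (\<lambda>n. emb (r n))" by blast
  with f(2) that show thesis by blast
qed

lemma emb_approx: assumes "e > 0" obtains r where "dist x (emb r) < e"
proof -
  have "x \<in> closure (range emb)" by (simp add: dense_emb)
  then show ?thesis using assms that unfolding closure_approachable by (auto simp: dist_commute)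
qed

text \<open>Known on the dense subgroup of rationals, where the distance depends on the difference only.\<close>

lemma dist_translate: "dist (x + z) (y + z) = dist x (y :: 'a)"
proof -
  obtain r s u where l: "(\<lambda>n. emb (r n)) \<longlonglongrightarrow> x" "(\<lambda>n. emb (s n)) \<longlonglongrightarrow> y" "(\<lambda>n. emb (u n)) \<longlonglongrightarrow> z"
    by (metis emb_sequence)
  have "(\<lambda>n. dist (emb (r n) + emb (u n)) (emb (s n) + emb (u n))) \<longlonglongrightarrow> dist (x + z) (y + z)"
    by (intro tendsto_intros l)
  moreover have "dist (emb (r n) + emb (u n)) (emb (s n) + emb (u n)) = dist (emb (r n)) (emb (s n))" for n
    by (simp add: dist_emb rat_dist_def flip: emb_add)
  moreover have "(\<lambda>n. dist (emb (r n)) (emb (s n))) \<longlonglongrightarrow> dist x y"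
    by (intro tendsto_intros l)
  ultimately show ?thesis using LIMSEQ_unique by auto
qed

text \<open>On the rationals, differences lying in a lattice add up to an element of the same lattice.\<close>

lemma ultrametric: "dist x z \<le> max (dist x y) (dist y (z :: 'a))"
proof -
  obtain r s u where l: "(\<lambda>n. emb (r n)) \<longlonglongrightarrow> x" "(\<lambda>n. emb (s n)) \<longlonglongrightarrow> y" "(\<lambda>n. emb (u n)) \<longlonglongrightarrow> z"
    by (metis emb_sequence)
  have rat: "dist (emb x) (emb z) \<le> max (dist (emb x) (emb y)) (dist (emb y) (emb z))" for x y z
  proof (cases "x = y \<or> y = z")
    case False
    define n where "n = min (rat_ord a (x - y)) (rat_ord a (y - z))"
    have "x - y \<in> lattice n" "y - z \<in> lattice n" using False by (auto simp: lattice_rat_ord n_def)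
    from lattice_add[OF this] have "dist (emb x) (emb z) \<le> radius n" by (simp add: dist_emb_le_iff)
    also have "radius n \<le> max (dist (emb x) (emb y)) (dist (emb y) (emb z))"
      using False by (auto simp: dist_emb_cases n_def min_def le_max_iff_disj)
    finally show ?thesis .
  qed auto
  have "(\<lambda>n. dist (emb (r n)) (emb (u n))) \<longlonglongrightarrow> dist x z"
    "(\<lambda>n. max (dist (emb (r n)) (emb (s n))) (dist (emb (s n)) (emb (u n)))) \<longlonglongrightarrow> max (dist x y) (dist y z)"
    by (intro tendsto_intros l)+
  then show ?thesis using rat by (intro LIMSEQ_le) auto
qed

lemma dist_eq_norm: "dist x y = dist (x - y) (0 :: 'a)"
  using dist_translate[of "x - y" y 0] by simp

text \<open>The closure of $e^{\psi(n)}\mathbb{Z}$; so the balls shrink as \<open>n\<close> grows.\<close>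

definition B :: "int \<Rightarrow> 'a set" where
  "B n = cball 0 (radius n)"

lemma B_iff: "x \<in> B n \<longleftrightarrow> dist x 0 \<le> radius n"
  by (simp add: B_def dist_commute)

lemma emb_B_iff: "emb r \<in> B n \<longleftrightarrow> r \<in> lattice n"
  using dist_emb_le_iff[of r 0 n] by (simp add: B_iff emb_0)

lemma B_diff: assumes "x \<in> B n" "y \<in> B n" shows "x - y \<in> B n"
  using assms ultrametric[of x y 0] dist_eq_norm[of x y]
  by (auto simp: B_iff dist_commute[of 0] max_def split: if_splits)

lemma B_0 [simp]: "0 \<in> B n"
  using radius_pos[of n] by (simp add: B_iff)

lemma B_uminus: "x \<in> B n \<Longrightarrow> - x \<in> B n"
  using B_diff[of 0 n x] by simp

lemma B_uminus_iff [simp]: "- x \<in> B n \<longleftrightarrow> x \<in> B n"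
  using B_uminus[of x n] B_uminus[of "- x" n] by auto

lemma B_add: "x \<in> B n \<Longrightarrow> y \<in> B n \<Longrightarrow> x + y \<in> B n"
  using B_diff[of x n "- y"] by simp

lemma B_sum: "(\<And>i. i \<in> I \<Longrightarrow> f i \<in> B n) \<Longrightarrow> (\<Sum>i\<in>I. f i) \<in> B n"
  by (induction I rule: infinite_finite_induct) (auto intro: B_add)

lemma B_antimono: "m \<le> n \<Longrightarrow> B n \<subseteq> B m"
  using radius_le_iff[of n m] by (auto simp: B_iff)

lemma closed_B: "closed (B n)"
  by (simp add: B_def)

lemma open_B: "open (B n)"
  unfolding open_dist
proof (intro ballI exI conjI allI impI)
  fix x y assume "x \<in> B n" "dist y x < radius n"
  then show "y \<in> B n" using ultrametric[of y 0 x] by (auto simp: B_iff)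
qed (rule radius_pos)

lemma B_measurable [measurable]: "B n \<in> sets borel"
  using closed_B by simp

lemma emb_approx_B: obtains r where "x - emb r \<in> B n"
  using emb_approx[OF radius_pos, of x n] by (auto simp: B_iff dist_eq_norm[of x] intro: less_imp_le)

text \<open>In an ultrametric triangle the two longest sides are equal.\<close>

lemma dist_0_attained:
  assumes "x \<noteq> 0" "dist x (emb r) < dist x 0"
  shows "dist x 0 = radius (rat_ord a r)" and "r \<noteq> 0"
proof -
  show r: "r \<noteq> 0" using assms by (auto simp: emb_0)
  have "dist (emb r) 0 = dist x 0"
    using assms ultrametric[of x 0 "emb r"] ultrametric[of "emb r" 0 x] by (auto simp: dist_commute)
  then show "dist x 0 = radius (rat_ord a r)" using dist_emb_cases[OF r] by (simp add: emb_0)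
qed

text \<open>Rationals closer to \<open>x\<close> than \<open>0\<close> is have the same distance to \<open>0\<close> as \<open>x\<close>, so the order is constant near \<open>x\<close>; the
constant is unique because rationals are dense.\<close>

lemma radius_adele_ord:
  assumes x: "x \<noteq> 0" shows "dist x 0 = radius (adele_ord a emb x)"
proof -
  have pos: "dist x 0 > 0" using x by simp
  obtain r where r: "dist x (emb r) < dist x 0" using emb_approx[OF pos] .
  have ev: "\<forall>\<^sub>F q in filtercomap emb (nhds x). rat_ord a q = rat_ord a r"
  proof -
    have "\<forall>\<^sub>F y in nhds x. dist x y < dist x 0"
      using pos unfolding eventually_nhds_metric by (metis dist_commute)
    then have "\<forall>\<^sub>F q in filtercomap emb (nhds x). dist x (emb q) < dist x 0" by (rule eventually_filtercomapI)
    then show ?thesis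
    proof eventually_elim
      case (elim s)
      have "radius (rat_ord a s) = radius (rat_ord a r)"
        using dist_0_attained[OF x elim] dist_0_attained[OF x r] by simp
      then show ?case by (simp add: radius_eq_iff)
    qed
  qed
  have nb: "filtercomap emb (nhds x) \<noteq> bot"
  proof (rule filtercomap_neq_bot)
    fix P assume "eventually P (nhds x)"
    then obtain e where "e > 0" "\<And>y. dist y x < e \<Longrightarrow> P y" by (auto simp: eventually_nhds_metric)
    then show "\<exists>q. P (emb q)" using emb_approx[of e x] by (metis dist_commute)
  qed
  have "adele_ord a emb x = rat_ord a r"
    unfolding adele_ord_def
  proof (rule the_equality)
    show "\<forall>\<^sub>F q in filtercomap emb (nhds x). rat_ord a q = rat_ord a r" by (rule ev)
    fix n assume "\<forall>\<^sub>F q in filtercomap emb (nhds x). rat_ord a q = n"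
    with ev have "\<forall>\<^sub>F q in filtercomap emb (nhds x). n = rat_ord a r" by eventually_elim simp
    then show "n = rat_ord a r" using nb by (simp add: eventually_const_iff)
  qed
  then show ?thesis using dist_0_attained[OF x r] by simp
qed

lemma adele_norm_eq_dist: "adele_norm a emb x = dist x 0"
  using radius_adele_ord[of x] by (simp add: adele_norm_def radius_eq_exp)

lemma B_iff_ord: "x \<noteq> 0 \<Longrightarrow> x \<in> B n \<longleftrightarrow> n \<le> adele_ord a emb x"
  by (simp add: B_iff radius_adele_ord radius_le_iff)

text \<open>For rationals this is $e^{\psi(-n)} = 1/e^{\psi(n)}$; the general case follows by continuity of the product.\<close>

lemma mult_B: assumes "x \<in> B n" "y \<in> B (- n)" shows "x * y \<in> B 0"
proof -
  obtain r s where l: "(\<lambda>n. emb (r n)) \<longlonglongrightarrow> x" "(\<lambda>n. emb (s n)) \<longlonglongrightarrow> y" by (metis emb_sequence)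
  have "\<forall>\<^sub>F k in sequentially. emb (r k) \<in> B n" "\<forall>\<^sub>F k in sequentially. emb (s k) \<in> B (- n)"
    using topological_tendstoD[OF l(1) open_B assms(1)] topological_tendstoD[OF l(2) open_B assms(2)] by auto
  then have "\<forall>\<^sub>F k in sequentially. emb (r k) * emb (s k) \<in> B 0"
  proof eventually_elim
    case (elim k)
    then have "r k \<in> lattice n" "s k \<in> lattice (- n)" by (auto simp: emb_B_iff)
    then obtain i j :: int where "r k = q n * of_int i" "s k = q (- n) * of_int j" by (auto simp: lattice_def)
    then have "r k * s k = of_int (i * j)" using q_pos[of n] by (simp add: q_uminus)
    then have "r k * s k \<in> lattice 0" by (simp add: lattice_0_iff)
    then show ?case by (simp add: emb_B_iff flip: emb_mult)
  qed
  moreover have "(\<lambda>k. emb (r k) * emb (s k)) \<longlonglongrightarrow> x * y" by (intro tendsto_mult l)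
  ultimately show ?thesis by (intro Lim_in_closed_set[OF closed_B _ sequentially_bot])
qed

section \<open>Cosets and compactness\<close>

text \<open>Approximate \<open>x\<close> by a rational in the larger lattice and reduce its coefficient modulo the index \<open>K\<close>.\<close>

lemma coset_exists:
  assumes "x \<in> B n" and K: "q m = q n * of_nat K"
  shows "\<exists>j<K. x - emb (q n * of_nat j) \<in> B m"
proof -
  have K0: "K > 0" using K q_pos[of m] by (auto intro: gr0I)
  have "q n \<le> q m" using K q_pos[of n] K0 by simp
  then have nm: "n \<le> m" by (simp add: q_le_iff)
  obtain r where r: "x - emb r \<in> B m" by (rule emb_approx_B)
  then have "x - emb r \<in> B n" using B_antimono[OF nm] by auto
  then have "x - (x - emb r) \<in> B n" by (rule B_diff[OF assms(1)])
  then obtain i :: int where i: "r = q n * of_int i" by (auto simp: emb_B_iff lattice_def)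
  \<comment> \<open>\<open>r\<close> is \<open>i\<close> times the generator of the lattice of index \<open>n\<close>, and \<open>K\<close> times that generator is the one of index \<open>m\<close>\<close>
  define j where "j = nat (i mod int K)"
  have ij: "i = int j + int K * (i div int K)" using K0 by (simp add: j_def)
  have "r - q n * of_nat j = q m * of_int (i div int K)"
    unfolding i K by (subst ij) (simp add: algebra_simps)
  then have "emb (r - q n * of_nat j) \<in> B m" by (simp only: emb_B_iff lattice_mult_of_int)
  then have "(x - emb r) + emb (r - q n * of_nat j) \<in> B m" by (rule B_add[OF r])
  moreover have "j < K" using K0 by (simp add: j_def nat_less_iff)
  ultimately show ?thesis by (auto simp: emb_diff)
qed

lemma coset_unique:
  assumes K: "q m = q n * of_nat K" and ij: "i < K" "j < K"
    and B: "x - emb (q n * of_nat i) \<in> B m" "x - emb (q n * of_nat j) \<in> B m"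
  shows "i = j"
proof -
  have "emb (q n * of_nat i - q n * of_nat j) \<in> B m"
    using B_diff[OF B(2,1)] by (simp add: emb_diff)
  then obtain k :: int where "q n * of_nat i - q n * of_nat j = q m * of_int k"
    by (auto simp: emb_B_iff lattice_def)
  then have "q n * of_int (int i - int j) = q n * of_int (int K * k)" by (simp add: K algebra_simps)
  then have "int i - int j = int K * k" using q_pos[of n] by (simp del: of_int_diff of_int_mult)
  moreover have "\<bar>int i - int j\<bar> < int K" using ij by auto
  ultimately have "int K * \<bar>k\<bar> < int K * 1" by (simp add: abs_mult)
  then have "k = 0" by (simp only: mult_less_cancel_left) auto
  with \<open>int i - int j = int K * k\<close> show ?thesis by simp
qed

text \<open>Balls are complete, and each is covered by finitely many cosets of any smaller ball.\<close>

lemma compact_cball_adele: "compact (cball (0::'a) r)"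
proof -
  obtain N where N: "r \<le> radius (- int N)" using radius_large by blast
  have "compact (B (- int N))"
    unfolding compact_eq_totally_bounded complete_eq_closed
  proof (intro conjI allI impI)
    show "closed (B (- int N))" by (rule closed_B)
    fix e :: real assume "e > 0"
    then obtain n where n: "radius (int n) < e" using radius_small by blast
    obtain K where K: "q (int n) = q (- int N) * of_nat K" using q_quotient_nat[of "- int N" "int n"] by auto
    have "B (- int N) \<subseteq> (\<Union>x\<in>(\<lambda>j. emb (q (- int N) * of_nat j)) ` {..<K}. ball x e)"
    proof
      fix x assume "x \<in> B (- int N)"
      then obtain j where "j < K" "x - emb (q (- int N) * of_nat j) \<in> B (int n)" using coset_exists[OF _ K] by blast
      then show "x \<in> (\<Union>x\<in>(\<lambda>j. emb (q (- int N) * of_nat j)) ` {..<K}. ball x e)"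
        using n by (auto simp: B_iff dist_commute[of _ x] dist_eq_norm[of x] intro!: bexI[of _ j])
    qed
    then show "\<exists>k. finite k \<and> B (- int N) \<subseteq> (\<Union>x\<in>k. ball x e)"
      by (intro exI[of _ "(\<lambda>j. emb (q (- int N) * of_nat j)) ` {..<K}"]) simp
  qed
  moreover have "cball 0 r = B (- int N) \<inter> cball 0 r" using N by (auto simp: B_def)
  ultimately show ?thesis using compact_Int_closed[OF _ closed_cball] by metis
qed

section \<open>Digit expansions and the canonical character\<close>

text \<open>The property that singles out the digits in the definition of the digits of an adele.\<close>

definition is_digit_sequence :: "'a \<Rightarrow> (int \<Rightarrow> nat) \<Rightarrow> bool" where
  "is_digit_sequence x c \<longleftrightarrow> (let \<gamma> = adele_ord a emb x in
     (\<forall>l<\<gamma>. c l = 0) \<and> c \<gamma> \<noteq> 0 \<and> (\<forall>l\<ge>\<gamma>. of_nat (c l) \<le> eLambda a (l + 1) - 1) \<and>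
     (\<lambda>k::nat. emb (of_nat (c (\<gamma> + int k)) * epsi a (\<gamma> + int k))) sums x)"

text \<open>The integer $e^{\Lambda(n+1)}$, the number of possible digits at place \<open>n\<close>.\<close>

definition digit_base :: "int \<Rightarrow> nat" where
  "digit_base n = (SOME k. q (n + 1) = q n * of_nat k)"

lemma q_Suc: "q (n + 1) = q n * of_nat (digit_base n)"
  unfolding digit_base_def by (rule someI_ex) (simp add: q_quotient_nat)

lemma digit_bound_iff: "of_nat j \<le> eLambda a (l + 1) - 1 \<longleftrightarrow> j < digit_base l"
proof -
  have "eLambda a (l + 1) = of_nat (digit_base l)"
    using q_Suc[of l] q_pos[of l] by (simp add: eLambda_def)
  moreover have "(of_nat j :: rat) \<le> of_nat (digit_base l) - 1 \<longleftrightarrow> (of_nat (Suc j) :: rat) \<le> of_nat (digit_base l)"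
    by (simp add: le_diff_eq add.commute)
  ultimately show ?thesis by (simp only: of_nat_le_iff Suc_le_eq)
qed

text \<open>The tail of the series consists of terms in a closed subgroup.\<close>

lemma digit_tail:
  assumes "(\<lambda>k::nat. emb (of_nat (c (\<gamma> + int k)) * q (\<gamma> + int k))) sums x"
  shows "x - (\<Sum>k<N. emb (of_nat (c (\<gamma> + int k)) * q (\<gamma> + int k))) \<in> B (\<gamma> + int N)"
proof -
  let ?f = "\<lambda>k::nat. emb (of_nat (c (\<gamma> + int k)) * q (\<gamma> + int k))"
  have f: "?f k \<in> B (\<gamma> + int N)" if "N \<le> k" for k
  proof -
    have "?f k \<in> B (\<gamma> + int k)"
      unfolding emb_B_iff
      using lattice_mult_of_int[of "\<gamma> + int k" "int (c (\<gamma> + int k))"] by (simp add: mult.commute)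
    then show ?thesis using B_antimono[of "\<gamma> + int N" "\<gamma> + int k"] that by auto
  qed
  have "(\<lambda>n. (\<Sum>k<n. ?f k) - (\<Sum>k<N. ?f k)) \<longlonglongrightarrow> x - (\<Sum>k<N. ?f k)"
    using assms unfolding sums_def by (intro tendsto_intros)
  moreover have "\<forall>\<^sub>F n in sequentially. (\<Sum>k<n. ?f k) - (\<Sum>k<N. ?f k) \<in> B (\<gamma> + int N)"
    using eventually_ge_at_top[of N]
  proof eventually_elim
    case (elim n)
    then have "(\<Sum>k<n. ?f k) - (\<Sum>k<N. ?f k) = (\<Sum>k\<in>{..<n} - {..<N}. ?f k)"
      by (intro sum_diff[symmetric]) auto
    also have "\<dots> \<in> B (\<gamma> + int N)" by (intro B_sum f) auto
    finally show ?case .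
  qed
  ultimately show ?thesis by (intro Lim_in_closed_set[OF closed_B _ sequentially_bot])
qed

lemma digit_tail_Suc:
  assumes "(\<lambda>k::nat. emb (of_nat (c (\<gamma> + int k)) * q (\<gamma> + int k))) sums x"
  shows "x - (\<Sum>k<N. emb (of_nat (c (\<gamma> + int k)) * q (\<gamma> + int k))) - emb (q (\<gamma> + int N) * of_nat (c (\<gamma> + int N)))
    \<in> B (\<gamma> + int N + 1)"
  using digit_tail[OF assms, of "Suc N"] by (simp add: diff_diff_eq mult.commute add_ac)

text \<open>Once the earlier digits agree, the next digit is determined by the coset of the remainder.\<close>

lemma digit_sequence_unique:
  assumes "is_digit_sequence x c" "is_digit_sequence x d" shows "c = d"
proof
  fix l
  define \<gamma> where "\<gamma> = adele_ord a emb x"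
  have c: "\<And>l. l < \<gamma> \<Longrightarrow> c l = 0" "\<And>l. l \<ge> \<gamma> \<Longrightarrow> c l < digit_base l"
      "(\<lambda>k::nat. emb (of_nat (c (\<gamma> + int k)) * q (\<gamma> + int k))) sums x"
    and d: "\<And>l. l < \<gamma> \<Longrightarrow> d l = 0" "\<And>l. l \<ge> \<gamma> \<Longrightarrow> d l < digit_base l"
      "(\<lambda>k::nat. emb (of_nat (d (\<gamma> + int k)) * q (\<gamma> + int k))) sums x"
    using assms by (auto simp: is_digit_sequence_def Let_def digit_bound_iff simp flip: \<gamma>_def)
  have eq: "c (\<gamma> + int k) = d (\<gamma> + int k)" for k
  proof (induction k rule: less_induct)
    case (less k)
    define y where "y = x - (\<Sum>i<k. emb (of_nat (c (\<gamma> + int i)) * q (\<gamma> + int i)))"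
    have "y = x - (\<Sum>i<k. emb (of_nat (d (\<gamma> + int i)) * q (\<gamma> + int i)))"
      unfolding y_def using less by (intro arg_cong2[where f = minus] sum.cong) auto
    then have "y - emb (q (\<gamma> + int k) * of_nat (d (\<gamma> + int k))) \<in> B (\<gamma> + int k + 1)"
      using digit_tail_Suc[OF d(3), of k] by simp
    moreover have "y - emb (q (\<gamma> + int k) * of_nat (c (\<gamma> + int k))) \<in> B (\<gamma> + int k + 1)"
      using digit_tail_Suc[OF c(3), of k] by (simp add: y_def)
    ultimately show ?case
      using c(2)[of "\<gamma> + int k"] d(2)[of "\<gamma> + int k"] by (intro coset_unique[OF q_Suc]) auto
  qed
  show "c l = d l"
    using eq[of "nat (l - \<gamma>)"] c(1)[of l] d(1)[of l] by (cases "l < \<gamma>") auto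
qed

text \<open>The greedy algorithm: subtract from the remainder the unique digit that moves it into the next smaller ball.  The
leading digit is nonzero because \<open>x\<close> lies in no smaller ball than the one of its order.\<close>

lemma digit_sequence_exists:
  assumes x: "x \<noteq> 0" shows "\<exists>c. is_digit_sequence x c"
proof -
  define \<gamma> where "\<gamma> = adele_ord a emb x"
  define dig where "dig n y = (SOME j. j < digit_base n \<and> y - emb (q n * of_nat j) \<in> B (n + 1))" for n y
  have dig: "dig n y < digit_base n" "y - emb (q n * of_nat (dig n y)) \<in> B (n + 1)" if "y \<in> B n" for n y
    using someI_ex[of "\<lambda>j. j < digit_base n \<and> y - emb (q n * of_nat j) \<in> B (n + 1)"] coset_exists[OF that q_Suc]
    unfolding dig_def by auto
  define R where "R = rec_nat x (\<lambda>k y. y - emb (q (\<gamma> + int k) * of_nat (dig (\<gamma> + int k) y)))"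
  have R0: "R 0 = x" and RS: "R (Suc k) = R k - emb (q (\<gamma> + int k) * of_nat (dig (\<gamma> + int k) (R k)))" for k
    by (simp_all add: R_def)
  have RB: "R k \<in> B (\<gamma> + int k)" for k
  proof (induction k)
    case 0
    then show ?case using x by (simp add: R0 B_iff_ord \<gamma>_def)
  next
    case (Suc k)
    then show ?case using dig(2)[OF Suc] by (simp add: RS add_ac)
  qed
  define c where "c l = (if l < \<gamma> then 0 else dig l (R (nat (l - \<gamma>))))" for l
  have c: "c (\<gamma> + int k) = dig (\<gamma> + int k) (R k)" for k by (simp add: c_def)
  let ?f = "\<lambda>k::nat. emb (of_nat (c (\<gamma> + int k)) * q (\<gamma> + int k))"
  have partial: "(\<Sum>k<n. ?f k) = x - R n" for n
    by (induction n) (simp_all add: R0 RS c mult.commute)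
  have "R \<longlonglongrightarrow> 0"
  proof (rule metric_LIMSEQ_I)
    fix e :: real assume "e > 0"
    then obtain m :: nat where m: "radius (int m) < e" using radius_small by blast
    have "dist (R n) 0 < e" if "n \<ge> nat (int m - \<gamma>)" for n
    proof -
      have "int m \<le> \<gamma> + int n" using that by linarith
      then have "R n \<in> B (int m)" using RB[of n] B_antimono by blast
      then show ?thesis using m by (simp add: B_iff)
    qed
    then show "\<exists>N. \<forall>n\<ge>N. dist (R n) 0 < e" by blast
  qed
  then have "(\<lambda>n. x - R n) \<longlonglongrightarrow> x - 0" by (intro tendsto_intros)
  then have sums: "?f sums x" by (simp add: sums_def partial)
  have "c \<gamma> \<noteq> 0"
  proof
    assume "c \<gamma> = 0"
    then have "dig \<gamma> x = 0" using c[of 0] by (simp add: R0)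
    then have "x \<in> B (\<gamma> + 1)" using RB[of 1] RS[of 0] by (simp add: R0 emb_0)
    then show False using x by (simp add: B_iff_ord \<gamma>_def)
  qed
  moreover have "c l < digit_base l" if "l \<ge> \<gamma>" for l
    using dig(1)[OF RB[of "nat (l - \<gamma>)"]] c[of "nat (l - \<gamma>)"] that by simp
  ultimately have "is_digit_sequence x c"
    using sums by (simp add: is_digit_sequence_def Let_def digit_bound_iff c_def flip: \<gamma>_def)
  then show ?thesis by (rule exI[of _ c])
qed

lemma adele_digits: "x \<noteq> 0 \<Longrightarrow> is_digit_sequence x (adele_digits a emb x)"
  unfolding adele_digits_def is_digit_sequence_def[symmetric]
  using digit_sequence_exists[of x] digit_sequence_unique by (rule theI'[OF ex_ex1I])

text \<open>This is all that the character needs to know about fractional parts.\<close>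

lemma adele_frac: "x - emb (adele_frac a emb x) \<in> B 0"
proof (cases "x \<noteq> 0 \<and> adele_ord a emb x < 0")
  case True
  define \<gamma> where "\<gamma> = adele_ord a emb x"
  define c where "c = adele_digits a emb x"
  define N where "N = nat (- \<gamma>)"
  have N: "\<gamma> + int N = 0" using True by (simp add: N_def \<gamma>_def)
  have "is_digit_sequence x c" using True by (simp add: adele_digits c_def)
  then have sums: "(\<lambda>k::nat. emb (of_nat (c (\<gamma> + int k)) * q (\<gamma> + int k))) sums x"
    by (simp add: is_digit_sequence_def Let_def \<gamma>_def)
  have "adele_frac a emb x = (\<Sum>l=\<gamma>..-1. of_nat (c l) * q l)"
    using True by (simp add: adele_frac_def \<gamma>_def c_def)
  also have "\<dots> = (\<Sum>k<N. of_nat (c (\<gamma> + int k)) * q (\<gamma> + int k))"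
    by (rule sum.reindex_bij_witness[of _ "\<lambda>k. \<gamma> + int k" "\<lambda>l. nat (l - \<gamma>)"]) (use N in auto)
  finally have "x - emb (adele_frac a emb x) = x - (\<Sum>k<N. emb (of_nat (c (\<gamma> + int k)) * q (\<gamma> + int k)))"
    by (simp add: emb_sum)
  then show ?thesis using digit_tail[OF sums, of N] N by simp
next
  case False
  then show ?thesis
    by (cases "x = 0") (auto simp: adele_frac_def emb_0 B_iff_ord)
qed

definition rat_char :: "rat \<Rightarrow> complex" where
  "rat_char r = exp (2 * of_real pi * \<i> * of_rat r)"

lemma rat_char_add: "rat_char (r + s) = rat_char r * rat_char s"
  by (simp add: rat_char_def of_rat_add distrib_left exp_add)

lemma of_rat_complex: "(of_rat r :: complex) = of_real (of_rat r)"
  by (cases r) (simp add: of_rat_rat)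

lemma rat_char_eq_1_iff: "rat_char r = 1 \<longleftrightarrow> r \<in> \<int>"
proof
  assume "rat_char r = 1"
  then obtain n :: int where "2 * pi * of_rat r = of_int (2 * n) * pi"
    unfolding rat_char_def exp_eq_1 by (auto simp: of_rat_complex)
  then have "of_rat r = (of_int n :: real)" by simp
  then have "r = of_int n" by (metis of_rat_eq_iff of_rat_of_int_eq)
  then show "r \<in> \<int>" by simp
next
  assume "r \<in> \<int>"
  then obtain n where "r = of_int n" by (auto elim: Ints_cases)
  then show "rat_char r = 1" unfolding rat_char_def exp_eq_1 by (auto simp: of_rat_complex)
qed

abbreviation \<psi> :: "'a \<Rightarrow> complex" where "\<psi> \<equiv> adele_char a emb"

text \<open>Two rationals that approximate \<open>x\<close> up to $\widehat{\mathbb{Z}}$ differ by an integer, so any of them can replace the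
fractional part.  This makes the character additive and locally constant.\<close>

lemma adele_char_eq: assumes "x - emb r \<in> B 0" shows "\<psi> x = rat_char r"
proof -
  let ?s = "adele_frac a emb x"
  have "(x - emb r) - (x - emb ?s) \<in> B 0" by (rule B_diff[OF assms adele_frac])
  then have "emb (?s - r) \<in> B 0" by (simp add: emb_diff)
  then have "?s - r \<in> \<int>" by (simp add: emb_B_iff lattice_0_iff)
  then have "rat_char (?s - r) = 1" by (simp only: rat_char_eq_1_iff)
  then have "rat_char ?s = rat_char r" using rat_char_add[of r "?s - r"] by simp
  then show ?thesis by (simp add: adele_char_def rat_char_def)
qed

lemma adele_char_add: "\<psi> (x + y) = \<psi> x * \<psi> y"
proof -
  obtain r s where r: "x - emb r \<in> B 0" and s: "y - emb s \<in> B 0" by (metis emb_approx_B)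
  have "(x + y) - emb (r + s) \<in> B 0" using B_add[OF r s] by (simp add: emb_add algebra_simps)
  then show ?thesis using r s by (simp add: adele_char_eq rat_char_add)
qed

lemma adele_char_B: "x \<in> B 0 \<Longrightarrow> \<psi> x = 1"
  using adele_char_eq[of x 0] rat_char_eq_1_iff[of 0] by (simp add: emb_0)

lemma norm_adele_char: "norm (\<psi> x) = 1"
  by (simp add: adele_char_def of_rat_complex norm_exp_eq_Re)

lemma measurable_adele_char [measurable]: "\<psi> \<in> borel_measurable borel"
proof (rule borel_measurableI)
  fix S :: "complex set"
  have "open (\<psi> -` S)"
    unfolding open_dist
  proof (intro ballI exI[of _ "radius 0"] conjI allI impI radius_pos)
    fix x y assume x: "x \<in> \<psi> -` S" and "dist y x < radius 0"
    then have "y - x \<in> B 0" by (simp add: B_iff flip: dist_eq_norm)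
    then have "\<psi> (x + (y - x)) = \<psi> x" by (simp only: adele_char_add adele_char_B mult_1_right)
    then show "y \<in> \<psi> -` S" using x by simp
  qed
  then show "\<psi> -` S \<inter> space borel \<in> sets borel" by simp
qed

text \<open>The test vector is the generator of the lattice of index \<open>m\<close>: multiplying by it turns a rational outside the dual
lattice into a non-integer.\<close>

lemma adele_char_nontrivial:
  assumes "x \<notin> B (- m)" shows "emb (q m) \<in> B m" "\<psi> (- (x * emb (q m))) \<noteq> 1"
proof -
  show m: "emb (q m) \<in> B m" using lattice_mult_of_int[of m 1] by (simp add: emb_B_iff)
  obtain r where r: "x - emb r \<in> B (- m)" by (rule emb_approx_B)
  have "r \<notin> lattice (- m)"
  proof
    assume "r \<in> lattice (- m)"
    then have "(x - emb r) + emb r \<in> B (- m)" by (intro B_add r) (simp add: emb_B_iff)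
    with assms show False by simp
  qed
  then have "r * q m \<notin> \<int>"
  proof (rule contrapos_nn)
    assume "r * q m \<in> \<int>"
    then obtain k where "r * q m = of_int k" by (auto elim: Ints_cases)
    then have "r = q (- m) * of_int k" using q_pos[of m] by (simp add: q_uminus field_simps)
    then show "r \<in> lattice (- m)" by (simp only: lattice_mult_of_int)
  qed
  moreover have "\<psi> (- (x * emb (q m))) = rat_char (- (r * q m))"
  proof (rule adele_char_eq)
    have "(x - emb r) * emb (q m) \<in> B 0" using mult_B[OF r, of "emb (q m)"] m by simp
    then have "- ((x - emb r) * emb (q m)) \<in> B 0" by simp
    then show "- (x * emb (q m)) - emb (- (r * q m)) \<in> B 0"
      by (simp add: emb_uminus emb_mult algebra_simps)
  qed
  ultimately show "\<psi> (- (x * emb (q m))) \<noteq> 1"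
    by (simp add: rat_char_eq_1_iff minus_in_Ints_iff)
qed

end

section \<open>Haar measure and the Fourier transform of balls\<close>

locale adele_haar = adele_ring a emb for a :: "nat \<Rightarrow> nat" and emb :: "rat \<Rightarrow> 'a::polish_ring" +
  fixes \<mu> :: "'a measure"
  assumes haar: "normalized_haar a emb \<mu>"
begin

lemma sets_\<mu> [simp, measurable_cong]: "sets \<mu> = sets borel"
  using haar by (simp add: normalized_haar_def haar_measure_def)

lemma space_\<mu> [simp]: "space \<mu> = UNIV"
  using sets_eq_imp_space_eq[OF sets_\<mu>] by simp

lemma measurable_translation [measurable]: "(\<lambda>y. x + y :: 'a) \<in> borel_measurable borel"
  by (intro borel_measurable_add) auto

lemma emeasure_translate: "A \<in> sets borel \<Longrightarrow> emeasure \<mu> ((\<lambda>y. x + y) ` A) = emeasure \<mu> A"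
  using haar by (simp add: normalized_haar_def haar_measure_def)

lemma translation_vimage: "(\<lambda>y. x + y) -` A = (\<lambda>y. - x + y) ` (A :: 'a set)"
proof (intro equalityI subsetI)
  fix y assume "y \<in> (\<lambda>y. x + y) -` A"
  then have "- x + (x + y) \<in> (\<lambda>y. - x + y) ` A" by (intro imageI) simp
  then show "y \<in> (\<lambda>y. - x + y) ` A" by simp
qed auto

lemma distr_translate: "distr \<mu> borel (\<lambda>y. x + y) = \<mu>"
proof (rule measure_eqI)
  fix A assume "A \<in> sets (distr \<mu> borel (\<lambda>y. x + y))"
  then have A: "A \<in> sets borel" by simp
  have "emeasure (distr \<mu> borel (\<lambda>y. x + y)) A = emeasure \<mu> ((\<lambda>y. x + y) -` A \<inter> space \<mu>)"
    by (rule emeasure_distr) (use A in simp_all)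
  then show "emeasure (distr \<mu> borel (\<lambda>y. x + y)) A = emeasure \<mu> A"
    by (simp only: space_\<mu> Int_UNIV_right translation_vimage emeasure_translate[OF A])
qed simp

lemma emeasure_B_0: "emeasure \<mu> (B 0) = 1"
proof -
  have "B 0 = {x. adele_norm a emb x \<le> 1}" by (auto simp: B_iff adele_norm_eq_dist radius_def q_0)
  then show ?thesis using haar by (simp add: normalized_haar_def)
qed

text \<open>A ball is the disjoint union of \<open>K\<close> cosets of the smaller one, all of the same measure.\<close>

lemma emeasure_B_cosets:
  assumes K: "q m = q n * of_nat K"
  shows "emeasure \<mu> (B n) = of_nat K * emeasure \<mu> (B m)"
proof -
  have K0: "K > 0" using K q_pos[of m] by (auto intro: gr0I)
  have "q n \<le> q m" using K q_pos[of n] K0 by simp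
  then have nm: "n \<le> m" by (simp add: q_le_iff)
  let ?C = "\<lambda>j. (\<lambda>y. emb (q n * of_nat j) + y) ` B m"
  have C_iff: "x \<in> ?C j \<longleftrightarrow> x - emb (q n * of_nat j) \<in> B m" for x j
    by (auto simp: image_iff intro!: bexI[of _ "x - emb (q n * of_nat j)"])
  have C_meas: "?C j \<in> sets \<mu>" for j
  proof -
    have "?C j = (\<lambda>y. - emb (q n * of_nat j) + y) -` B m \<inter> space borel"
      using translation_vimage[of "- emb (q n * of_nat j)" "B m"] by simp
    also have "\<dots> \<in> sets borel" by (rule measurable_sets[OF measurable_translation B_measurable])
    finally show ?thesis by simp
  qed
  have "B n = (\<Union>j<K. ?C j)"
  proof (intro equalityI subsetI)
    fix x assume "x \<in> B n"
    then show "x \<in> (\<Union>j<K. ?C j)" using coset_exists[OF _ K] by (simp only: UN_iff C_iff) blast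
  next
    fix x assume "x \<in> (\<Union>j<K. ?C j)"
    then obtain j where "x - emb (q n * of_nat j) \<in> B m" by (auto simp only: UN_iff C_iff)
    then have "x - emb (q n * of_nat j) \<in> B n" using B_antimono[OF nm] by auto
    moreover have "emb (q n * of_nat j) \<in> B n" using lattice_mult_of_int[of n "int j"] by (simp add: emb_B_iff)
    ultimately have "(x - emb (q n * of_nat j)) + emb (q n * of_nat j) \<in> B n" by (rule B_add)
    then show "x \<in> B n" by simp
  qed
  moreover have "emeasure \<mu> (\<Union>j<K. ?C j) = (\<Sum>j<K. emeasure \<mu> (?C j))"
  proof (rule sum_emeasure[symmetric])
    show "disjoint_family_on ?C {..<K}"
      unfolding disjoint_family_on_def
    proof (intro ballI impI equals0I)
      fix i j x assume "i \<in> {..<K}" "j \<in> {..<K}" "i \<noteq> j" "x \<in> ?C i \<inter> ?C j"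
      then show False using coset_unique[OF K, of i j x] by (simp only: Int_iff C_iff lessThan_iff) blast
    qed
  qed (use C_meas in auto)
  moreover have "emeasure \<mu> (?C j) = emeasure \<mu> (B m)" for j
    by (rule emeasure_translate) simp
  ultimately show ?thesis by simp
qed

lemma emeasure_B: "emeasure \<mu> (B n) = ennreal (radius n)"
proof (cases "0 \<le> n")
  case True
  obtain K where K: "q n = q 0 * of_nat K" using q_quotient_nat[OF True] by blast
  have K0: "K > 0" using K q_pos[of n] by (auto intro: gr0I)
  have "1 = of_nat K * emeasure \<mu> (B n)" using emeasure_B_cosets[OF K] emeasure_B_0 by simp
  then have fin: "emeasure \<mu> (B n) \<noteq> \<infinity>" using K0 by (auto simp: ennreal_mult_top)
  then have "1 = real K * measure \<mu> (B n)"
    using \<open>1 = of_nat K * emeasure \<mu> (B n)\<close>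
    by (simp add: emeasure_eq_ennreal_measure ennreal_of_nat_eq_real_of_nat flip: ennreal_mult' ennreal_1)
  then have "measure \<mu> (B n) = radius n" using K K0 by (simp add: radius_def q_0 field_simps)
  then show ?thesis using fin by (simp add: emeasure_eq_ennreal_measure)
next
  case False
  then obtain K where K: "q 0 = q n * of_nat K" using q_quotient_nat[of n 0] by auto
  have "of_rat (q n * of_nat K) = (1 :: real)" using K by (simp add: q_0)
  then have "radius n = real K"
    using q_pos[of n] by (simp add: radius_def of_rat_mult field_simps)
  then show ?thesis using emeasure_B_cosets[OF K] emeasure_B_0 by (simp add: ennreal_of_nat_eq_real_of_nat)
qed

lemma measure_B: "measure \<mu> (B n) = radius n"
  using radius_pos[of n] by (simp add: measure_def emeasure_B)

lemma B_exhausts: "(\<Union>n::nat. B (- int n)) = UNIV"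
proof (intro equalityI subsetI UNIV_I)
  fix x :: 'a
  obtain n where "dist x 0 \<le> radius (- int n)" using radius_large by blast
  then show "x \<in> (\<Union>n::nat. B (- int n))" by (auto simp: B_iff)
qed

lemma sigma_finite_\<mu>: "sigma_finite_measure \<mu>"
proof
  show "\<exists>A. countable A \<and> A \<subseteq> sets \<mu> \<and> \<Union> A = space \<mu> \<and> (\<forall>a\<in>A. emeasure \<mu> a \<noteq> \<infinity>)"
    using B_exhausts
    by (intro exI[of _ "range (\<lambda>n::nat. B (- int n))"]) (auto simp: emeasure_B)
qed

lemma integrable_char_B: "integrable \<mu> (\<lambda>\<xi>. indicator (B m) \<xi> * \<psi> (- (x * \<xi>)))"
proof (rule Bochner_Integration.integrable_bound)
  show "integrable \<mu> (indicator (B m) :: 'a \<Rightarrow> real)"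
    by (intro integrable_real_indicator) (auto simp: emeasure_B)
  have "(\<lambda>\<xi>. - (x * \<xi>)) \<in> borel_measurable borel"
    by (intro borel_measurable_continuous_onI continuous_intros)
  then show "(\<lambda>\<xi>. indicator (B m) \<xi> * \<psi> (- (x * \<xi>))) \<in> borel_measurable \<mu>" by measurable
qed (auto simp: norm_mult norm_adele_char indicator_def)

text \<open>Orthogonality: if the character is nontrivial on the ball, translating by a suitable element of the ball multiplies
the integral by a number different from \<open>1\<close>.\<close>

lemma integral_char_B:
  "(LINT \<xi>|\<mu>. indicator (B m) \<xi> * \<psi> (- (x * \<xi>))) = (if x \<in> B (- m) then of_real (radius m) else 0)"
proof (cases "x \<in> B (- m)")
  case True
  have "indicator (B m) \<xi> * \<psi> (- (x * \<xi>)) = complex_of_real (indicator (B m) \<xi>)" for \<xi>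
  proof (cases "\<xi> \<in> B m")
    case \<xi>: True
    then have "- (x * \<xi>) \<in> B 0" using mult_B[OF True, of \<xi>] by simp
    then show ?thesis by (simp add: adele_char_B indicator_def)
  qed simp
  then have "(LINT \<xi>|\<mu>. indicator (B m) \<xi> * \<psi> (- (x * \<xi>))) = (LINT \<xi>|\<mu>. complex_of_real (indicator (B m) \<xi>))"
    by (simp only:)
  also have "\<dots> = complex_of_real (LINT \<xi>|\<mu>. indicator (B m) \<xi>)"
    by (rule integral_complex_of_real)
  also have "(LINT \<xi>|\<mu>. indicator (B m) \<xi> :: real) = radius m" by (simp add: measure_B)
  finally show ?thesis using True by simp
next
  case False
  note z = adele_char_nontrivial[OF False]
  let ?z = "emb (q m)"
  let ?f = "\<lambda>\<xi>. indicator (B m) \<xi> * \<psi> (- (x * \<xi>))"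
  have f: "?f \<in> borel_measurable borel"
    using borel_measurable_integrable[OF integrable_char_B[of m x]] by (simp cong: measurable_cong_sets)
  have "integral\<^sup>L \<mu> ?f = integral\<^sup>L (distr \<mu> borel (\<lambda>y. ?z + y)) ?f" by (simp only: distr_translate)
  also have "\<dots> = (LINT \<xi>|\<mu>. ?f (?z + \<xi>))" by (intro integral_distr f) simp
  also have "\<dots> = (LINT \<xi>|\<mu>. \<psi> (- (x * ?z)) * ?f \<xi>)"
  proof (rule Bochner_Integration.integral_cong[OF refl])
    fix \<xi>
    have "?z + \<xi> \<in> B m \<longleftrightarrow> \<xi> \<in> B m" using B_add[OF z(1), of \<xi>] B_diff[of "?z + \<xi>" m ?z] z(1) by auto
    moreover have "\<psi> (- (x * (?z + \<xi>))) = \<psi> (- (x * ?z)) * \<psi> (- (x * \<xi>))"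
      by (simp add: distrib_left flip: adele_char_add)
    ultimately show "?f (?z + \<xi>) = \<psi> (- (x * ?z)) * ?f \<xi>" by (simp add: indicator_def)
  qed
  also have "\<dots> = \<psi> (- (x * ?z)) * integral\<^sup>L \<mu> ?f" by simp
  finally have "(1 - \<psi> (- (x * ?z))) * integral\<^sup>L \<mu> ?f = 0" by (simp add: algebra_simps)
  then show ?thesis using z(2) False by simp
qed

end

section \<open>The law of the radius\<close>

locale heat = adele_haar a emb \<mu> for a :: "nat \<Rightarrow> nat" and emb :: "rat \<Rightarrow> 'a::polish_ring" and \<mu> :: "'a measure" +
  fixes \<alpha> :: real
  assumes \<alpha>: "\<alpha> > 0"
begin

text \<open>The distribution function of the index of a random ball.  It increases with \<open>n\<close> from \<open>0\<close> to \<open>1\<close> because the radius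
decreases.\<close>

definition F :: "real \<Rightarrow> int \<Rightarrow> real" where
  "F t n = exp (- t * radius n powr \<alpha>)"

text \<open>The measure on the real line with distribution function \<open>x \<mapsto> F t \<lfloor>x\<rfloor>\<close> is carried to the integers by rounding up,
because \<open>\<lceil>x\<rceil> \<le> n\<close> is the same as \<open>x \<le> n\<close>.\<close>

definition \<kappa> :: "real \<Rightarrow> int measure" where
  "\<kappa> t = distr (interval_measure (\<lambda>x. F t \<lfloor>x\<rfloor>)) (count_space UNIV) ceiling"

lemma F_mono: "t > 0 \<Longrightarrow> m \<le> n \<Longrightarrow> F t m \<le> F t n"
  using \<alpha> radius_pos[of n] by (auto simp: F_def radius_le_iff intro!: powr_mono2)

lemma F_add: "F (s + t) n = F s n * F t n"
  by (simp add: F_def algebra_simps flip: exp_add)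

lemma powr_radius_small:
  assumes e: "e > 0" shows "\<exists>n::nat. radius (int n) powr \<alpha> < e"
proof -
  obtain n :: nat where "radius (int n) < e powr (1 / \<alpha>)" using radius_small[of "e powr (1 / \<alpha>)"] e by auto
  then have "radius (int n) powr \<alpha> < (e powr (1 / \<alpha>)) powr \<alpha>"
    using \<alpha> radius_pos[of "int n"] by (intro powr_less_mono2) auto
  also have "\<dots> = e" using \<alpha> e by (simp add: powr_powr)
  finally show ?thesis by blast
qed

lemma powr_radius_large: "\<exists>n::nat. e \<le> radius (- int n) powr \<alpha>"
proof -
  define d where "d = max e 1"
  have d: "d > 0" "e \<le> d" by (auto simp: d_def)
  obtain n :: nat where "d powr (1 / \<alpha>) \<le> radius (- int n)" using radius_large by blast
  then have "(d powr (1 / \<alpha>)) powr \<alpha> \<le> radius (- int n) powr \<alpha>"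
    using \<alpha> d by (intro powr_mono2) auto
  then have "e \<le> radius (- int n) powr \<alpha>" using \<alpha> d by (simp add: powr_powr)
  then show ?thesis ..
qed

lemma F_at_top:
  assumes t: "t > 0" shows "((\<lambda>x::real. F t \<lfloor>x\<rfloor>) \<longlongrightarrow> 1) at_top"
proof (rule order_tendstoI)
  fix e :: real assume "e < 1"
  \<comment> \<open>the logarithm needs a positive bound\<close>
  define e' where "e' = max e (1/2)"
  have e': "e' < 1" "e \<le> e'" "e' > 0" using \<open>e < 1\<close> by (auto simp: e'_def)
  obtain n :: nat where n: "radius (int n) powr \<alpha> < - ln e' / t"
    using powr_radius_small[of "- ln e' / t"] e' t by (auto simp: divide_neg_pos)
  then have "ln e' < - t * radius (int n) powr \<alpha>" using t by (simp add: field_simps)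
  then have "exp (ln e') < F t (int n)" unfolding F_def by (simp only: exp_less_mono)
  then have "e' < F t (int n)" using e' by simp
  then have "e < F t \<lfloor>x\<rfloor>" if "x \<ge> real n" for x
    using F_mono[OF t, of "int n" "\<lfloor>x\<rfloor>"] that e' by (simp add: le_floor_iff)
  then show "\<forall>\<^sub>F x::real in at_top. e < F t \<lfloor>x\<rfloor>" unfolding eventually_at_top_linorder by blast
next
  fix e :: real assume e: "e > 1"
  have "F t n < e" for n
  proof -
    have "F t n \<le> 1" using t by (simp add: F_def)
    with e show ?thesis by simp
  qed
  then show "\<forall>\<^sub>F x::real in at_top. F t \<lfloor>x\<rfloor> < e" by simp
qed

lemma F_at_bot:
  assumes t: "t > 0" shows "((\<lambda>x::real. F t \<lfloor>x\<rfloor>) \<longlongrightarrow> 0) at_bot"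
proof (rule order_tendstoI)
  fix e :: real assume "e < 0"
  then have "e < F t n" for n by (simp add: F_def) (use exp_gt_zero less_trans in blast)
  then show "\<forall>\<^sub>F x::real in at_bot. e < F t \<lfloor>x\<rfloor>" by simp
next
  fix e :: real assume e: "e > 0"
  obtain n :: nat where n: "(1 - ln e) / t \<le> radius (- int n) powr \<alpha>" using powr_radius_large by blast
  then have "- t * radius (- int n) powr \<alpha> < ln e" using t by (simp add: field_simps)
  then have "F t (- int n) < exp (ln e)" unfolding F_def by (simp only: exp_less_mono)
  then have "F t (- int n) < e" using e by simp
  then have "F t \<lfloor>x\<rfloor> < e" if "x \<le> - real n" for x
    using F_mono[OF t, of "\<lfloor>x\<rfloor>" "- int n"] that by (simp add: floor_le_iff)
  then show "\<forall>\<^sub>F x::real in at_bot. F t \<lfloor>x\<rfloor> < e" unfolding eventually_at_bot_linorder by blast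
qed

lemma F_right_continuous: "continuous (at_right x) (\<lambda>x::real. F t \<lfloor>x\<rfloor>)"
proof -
  have "\<forall>\<^sub>F y in at_right x. F t \<lfloor>y\<rfloor> = F t \<lfloor>x\<rfloor>"
    unfolding eventually_at_right_field
  proof (intro exI[of _ "of_int (\<lfloor>x\<rfloor> + 1)"] conjI allI impI)
    show "x < of_int (\<lfloor>x\<rfloor> + 1)" by linarith
    fix y assume "y > x" "y < of_int (\<lfloor>x\<rfloor> + 1)"
    then have "\<lfloor>y\<rfloor> = \<lfloor>x\<rfloor>" by (intro floor_unique) linarith+
    then show "F t \<lfloor>y\<rfloor> = F t \<lfloor>x\<rfloor>" by simp
  qed
  then show ?thesis unfolding continuous_within by (rule tendsto_eventually)
qed

lemma
  assumes t: "t > 0"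
  shows prob_space_\<kappa>: "prob_space (\<kappa> t)" and measure_\<kappa>_atMost: "measure (\<kappa> t) {..n} = F t n"
proof -
  let ?F = "\<lambda>x::real. F t \<lfloor>x\<rfloor>"
  have mono: "?F x \<le> ?F y" if "x \<le> y" for x y using F_mono[OF t floor_mono[OF that]] .
  interpret I: real_distribution "interval_measure ?F"
    by (intro real_distribution_interval_measure mono F_right_continuous F_at_top[OF t] F_at_bot[OF t])
  have m: "ceiling \<in> interval_measure ?F \<rightarrow>\<^sub>M count_space UNIV" by simp
  show "prob_space (\<kappa> t)" unfolding \<kappa>_def by (rule I.prob_space_distr[OF m])
  have "measure (\<kappa> t) {..n} = measure (interval_measure ?F) {..real_of_int n}"
    unfolding \<kappa>_def by (subst measure_distr[OF m]) (auto simp: ceiling_le_iff intro!: arg_cong[where f = I.prob])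
  also have "\<dots> = cdf (interval_measure ?F) (of_int n)" by (simp add: cdf_def)
  also have "\<dots> = F t n"
    by (subst cdf_interval_measure) (auto intro!: mono F_right_continuous F_at_top[OF t] F_at_bot[OF t])
  finally show "measure (\<kappa> t) {..n} = F t n" .
qed

lemma sets_\<kappa> [simp, measurable_cong]: "sets (\<kappa> t) = sets (count_space UNIV)"
  by (simp add: \<kappa>_def)

lemma space_\<kappa> [simp]: "space (\<kappa> t) = UNIV"
  by (simp add: \<kappa>_def)

lemma emeasure_\<kappa>_atMost: "t > 0 \<Longrightarrow> emeasure (\<kappa> t) {..n} = ennreal (F t n)"
  using finite_measure.emeasure_eq_measure[OF prob_space.finite_measure[OF prob_space_\<kappa>]] measure_\<kappa>_atMost by simp

lemma \<kappa>_eqI: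
  assumes N: "prob_space N" "sets N = sets (count_space UNIV)" and t: "t > 0"
    and eq: "\<And>n. emeasure N {..n} = ennreal (F t n)"
  shows "N = \<kappa> t"
proof (rule measure_eqI_generator_eq[where E = "range (\<lambda>n::int. {..n})" and \<Omega> = UNIV and A = "\<lambda>n. {..int n}"])
  let ?G = "range (\<lambda>n::int. {..n})"
  interpret N: prob_space N by (rule N(1))
  show "Int_stable ?G"
  proof (rule Int_stableI)
    fix A B :: "int set" assume "A \<in> range (\<lambda>n. {..n})" "B \<in> range (\<lambda>n. {..n})"
    then obtain m n where "A = {..m}" "B = {..n}" by blast
    then have "A \<inter> B = {..min m n}" by auto
    then show "A \<inter> B \<in> range (\<lambda>n. {..n})" by blast
  qed
  have gen: "sigma_sets UNIV ?G = UNIV"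
  proof -
    interpret S: sigma_algebra UNIV "sigma_sets UNIV ?G"
      by (rule sigma_algebra_sigma_sets) simp
    have "{n} \<in> sigma_sets UNIV ?G" for n
    proof -
      have "{n} = {..n} - {..n - 1}" by auto
      also have "\<dots> \<in> sigma_sets UNIV ?G" by (intro S.Diff sigma_sets.Basic) auto
      finally show ?thesis .
    qed
    then have "(\<Union>n\<in>A. {n}) \<in> sigma_sets UNIV ?G" for A
      by (intro S.countable_UN'') auto
    then show ?thesis by auto
  qed
  show "sets N = sigma_sets UNIV ?G" "sets (\<kappa> t) = sigma_sets UNIV ?G"
    unfolding gen N(2) by simp_all
  show "(\<Union>i. {..int i}) = UNIV"
  proof (intro equalityI subsetI UNIV_I)
    fix z :: int show "z \<in> (\<Union>i. {..int i})" by (intro UN_I[of "nat z"]) auto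
  qed
qed (auto simp: eq emeasure_\<kappa>_atMost t)

lemma measurable_\<kappa>_\<kappa>: "f \<in> UNIV \<rightarrow> space M \<Longrightarrow> f \<in> \<kappa> s \<Otimes>\<^sub>M \<kappa> t \<rightarrow>\<^sub>M M"
proof -
  assume f: "f \<in> UNIV \<rightarrow> space M"
  have "sets (\<kappa> s \<Otimes>\<^sub>M \<kappa> t) = sets (count_space UNIV \<Otimes>\<^sub>M count_space UNIV)"
    by (intro sets_pair_measure_cong) simp_all
  also have "\<dots> = sets (count_space UNIV)"
    by (subst pair_measure_countable) (auto intro: countableI_type)
  finally show ?thesis
    using measurable_cong_sets[of "\<kappa> s \<Otimes>\<^sub>M \<kappa> t" "count_space UNIV" M M] f by simp
qed

text \<open>The distribution function of a maximum of independent variables is the product of theirs.\<close>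

lemma distr_max_\<kappa>:
  assumes s: "s > 0" and t: "t > 0"
  shows "distr (\<kappa> s \<Otimes>\<^sub>M \<kappa> t) (count_space UNIV) (\<lambda>(m, n). max m n) = \<kappa> (s + t)"
proof (rule \<kappa>_eqI)
  let ?M = "distr (\<kappa> s \<Otimes>\<^sub>M \<kappa> t) (count_space UNIV) (\<lambda>(m, n). max m n)"
  interpret S: prob_space "\<kappa> s" using s by (rule prob_space_\<kappa>)
  interpret T: prob_space "\<kappa> t" using t by (rule prob_space_\<kappa>)
  interpret P: pair_prob_space "\<kappa> s" "\<kappa> t" ..
  have m: "(\<lambda>(m, n). max m n) \<in> \<kappa> s \<Otimes>\<^sub>M \<kappa> t \<rightarrow>\<^sub>M count_space UNIV"
    by (rule measurable_\<kappa>_\<kappa>) simp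
  show "prob_space ?M"
    by (rule P.prob_space_distr[OF m])
  show "emeasure ?M {..k} = ennreal (F (s + t) k)" for k
  proof -
    have "(\<lambda>(m, n). max m n) -` {..k} \<inter> space (\<kappa> s \<Otimes>\<^sub>M \<kappa> t) = {..k} \<times> {..k}"
      by (auto simp: space_pair_measure)
    then have "emeasure ?M {..k} = emeasure (\<kappa> s \<Otimes>\<^sub>M \<kappa> t) ({..k} \<times> {..k})"
      by (subst emeasure_distr[OF m]) simp_all
    also have "\<dots> = ennreal (F s k) * ennreal (F t k)"
      by (subst T.emeasure_pair_measure_Times) (simp_all add: emeasure_\<kappa>_atMost s t)
    also have "\<dots> = ennreal (F (s + t) k)"
      unfolding F_add by (rule ennreal_mult[symmetric]) (simp_all add: F_def)
    finally show ?thesis .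
  qed
qed (use s t in simp_all)

text \<open>The ball of index \<open>n\<close> contains a nonzero \<open>\<xi>\<close> exactly when \<open>n\<close> is at most the order of \<open>\<xi>\<close>.\<close>

lemma heat_weight_eq:
  assumes t: "t > 0"
  shows "exp (- t * adele_norm a emb \<xi> powr \<alpha>) = measure (\<kappa> t) {n. \<xi> \<in> B n}"
proof (cases "\<xi> = 0")
  case True
  interpret prob_space "\<kappa> t" using t by (rule prob_space_\<kappa>)
  show ?thesis using True prob_space by (simp add: adele_norm_eq_dist)
next
  case False
  then have "{n. \<xi> \<in> B n} = {..adele_ord a emb \<xi>}" by (auto simp: B_iff_ord)
  then show ?thesis
    using measure_\<kappa>_atMost[OF t] radius_adele_ord[OF False] by (simp add: F_def adele_norm_eq_dist)
qed

text \<open>The radius \<open>r\<close> is the volume of the ball, so this is the integrability of $\exp(-t\|\xi\|^\alpha)$.  The index of the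
ball of radius \<open>r\<close> has probability at most $\exp(-t r^\alpha) \le C/r^2$, and the radii above \<open>1\<close> grow at least like
powers of \<open>2\<close>.\<close>

lemma nn_integral_radius_finite:
  assumes t: "t > 0" shows "(\<integral>\<^sup>+n. ennreal (radius n) \<partial>\<kappa> t) < \<infinity>"
proof -
  interpret prob_space "\<kappa> t" using t by (rule prob_space_\<kappa>)
  have lim: "((\<lambda>y::real. y\<^sup>2 * exp (- t * y powr \<alpha>)) \<longlongrightarrow> 0) at_top"
    using t \<alpha> by real_asymp
  then obtain Y where Y: "\<And>y. y \<ge> Y \<Longrightarrow> y\<^sup>2 * exp (- t * y powr \<alpha>) < 1"
    using order_tendstoD(2)[OF lim, of 1] by (auto simp: eventually_at_top_linorder)
  \<comment> \<open>the product is below \<open>1\<close> from \<open>Y\<close> on, and at most \<open>Y\<^sup>2\<close> before\<close>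
  define C where "C = max 1 (Y\<^sup>2)"
  have bound: "y\<^sup>2 * exp (- t * y powr \<alpha>) \<le> C" if "y > 0" for y
  proof (cases "y \<ge> Y")
    case True
    then show ?thesis using Y[of y] by (simp add: C_def)
  next
    case False
    then have "y\<^sup>2 * exp (- t * y powr \<alpha>) \<le> Y\<^sup>2 * 1"
      using that t by (intro mult_mono power_mono) auto
    then show ?thesis by (simp add: C_def)
  qed
  have radius2: "2 ^ n \<le> radius (- int n)" for n
  proof (induction n)
    case (Suc n)
    have "radius (- int (Suc n)) = of_rat (q (int n + 1))" by (simp only: radius_uminus) (simp add: add.commute)
    also have "\<dots> = radius (- int n) * real (digit_base (int n))" by (simp add: q_Suc of_rat_mult radius_uminus)
    also have "\<dots> \<ge> radius (- int n) * 2"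
    proof -
      have "q (int n) < q (int n + 1)" by (rule q_less) simp
      then have "digit_base (int n) > 1" using q_pos[of "int n"] by (simp add: q_Suc)
      then show ?thesis using radius_pos[of "- int n"] by simp
    qed
    finally show ?case using Suc by simp
  qed (simp add: radius_def q_0)
  have le: "ennreal (radius n) \<le> 1 + (\<Sum>m. ennreal (radius (- int m)) * indicator {- int m} n)" for n
  proof (cases "n \<ge> 0")
    case True
    then have "radius n \<le> radius 0" by (simp add: radius_le_iff)
    then have "ennreal (radius n) \<le> 1" by (simp add: radius_def[of 0] q_0)
    then show ?thesis by (rule order_trans) simp
  next
    case False
    then have n: "n = - int (nat (- n))" by simp
    have "ennreal (radius n) = ennreal (radius (- int (nat (- n)))) * indicator {- int (nat (- n))} n"
      using False by simp
    also have "\<dots> \<le> (\<Sum>m. ennreal (radius (- int m)) * indicator {- int m} n)"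
      using sum_le_suminf[of "\<lambda>m. ennreal (radius (- int m)) * indicator {- int m} n" "{nat (- n)}"] by simp
    finally show ?thesis by (metis add.commute add_increasing2 zero_le)
  qed
  have "(\<integral>\<^sup>+n. ennreal (radius n) \<partial>\<kappa> t) \<le> (\<integral>\<^sup>+n. 1 + (\<Sum>m. ennreal (radius (- int m)) * indicator {- int m} n) \<partial>\<kappa> t)"
    by (intro nn_integral_mono le)
  also have "\<dots> = 1 + (\<Sum>m. \<integral>\<^sup>+n. ennreal (radius (- int m)) * indicator {- int m} n \<partial>\<kappa> t)"
    using emeasure_space_1 by (subst nn_integral_add) (simp_all add: nn_integral_suminf)
  also have "(\<Sum>m. \<integral>\<^sup>+n. ennreal (radius (- int m)) * indicator {- int m} n \<partial>\<kappa> t) \<le> (\<Sum>m. ennreal (C * (1/2) ^ m))"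
  proof (intro suminf_le summableI)
    fix m
    let ?r = "radius (- int m)"
    have r: "?r > 0" by (rule radius_pos)
    have "emeasure (\<kappa> t) {- int m} \<le> emeasure (\<kappa> t) {..- int m}" by (intro emeasure_mono) auto
    also have "\<dots> = ennreal (exp (- t * ?r powr \<alpha>))" by (simp add: emeasure_\<kappa>_atMost t F_def)
    finally have "ennreal ?r * emeasure (\<kappa> t) {- int m} \<le> ennreal ?r * ennreal (exp (- t * ?r powr \<alpha>))"
      by (rule mult_left_mono) simp
    also have "\<dots> = ennreal (?r * exp (- t * ?r powr \<alpha>))" using r by (simp add: ennreal_mult)
    also have "\<dots> \<le> ennreal (C * (1/2) ^ m)"
    proof (rule ennreal_leI)
      have "?r * exp (- t * ?r powr \<alpha>) = (?r\<^sup>2 * exp (- t * ?r powr \<alpha>)) * (1 / ?r)"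
        using r by (simp add: power2_eq_square)
      also have "\<dots> \<le> C * (1 / 2 ^ m)"
        using bound[OF r] radius2[of m] r by (intro mult_mono divide_left_mono) (auto simp: C_def)
      finally show "?r * exp (- t * ?r powr \<alpha>) \<le> C * (1/2) ^ m" by (simp add: power_one_over)
    qed
    finally show "(\<integral>\<^sup>+n. ennreal ?r * indicator {- int m} n \<partial>\<kappa> t) \<le> ennreal (C * (1/2) ^ m)"
      by (simp add: nn_integral_cmult_indicator)
  qed
  also have "(\<Sum>m. ennreal (C * (1/2) ^ m)) = ennreal (\<Sum>m. C * (1/2) ^ m)"
    by (intro suminf_ennreal2 summable_mult summable_geometric) (auto simp: C_def)
  finally show ?thesis by (auto simp: less_top[symmetric] top_unique)
qed

section \<open>The heat kernel as a mixture of balls\<close>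

lemma measurable_\<kappa>_pair:
  assumes "\<And>n. f n \<in> borel \<rightarrow>\<^sub>M M"
  shows "(\<lambda>(n, y). f n y) \<in> \<kappa> t \<Otimes>\<^sub>M borel \<rightarrow>\<^sub>M M"
proof -
  have "(\<lambda>(n, y). f n y) \<in> count_space UNIV \<Otimes>\<^sub>M borel \<rightarrow>\<^sub>M M"
    using assms by (intro measurable_pair_measure_countable1) (auto intro: countableI_type)
  moreover have "sets (\<kappa> t \<Otimes>\<^sub>M borel) = sets (count_space UNIV \<Otimes>\<^sub>M (borel :: 'a measure))"
    by (intro sets_pair_measure_cong) simp_all
  ultimately show ?thesis by (simp cong: measurable_cong_sets)
qed

lemma measurable_\<kappa>_\<mu>_pair:
  assumes "\<And>n. f n \<in> borel \<rightarrow>\<^sub>M M"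
  shows "(\<lambda>(n, y). f n y) \<in> \<kappa> t \<Otimes>\<^sub>M \<mu> \<rightarrow>\<^sub>M M"
  using measurable_\<kappa>_pair[OF assms, where t = t] measurable_cong_sets[OF sets_pair_measure_cong[OF refl sets_\<mu>] refl] by auto

lemma weight_nonneg: "0 \<le> radius n * indicator (B (- n)) x"
  using radius_pos[of n] by (simp add: indicator_def)

lemma integrable_radius:
  assumes t: "t > 0"
  shows "integrable (\<kappa> t) (\<lambda>n. radius n * indicator (B (- n)) x)"
proof -
  have "integrable (\<kappa> t) radius"
    using nn_integral_radius_finite[OF t] radius_pos
    by (intro integrableI_nonneg) (auto intro: less_imp_le)
  then show ?thesis
  proof (rule Bochner_Integration.integrable_bound)
    show "AE n in \<kappa> t. norm (radius n * indicator (B (- n)) x) \<le> norm (radius n)"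
      by (auto simp: indicator_def)
  qed simp
qed

text \<open>Fubini, with the weight written as the probability that the random ball contains \<open>\<xi>\<close>: the inner integral becomes the
Fourier transform of a ball.\<close>

theorem heat_kernel_eq:
  assumes t: "t > 0"
  shows "heat_kernel a emb \<mu> \<alpha> x t = of_real (LINT n|\<kappa> t. radius n * indicator (B (- n)) x)"
proof -
  interpret K: prob_space "\<kappa> t" using t by (rule prob_space_\<kappa>)
  interpret M: sigma_finite_measure \<mu> by (rule sigma_finite_\<mu>)
  interpret P: pair_sigma_finite "\<kappa> t" \<mu> ..
  define f where "f n \<xi> = indicator (B n) \<xi> * \<psi> (- (x * \<xi>))" for n \<xi>
  have f_meas: "f n \<in> borel_measurable borel" for n
  proof -
    have [measurable]: "(\<lambda>\<xi>. - (x * \<xi>)) \<in> borel_measurable borel"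
      by (intro borel_measurable_continuous_onI continuous_intros)
    show ?thesis unfolding f_def by measurable
  qed
  have int: "integrable (\<kappa> t \<Otimes>\<^sub>M \<mu>) (\<lambda>(n, \<xi>). f n \<xi>)"
  proof (rule integrableI_bounded)
    show m: "(\<lambda>(n, \<xi>). f n \<xi>) \<in> borel_measurable (\<kappa> t \<Otimes>\<^sub>M \<mu>)"
      by (rule measurable_\<kappa>_\<mu>_pair) (rule f_meas)
    have "(\<integral>\<^sup>+p. ennreal (norm (case p of (n, \<xi>) \<Rightarrow> f n \<xi>)) \<partial>(\<kappa> t \<Otimes>\<^sub>M \<mu>)) = (\<integral>\<^sup>+n. \<integral>\<^sup>+\<xi>. ennreal (norm (f n \<xi>)) \<partial>\<mu> \<partial>\<kappa> t)"
      using m by (subst M.nn_integral_fst[symmetric]) simp_all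
    also have "\<dots> = (\<integral>\<^sup>+n. \<integral>\<^sup>+\<xi>. indicator (B n) \<xi> \<partial>\<mu> \<partial>\<kappa> t)"
      by (intro nn_integral_cong) (auto simp: f_def norm_mult norm_adele_char indicator_def)
    also have "\<dots> = (\<integral>\<^sup>+n. ennreal (radius n) \<partial>\<kappa> t)"
      by (intro nn_integral_cong) (simp add: emeasure_B)
    finally show "(\<integral>\<^sup>+p. ennreal (norm (case p of (n, \<xi>) \<Rightarrow> f n \<xi>)) \<partial>(\<kappa> t \<Otimes>\<^sub>M \<mu>)) < \<infinity>"
      using nn_integral_radius_finite[OF t] by simp
  qed
  have "heat_kernel a emb \<mu> \<alpha> x t = (LINT \<xi>|\<mu>. LINT n|\<kappa> t. f n \<xi>)"
    unfolding heat_kernel_def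
  proof (rule Bochner_Integration.integral_cong[OF refl])
    fix \<xi>
    have "(LINT n|\<kappa> t. f n \<xi>) = (LINT n|\<kappa> t. complex_of_real (indicator {n. \<xi> \<in> B n} n) * \<psi> (- (x * \<xi>)))"
      unfolding f_def by (intro Bochner_Integration.integral_cong) (auto simp: indicator_def)
    also have "\<dots> = (LINT n|\<kappa> t. complex_of_real (indicator {n. \<xi> \<in> B n} n)) * \<psi> (- (x * \<xi>))"
      by (rule integral_mult_left_zero)
    also have "(LINT n|\<kappa> t. complex_of_real (indicator {n. \<xi> \<in> B n} n)) = complex_of_real (LINT n|\<kappa> t. indicator {n. \<xi> \<in> B n} n)"
      by (rule integral_complex_of_real)
    also have "(LINT n|\<kappa> t. indicator {n. \<xi> \<in> B n} n :: real) = exp (- t * adele_norm a emb \<xi> powr \<alpha>)"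
      by (simp only: heat_weight_eq[OF t]) simp
    finally show "\<psi> (- (x * \<xi>)) * complex_of_real (exp (- t * adele_norm a emb \<xi> powr \<alpha>)) = (LINT n|\<kappa> t. f n \<xi>)"
      by (simp only: mult.commute)
  qed
  also have "\<dots> = (LINT n|\<kappa> t. LINT \<xi>|\<mu>. f n \<xi>)"
    by (rule P.Fubini_integral[OF int])
  also have "\<dots> = (LINT n|\<kappa> t. complex_of_real (radius n * indicator (B (- n)) x))"
    unfolding f_def integral_char_B by (intro Bochner_Integration.integral_cong) (auto simp: indicator_def)
  finally show ?thesis by (simp only: integral_complex_of_real)
qed

lemma heat_kernel_real_nonneg:
  assumes t: "t > 0"
  shows "heat_kernel a emb \<mu> \<alpha> x t \<in> \<real>" "0 \<le> Re (heat_kernel a emb \<mu> \<alpha> x t)"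
  unfolding heat_kernel_eq[OF t]
  by (simp_all only: Reals_of_real Re_complex_of_real Bochner_Integration.integral_nonneg weight_nonneg)

lemma ennreal_heat_kernel:
  assumes t: "t > 0"
  shows "ennreal (Re (heat_kernel a emb \<mu> \<alpha> x t)) = (\<integral>\<^sup>+n. ennreal (radius n) * indicator (B (- n)) x \<partial>\<kappa> t)"
proof -
  have "(\<integral>\<^sup>+n. ennreal (radius n * indicator (B (- n)) x) \<partial>\<kappa> t) = ennreal (LINT n|\<kappa> t. radius n * indicator (B (- n)) x)"
    by (intro nn_integral_eq_integral integrable_radius[OF t] AE_I2 weight_nonneg)
  moreover have "ennreal (radius n * indicator (B (- n)) x) = ennreal (radius n) * indicator (B (- n)) x" for n
    by (simp add: indicator_def)
  ultimately show ?thesis by (simp add: heat_kernel_eq[OF t])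
qed

section \<open>The convolution semigroup\<close>

text \<open>The uniform law on the ball dual to the one of index \<open>n\<close>; its density \<open>radius n\<close> is the inverse of the volume
\<open>radius (- n)\<close>.  With growing \<open>n\<close> these balls grow.\<close>

definition ball_law :: "int \<Rightarrow> 'a measure" where
  "ball_law n = density \<mu> (\<lambda>y. ennreal (radius n) * indicator (B (- n)) y)"

text \<open>The transition law from \<open>0\<close>; at time \<open>0\<close> there is no random ball, and the law is the point mass.\<close>

definition heat_law :: "real \<Rightarrow> 'a measure" where
  "heat_law t = (if t = 0 then return borel 0 else \<kappa> t \<bind> ball_law)"

lemma sets_ball_law [simp, measurable_cong]: "sets (ball_law n) = sets borel"
  by (simp add: ball_law_def)

lemma space_ball_law [simp]: "space (ball_law n) = UNIV"
  by (simp add: ball_law_def)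

lemma emeasure_ball_law:
  assumes A: "A \<in> sets borel" shows "emeasure (ball_law n) A = ennreal (radius n) * emeasure \<mu> (A \<inter> B (- n))"
proof -
  have [measurable]: "A \<in> sets \<mu>" "B (- n) \<in> sets \<mu>" using A by simp_all
  have "emeasure (ball_law n) A = (\<integral>\<^sup>+y. ennreal (radius n) * indicator (B (- n)) y * indicator A y \<partial>\<mu>)"
    unfolding ball_law_def by (rule emeasure_density) measurable
  also have "\<dots> = (\<integral>\<^sup>+y. ennreal (radius n) * indicator (A \<inter> B (- n)) y \<partial>\<mu>)"
    by (intro nn_integral_cong) (auto simp: indicator_def)
  also have "\<dots> = ennreal (radius n) * emeasure \<mu> (A \<inter> B (- n))"
    by (rule nn_integral_cmult_indicator) measurable
  finally show ?thesis .
qed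

lemma radius_mult_uminus: "radius n * radius (- n) = 1"
  using q_pos[of n] unfolding radius_uminus by (simp add: radius_def)

lemma emeasure_ball_law_eq_1: "B (- n) \<subseteq> A \<Longrightarrow> A \<in> sets borel \<Longrightarrow> emeasure (ball_law n) A = 1"
  using radius_pos by (simp add: emeasure_ball_law Int_absorb1 emeasure_B radius_mult_uminus less_imp_le flip: ennreal_mult)

lemma prob_space_ball_law: "prob_space (ball_law n)"
  by (rule prob_spaceI) (simp add: emeasure_ball_law_eq_1)

lemma measurable_ball_law: "ball_law \<in> \<kappa> t \<rightarrow>\<^sub>M prob_algebra borel"
  by (subst measurable_cong_sets[OF sets_\<kappa> refl]) (auto simp: space_prob_algebra prob_space_ball_law)

lemma measurable_ball_law': "ball_law \<in> \<kappa> t \<rightarrow>\<^sub>M subprob_algebra borel"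
  by (rule measurable_prob_algebraD[OF measurable_ball_law])

lemma prob_space_heat_law: "t \<ge> 0 \<Longrightarrow> prob_space (heat_law t)"
  unfolding heat_law_def
  by (auto intro!: prob_space_return prob_space_bind'[OF _ measurable_ball_law] simp: space_prob_algebra prob_space_\<kappa>)

lemma sets_heat_law [simp]: "sets (heat_law t) = sets borel"
  unfolding heat_law_def by (simp add: sets_bind[where N = borel])

lemma space_heat_law [simp]: "space (heat_law t) = UNIV"
  using sets_eq_imp_space_eq[OF sets_heat_law] by simp

lemma emeasure_heat_law:
  assumes "t > 0" "A \<in> sets borel"
  shows "emeasure (heat_law t) A = (\<integral>\<^sup>+n. emeasure (ball_law n) A \<partial>\<kappa> t)"
  unfolding heat_law_def using assms by (simp add: emeasure_bind[OF _ measurable_ball_law'])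

lemma translate_vimage_sets: "A \<in> sets borel \<Longrightarrow> {y. x + y \<in> A} \<in> sets (borel :: 'a measure)"
  using measurable_sets[OF measurable_translation[of x], of A] by (simp add: vimage_def)

lemma emeasure_ball_law_translate:
  assumes A: "A \<in> sets borel"
  shows "emeasure (ball_law n) {y. x + y \<in> A} = ennreal (radius n) * emeasure \<mu> {y \<in> A. x - y \<in> B (- n)}"
proof -
  have s: "{y. x + y \<in> A} \<in> sets borel" using A by (rule translate_vimage_sets)
  have "{y \<in> A. x - y \<in> B (- n)} = (\<lambda>y. x + y) ` ({y. x + y \<in> A} \<inter> B (- n))"
  proof (intro equalityI subsetI)
    fix y assume y: "y \<in> {y \<in> A. x - y \<in> B (- n)}"
    then have "y - x \<in> B (- n)" using B_uminus[of "x - y" "- n"] by simp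
    with y have "y - x \<in> {y. x + y \<in> A} \<inter> B (- n)" by simp
    then have "x + (y - x) \<in> (\<lambda>y. x + y) ` ({y. x + y \<in> A} \<inter> B (- n))" by (rule imageI)
    then show "y \<in> (\<lambda>y. x + y) ` ({y. x + y \<in> A} \<inter> B (- n))" by simp
  qed auto
  then show ?thesis using s by (simp add: emeasure_ball_law emeasure_translate)
qed

lemma emeasure_ball_law_invariant:
  assumes A: "A \<in> sets borel" and x: "x \<in> B (- n)"
  shows "emeasure (ball_law n) {y. x + y \<in> A} = emeasure (ball_law n) A"
proof -
  have "x - y \<in> B (- n) \<longleftrightarrow> y \<in> B (- n)" for y
    using B_diff[OF x, of y] B_diff[OF x, of "x - y"] by auto
  then have "{y \<in> A. x - y \<in> B (- n)} = A \<inter> B (- n)" by auto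
  then show ?thesis unfolding emeasure_ball_law_translate[OF A] emeasure_ball_law[OF A] by simp
qed

text \<open>The density of the transition law is the average of the densities of uniform laws on balls around \<open>x\<close>.\<close>

lemma heat_transition_eq:
  assumes t: "t \<ge> 0"
  shows "heat_transition a emb \<mu> \<alpha> t x = distr (heat_law t) borel (\<lambda>y. x + y)"
proof (cases "t = 0")
  case True
  then show ?thesis by (simp add: heat_transition_def heat_law_def distr_return)
next
  let ?p = "\<lambda>y. ennreal (Re (heat_kernel a emb \<mu> \<alpha> (x - y) t))"
  case False
  with t have t: "t > 0" by simp
  interpret K: prob_space "\<kappa> t" using t by (rule prob_space_\<kappa>)
  interpret M: sigma_finite_measure \<mu> by (rule sigma_finite_\<mu>)
  interpret P: pair_sigma_finite "\<kappa> t" \<mu> ..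
  let ?f = "\<lambda>n y. ennreal (radius n) * indicator (B (- n)) (x - y)"
  have [measurable]: "(\<lambda>y. x - y :: 'a) \<in> borel_measurable borel"
    by (intro borel_measurable_continuous_onI continuous_intros)
  have f: "?f n \<in> borel_measurable borel" for n by measurable
  have f2: "(\<lambda>(n, y). ?f n y) \<in> borel_measurable (\<kappa> t \<Otimes>\<^sub>M \<mu>)"
    by (rule measurable_\<kappa>_\<mu>_pair) (rule f)
  have swap: "(\<lambda>(y, n). ?f n y) \<in> borel_measurable (\<mu> \<Otimes>\<^sub>M \<kappa> t)"
    using measurable_pair_swap[OF f2] by (simp add: split_beta')
  have dens: "?p \<in> borel_measurable \<mu>"
    unfolding ennreal_heat_kernel[OF t] using K.borel_measurable_nn_integral_fst[OF swap] by simp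
  have "heat_transition a emb \<mu> \<alpha> t x = density \<mu> ?p"
    using t by (simp add: heat_transition_def)
  also have "\<dots> = distr (heat_law t) borel (\<lambda>y. x + y)"
  proof (rule measure_eqI)
    fix A assume "A \<in> sets (density \<mu> ?p)"
    then have A: "A \<in> sets borel" by simp
    have Am[measurable]: "A \<in> sets \<mu>" using A by simp
    have s: "{y \<in> A. x - y \<in> B (- n)} \<in> sets borel" for n
    proof -
      have "{y \<in> space borel. y \<in> A \<and> x - y \<in> B (- n)} \<in> sets borel" using A by measurable
      then show ?thesis by simp
    qed
    have "emeasure (density \<mu> ?p) A =
        (\<integral>\<^sup>+y. ennreal (Re (heat_kernel a emb \<mu> \<alpha> (x - y) t)) * indicator A y \<partial>\<mu>)"
      by (rule emeasure_density[OF dens Am])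
    also have "\<dots> = (\<integral>\<^sup>+y. \<integral>\<^sup>+n. ?f n y * indicator A y \<partial>\<kappa> t \<partial>\<mu>)"
      unfolding ennreal_heat_kernel[OF t] by (intro nn_integral_cong nn_integral_multc[symmetric]) simp
    also have "\<dots> = (\<integral>\<^sup>+n. \<integral>\<^sup>+y. ?f n y * indicator A y \<partial>\<mu> \<partial>\<kappa> t)"
    proof (rule P.Fubini')
      show "(\<lambda>(n, y). ?f n y * indicator A y) \<in> borel_measurable (\<kappa> t \<Otimes>\<^sub>M \<mu>)"
        using A by (intro measurable_\<kappa>_\<mu>_pair) measurable
    qed
    also have "\<dots> = (\<integral>\<^sup>+n. ennreal (radius n) * emeasure \<mu> {y \<in> A. x - y \<in> B (- n)} \<partial>\<kappa> t)"
    proof (rule nn_integral_cong)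
      fix n
      have "(\<integral>\<^sup>+y. ?f n y * indicator A y \<partial>\<mu>) = (\<integral>\<^sup>+y. ennreal (radius n) * indicator {y \<in> A. x - y \<in> B (- n)} y \<partial>\<mu>)"
        by (intro nn_integral_cong) (auto simp: indicator_def)
      also have "\<dots> = ennreal (radius n) * emeasure \<mu> {y \<in> A. x - y \<in> B (- n)}"
        using s by (intro nn_integral_cmult_indicator) simp
      finally show "(\<integral>\<^sup>+y. ?f n y * indicator A y \<partial>\<mu>) = ennreal (radius n) * emeasure \<mu> {y \<in> A. x - y \<in> B (- n)}" .
    qed
    also have "\<dots> = emeasure (heat_law t) {y. x + y \<in> A}"
      using A t by (simp add: emeasure_heat_law translate_vimage_sets emeasure_ball_law_translate)
    also have "\<dots> = emeasure (distr (heat_law t) borel (\<lambda>y. x + y)) A"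
      using A by (subst emeasure_distr) (simp_all add: vimage_def measurable_cong_sets[OF sets_heat_law refl])
    finally show "emeasure (density \<mu> ?p) A =
        emeasure (distr (heat_law t) borel (\<lambda>y. x + y)) A" .
  qed simp
  finally show ?thesis .
qed

lemma measurable_ball_law_translate:
  assumes A: "A \<in> sets borel" shows "(\<lambda>x. emeasure (ball_law n) {y. x + y \<in> A}) \<in> borel_measurable borel"
proof -
  interpret U: prob_space "ball_law n" by (rule prob_space_ball_law)
  note [measurable] = A
  have "(\<lambda>p. indicator A (fst p + snd p) :: ennreal) \<in> borel_measurable (borel \<Otimes>\<^sub>M borel)"
    by measurable
  then have "(\<lambda>p. indicator A (fst p + snd p) :: ennreal) \<in> borel_measurable (borel \<Otimes>\<^sub>M ball_law n)"
    by (simp cong: measurable_cong_sets sets_pair_measure_cong)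
  from U.borel_measurable_nn_integral_fst[OF this]
  have "(\<lambda>x. \<integral>\<^sup>+y. indicator A (x + y) \<partial>ball_law n) \<in> borel_measurable borel" by simp
  moreover have "(\<integral>\<^sup>+y. indicator A (x + y) \<partial>ball_law n) = emeasure (ball_law n) {y. x + y \<in> A}" for x
  proof -
    have "(\<integral>\<^sup>+y. indicator A (x + y) \<partial>ball_law n) = (\<integral>\<^sup>+y. indicator {y. x + y \<in> A} y \<partial>ball_law n)"
      by (intro nn_integral_cong) (simp add: indicator_def)
    then show ?thesis using translate_vimage_sets[OF A] by simp
  qed
  ultimately show ?thesis by simp
qed

lemma AE_ball_law: "AE y in ball_law n. y \<in> B (- n)"
proof -
  interpret U: prob_space "ball_law n" by (rule prob_space_ball_law)
  have "emeasure (ball_law n) (B (- n)) = 1" by (rule emeasure_ball_law_eq_1) simp_all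
  then have "U.prob (B (- n)) = 1" by (simp add: measure_def)
  then show ?thesis by (rule U.AE_prob_1)
qed

lemma ball_law_convolution_le:
  assumes A: "A \<in> sets borel" and mn: "m \<le> n"
  shows "(\<integral>\<^sup>+y. emeasure (ball_law n) {z. y + z \<in> A} \<partial>ball_law m) = emeasure (ball_law n) A"
proof -
  interpret U: prob_space "ball_law m" by (rule prob_space_ball_law)
  have "(\<integral>\<^sup>+y. emeasure (ball_law n) {z. y + z \<in> A} \<partial>ball_law m) = (\<integral>\<^sup>+y. emeasure (ball_law n) A \<partial>ball_law m)"
  proof (rule nn_integral_cong_AE)
    show "AE y in ball_law m. emeasure (ball_law n) {z. y + z \<in> A} = emeasure (ball_law n) A"
      using AE_ball_law
    proof eventually_elim
      case (elim y)
      then have "y \<in> B (- n)" using B_antimono[of "- n" "- m"] mn by auto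
      then show ?case by (rule emeasure_ball_law_invariant[OF A])
    qed
  qed
  also have "\<dots> = emeasure (ball_law n) A" using U.emeasure_space_1 by simp
  finally show ?thesis .
qed

text \<open>The law on the larger ball is invariant under translations from the smaller one, so convolution with the smaller
one does not change it; Fubini exchanges the roles of the two.\<close>

lemma ball_law_convolution:
  assumes A: "A \<in> sets borel"
  shows "(\<integral>\<^sup>+y. emeasure (ball_law n) {z. y + z \<in> A} \<partial>ball_law m) = emeasure (ball_law (max m n)) A"
proof (cases "m \<le> n")
  case True
  then show ?thesis using ball_law_convolution_le[OF A True] by (simp add: max_def)
next
  case False
  interpret U: prob_space "ball_law m" by (rule prob_space_ball_law)
  interpret V: prob_space "ball_law n" by (rule prob_space_ball_law)
  interpret P: pair_sigma_finite "ball_law n" "ball_law m" ..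
  note [measurable] = A
  have em: "emeasure (ball_law k) {z. y + z \<in> A} = (\<integral>\<^sup>+z. indicator A (y + z) \<partial>ball_law k)" for k y
  proof -
    have "(\<integral>\<^sup>+z. indicator A (y + z) \<partial>ball_law k) = (\<integral>\<^sup>+z. indicator {z. y + z \<in> A} z \<partial>ball_law k)"
      by (intro nn_integral_cong) (simp add: indicator_def)
    then show ?thesis using translate_vimage_sets[OF A] by simp
  qed
  have "(\<lambda>(z, y). indicator A (y + z) :: ennreal) \<in> borel_measurable (borel \<Otimes>\<^sub>M borel)"
    by measurable
  then have m: "(\<lambda>(z, y). indicator A (y + z) :: ennreal) \<in> borel_measurable (ball_law n \<Otimes>\<^sub>M ball_law m)"
    by (simp cong: measurable_cong_sets sets_pair_measure_cong)
  have "(\<integral>\<^sup>+y. emeasure (ball_law n) {z. y + z \<in> A} \<partial>ball_law m) = (\<integral>\<^sup>+y. \<integral>\<^sup>+z. indicator A (y + z) \<partial>ball_law n \<partial>ball_law m)"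
    by (simp only: em)
  also have "\<dots> = (\<integral>\<^sup>+z. \<integral>\<^sup>+y. indicator A (y + z) \<partial>ball_law m \<partial>ball_law n)"
    by (rule P.Fubini'[OF m])
  also have "\<dots> = (\<integral>\<^sup>+z. emeasure (ball_law m) {y. z + y \<in> A} \<partial>ball_law n)"
    by (simp only: em add.commute)
  also have "\<dots> = emeasure (ball_law m) A"
    using False by (intro ball_law_convolution_le[OF A]) simp
  finally show ?thesis using False by (simp add: max_def)
qed

lemma emeasure_heat_law_convolution:
  assumes s: "s \<ge> 0" and t: "t \<ge> 0" and A: "A \<in> sets borel"
  shows "emeasure (distr (heat_law s \<Otimes>\<^sub>M heat_law t) borel (\<lambda>(x, y). x + y)) A =
    (\<integral>\<^sup>+y. emeasure (heat_law t) {z. y + z \<in> A} \<partial>heat_law s)"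
proof -
  let ?P = "(heat_law s \<Otimes>\<^sub>M heat_law t)"
  let ?g = "\<lambda>(x, y). x + y"
  interpret T: prob_space "heat_law t" by (rule prob_space_heat_law[OF t])
  note [measurable] = A
  have "(\<lambda>(x, y). x + y :: 'a) \<in> borel \<Otimes>\<^sub>M borel \<rightarrow>\<^sub>M borel" by measurable
  then have m: "?g \<in> heat_law s \<Otimes>\<^sub>M heat_law t \<rightarrow>\<^sub>M borel"
    by (simp cong: measurable_cong_sets sets_pair_measure_cong)
  have "emeasure (distr ?P borel ?g) A =
      emeasure ?P (?g -` A \<inter> space ?P)"
    by (rule emeasure_distr[OF m A])
  also have "\<dots> = (\<integral>\<^sup>+y. emeasure (heat_law t) (Pair y -` (?g -` A \<inter> space ?P)) \<partial>heat_law s)"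
    by (rule T.emeasure_pair_measure_alt[OF measurable_sets[OF m A]])
  finally show ?thesis by (simp add: vimage_def space_pair_measure)
qed

lemma heat_law_add:
  assumes s: "s \<ge> 0" and t: "t \<ge> 0"
  shows "heat_law (s + t) = distr (heat_law s \<Otimes>\<^sub>M heat_law t) borel (\<lambda>(x, y). x + y)"
proof (rule measure_eqI)
  fix A assume "A \<in> sets (heat_law (s + t))"
  then have A: "A \<in> sets borel" by simp
  have meas: "(\<lambda>y. emeasure (heat_law t) {z. y + z \<in> A}) \<in> borel_measurable borel" if "t > 0"
  proof -
    interpret K: prob_space "\<kappa> t" using that by (rule prob_space_\<kappa>)
    have "(\<lambda>(n, y). emeasure (ball_law n) {z. y + z \<in> A}) \<in> borel_measurable (\<kappa> t \<Otimes>\<^sub>M borel)"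
      by (rule measurable_\<kappa>_pair) (rule measurable_ball_law_translate[OF A])
    from K.borel_measurable_nn_integral_fst[OF measurable_pair_swap[OF this]]
    show ?thesis using that by (simp add: emeasure_heat_law translate_vimage_sets[OF A])
  qed
  consider "s = 0" | "t = 0" | "s > 0" "t > 0" using s t by linarith
  then have "emeasure (heat_law (s + t)) A = (\<integral>\<^sup>+y. emeasure (heat_law t) {z. y + z \<in> A} \<partial>heat_law s)"
  proof cases
    case 1
    show ?thesis
    proof (cases "t = 0")
      case True
      have "(\<integral>\<^sup>+y. emeasure (return borel 0) {z. y + z \<in> A} \<partial>return borel 0) = (\<integral>\<^sup>+y. indicator A y \<partial>return borel (0::'a))"
        by (intro nn_integral_cong) (simp add: translate_vimage_sets[OF A] indicator_def)
      then show ?thesis using 1 True A by (simp add: heat_law_def)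
    next
      case False
      then have "(\<integral>\<^sup>+y. emeasure (heat_law t) {z. y + z \<in> A} \<partial>return borel 0) = emeasure (heat_law t) {z. 0 + z \<in> A}"
        using t by (intro nn_integral_return meas) auto
      then show ?thesis using 1 by (simp add: heat_law_def[of 0])
    qed
  next
    case 2
    have "(\<integral>\<^sup>+y. emeasure (return borel 0) {z. y + z \<in> A} \<partial>heat_law s) = (\<integral>\<^sup>+y. indicator A y \<partial>heat_law s)"
      by (intro nn_integral_cong) (simp add: translate_vimage_sets[OF A] indicator_def)
    then show ?thesis using 2 A by (simp add: heat_law_def[of 0])
  next
    case 3
    interpret S: prob_space "\<kappa> s" using 3 by (intro prob_space_\<kappa>)
    interpret T: prob_space "\<kappa> t" using 3 by (intro prob_space_\<kappa>)
    have "(\<integral>\<^sup>+y. emeasure (heat_law t) {z. y + z \<in> A} \<partial>heat_law s) =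
        (\<integral>\<^sup>+m. \<integral>\<^sup>+y. emeasure (heat_law t) {z. y + z \<in> A} \<partial>ball_law m \<partial>\<kappa> s)"
      using 3 by (simp add: heat_law_def[of s] nn_integral_bind[OF meas measurable_ball_law'])
    also have "\<dots> = (\<integral>\<^sup>+m. \<integral>\<^sup>+y. \<integral>\<^sup>+n. emeasure (ball_law n) {z. y + z \<in> A} \<partial>\<kappa> t \<partial>ball_law m \<partial>\<kappa> s)"
      using 3 by (simp add: emeasure_heat_law translate_vimage_sets[OF A])
    also have "\<dots> = (\<integral>\<^sup>+m. \<integral>\<^sup>+n. \<integral>\<^sup>+y. emeasure (ball_law n) {z. y + z \<in> A} \<partial>ball_law m \<partial>\<kappa> t \<partial>\<kappa> s)"
    proof (rule nn_integral_cong)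
      fix m
      interpret U: prob_space "ball_law m" by (rule prob_space_ball_law)
      interpret P: pair_sigma_finite "\<kappa> t" "ball_law m" ..
      have "(\<lambda>(n, y). emeasure (ball_law n) {z. y + z \<in> A}) \<in> borel_measurable (\<kappa> t \<Otimes>\<^sub>M borel)"
        by (rule measurable_\<kappa>_pair) (rule measurable_ball_law_translate[OF A])
      then have "(\<lambda>(n, y). emeasure (ball_law n) {z. y + z \<in> A}) \<in> borel_measurable (\<kappa> t \<Otimes>\<^sub>M ball_law m)"
        using measurable_cong_sets[OF sets_pair_measure_cong[OF refl sets_ball_law] refl] by blast
      then show "(\<integral>\<^sup>+y. \<integral>\<^sup>+n. emeasure (ball_law n) {z. y + z \<in> A} \<partial>\<kappa> t \<partial>ball_law m) =
          (\<integral>\<^sup>+n. \<integral>\<^sup>+y. emeasure (ball_law n) {z. y + z \<in> A} \<partial>ball_law m \<partial>\<kappa> t)"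
        by (rule P.Fubini')
    qed
    also have "\<dots> = (\<integral>\<^sup>+m. \<integral>\<^sup>+n. emeasure (ball_law (max m n)) A \<partial>\<kappa> t \<partial>\<kappa> s)"
      by (simp only: ball_law_convolution[OF A])
    also have "\<dots> = (\<integral>\<^sup>+p. (case p of (m, n) \<Rightarrow> emeasure (ball_law (max m n)) A) \<partial>(\<kappa> s \<Otimes>\<^sub>M \<kappa> t))"
    proof -
      have "(\<lambda>(m, n). emeasure (ball_law (max m n)) A) \<in> borel_measurable (\<kappa> s \<Otimes>\<^sub>M \<kappa> t)"
        by (rule measurable_\<kappa>_\<kappa>) simp
      from T.nn_integral_fst[OF this] show ?thesis by simp
    qed
    also have "\<dots> = (\<integral>\<^sup>+k. emeasure (ball_law k) A \<partial>distr (\<kappa> s \<Otimes>\<^sub>M \<kappa> t) (count_space UNIV) (\<lambda>(m, n). max m n))"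
      by (subst nn_integral_distr) (auto intro!: nn_integral_cong measurable_\<kappa>_\<kappa>)
    also have "\<dots> = emeasure (heat_law (s + t)) A"
      using 3 A by (simp add: distr_max_\<kappa> emeasure_heat_law)
    finally show ?thesis by simp
  qed
  then show "emeasure (heat_law (s + t)) A = emeasure (distr (heat_law s \<Otimes>\<^sub>M heat_law t) borel (\<lambda>(x, y). x + y)) A"
    by (simp add: emeasure_heat_law_convolution[OF s t A])
qed simp

text \<open>The ball of radius \<open>r\<close> contains some ball of index \<open>n\<close>, which is dual to the random ball of index \<open>- n\<close>; the random
ball is no larger than that with probability $\exp(-t\,r_{-n}^\alpha)$.\<close>

definition jump_rate :: "real \<Rightarrow> real" where
  "jump_rate r = radius (- int (SOME n. radius (int n) < r)) powr \<alpha>"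

lemma heat_law_cball:
  assumes t: "t \<ge> 0" and r: "r > 0"
  shows "1 - t * jump_rate r \<le> measure (heat_law t) (cball 0 r)"
proof (cases "t = 0")
  case True
  then show ?thesis using r by (simp add: heat_law_def measure_return)
next
  case False
  with t have t: "t > 0" by simp
  interpret N: prob_space "heat_law t" using t by (intro prob_space_heat_law) simp
  define n where "n = (SOME n. radius (int n) < r)"
  have "radius (int n) < r" unfolding n_def by (rule someI_ex[OF radius_small[OF r]])
  then have sub: "B (int n) \<subseteq> cball 0 r" by (auto simp: B_def)
  have "1 - t * jump_rate r \<le> F t (- int n)"
    using exp_ge_add_one_self[of "- t * radius (- int n) powr \<alpha>"] by (simp add: F_def jump_rate_def n_def)
  then have "ennreal (1 - t * jump_rate r) \<le> emeasure (\<kappa> t) {..- int n}"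
    by (simp add: emeasure_\<kappa>_atMost[OF t] ennreal_leI)
  also have "\<dots> = (\<integral>\<^sup>+k. indicator {..- int n} k \<partial>\<kappa> t)" by simp
  also have "\<dots> \<le> (\<integral>\<^sup>+k. emeasure (ball_law k) (cball 0 r) \<partial>\<kappa> t)"
  proof (rule nn_integral_mono)
    fix k
    show "indicator {..- int n} k \<le> emeasure (ball_law k) (cball 0 r)"
    proof (cases "k \<le> - int n")
      case True
      then have "B (- k) \<subseteq> cball 0 r" using B_antimono[of "int n" "- k"] sub by auto
      then show ?thesis using True by (simp add: emeasure_ball_law_eq_1)
    qed simp
  qed
  also have "\<dots> = emeasure (heat_law t) (cball 0 r)" by (simp add: emeasure_heat_law[OF t])
  finally show ?thesis by (simp add: N.emeasure_eq_measure ennreal_le_iff)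
qed

lemma ultrametric_convolution_semigroup_heat_law:
  "ultrametric_convolution_semigroup heat_law jump_rate"
proof (rule ultrametric_convolution_semigroup.intro)
  show "dist (x + z) (y + z) = dist x y" for x y z :: 'a by (rule dist_translate)
  show "dist x z \<le> max (dist x y) (dist y z)" for x y z :: 'a by (rule ultrametric)
  show "compact (cball (0::'a) r)" for r by (rule compact_cball_adele)
  show "heat_law 0 = return borel 0" by (simp add: heat_law_def)
qed (simp_all only: prob_space_heat_law sets_heat_law heat_law_add[symmetric] heat_law_cball)

end

theorem theorem2p12:
  fixes a :: "nat \<Rightarrow> nat" and emb :: "rat \<Rightarrow> 'a::polish_ring" and \<mu> :: "'a measure" and \<alpha> :: real
  assumes "adelic_sequence a"
    and "finite_adeles a emb"
    and "normalized_haar a emb \<mu>"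
    and "\<alpha> > 0"
  shows "(\<forall>t>0. \<forall>x. heat_kernel a emb \<mu> \<alpha> x t \<in> \<real> \<and> 0 \<le> Re (heat_kernel a emb \<mu> \<alpha> x t)) \<and>
    space_homogeneous (heat_transition a emb \<mu> \<alpha>) \<and>
    (\<exists>(S :: (real \<Rightarrow> 'a) measure) F M X.
       markov_process (heat_transition a emb \<mu> \<alpha>) S F M X \<and>
       (\<forall>\<omega>\<in>space S. bounded_trajectory (\<lambda>t. X t \<omega>) \<and>
                    right_continuous_trajectory (\<lambda>t. X t \<omega>) \<and>
                    only_jumps_trajectory (\<lambda>t. X t \<omega>)))"
proof -
  interpret heat a emb \<mu> \<alpha>
    using assms by unfold_locales
  interpret L: ultrametric_convolution_semigroup heat_law jump_rate
    by (rule ultrametric_convolution_semigroup_heat_law)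
  have P: "heat_transition a emb \<mu> \<alpha> t = L.kernel t" if "t \<ge> 0" for t
    using heat_transition_eq[OF that] by (simp add: L.kernel_def fun_eq_iff)
  have "markov_process (heat_transition a emb \<mu> \<alpha>) L.path_algebra L.path_filtration L.path_law (\<lambda>t f. f t)"
    by (rule L.cadlag_markov_process[OF P])
  moreover have "bounded_trajectory f \<and> right_continuous_trajectory f \<and> only_jumps_trajectory f"
    if "f \<in> space L.path_algebra" for f
    using that by (simp add: L.cadlag_paths_def)
  ultimately have "\<exists>(S :: (real \<Rightarrow> 'a) measure) F M X.
       markov_process (heat_transition a emb \<mu> \<alpha>) S F M X \<and>
       (\<forall>\<omega>\<in>space S. bounded_trajectory (\<lambda>t. X t \<omega>) \<and>
                    right_continuous_trajectory (\<lambda>t. X t \<omega>) \<and>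
                    only_jumps_trajectory (\<lambda>t. X t \<omega>))"
    by blast
  then show ?thesis
    using heat_kernel_real_nonneg L.space_homogeneous_kernel[OF P] by blast
qed

end
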